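(* Let $f_1,\dots,f_n:\mathbb{R}^d\to\mathbb{R}$ be differentiable with $\|\nabla f_i(x)-\nabla f_i(y)\|\le \ell\|x-y\|$ for all $x,y$ ($\ell>0$), let $f=\frac1n\sum_{i=1}^n f_i$ satisfy $f^\ast=\inf f>-\infty$, and let a lower bound $f_{\rm low}\le f^\ast$ be known. Let the communication graph be undirected and connected. Let $\mathcal{C}:\mathbb{R}^d\to\mathbb{R}^d$ be a locally-bounded compressor: for some $p\ge1$, $r>0$, $C>0$, $\delta\in(0,1]$, $\big\|\frac{\mathcal{C}(x)}{r}-x\big\|_p\le C(1-\delta)$ for all $x$ with $\|x\|_p\le C$. Let $\{x_{i,k}\}$ be generated by the Unified Compression Algorithm (see context) with $$\alpha=\frac{1}{n^{1/4}\tilde d\sqrt T},\quad \beta=\tau_1\gamma,\quad \gamma>\kappa_2,\quad \omega\in(0,\tfrac1r],\quad \tau_1\ge\kappa_1,\quad T>\tilde\kappa_3,\quad s_0\ge \max_{i}\|x_{i,0}\|_p/C,$$ $$s_k^2=(1-\varepsilon_8)s_{k-1}^2+\tilde\kappa_4(T),\qquad k=1,\dots,T,$$ where the constants are those given in the context. Then, with $\bar x_k=\frac1n\sum_i x_{i,k}$, $$\frac1T\sum_{k=0}^{T-1}\Big(\|\nabla f(\bar x_k)\|^2+\frac1n\sum_{i=1}^n\|x_{i,k}-\bar x_k\|^2\Big)=\mathcal{O}\Big(\frac{n^{1/4}\tilde d}{\sqrt T}\Big),\qquad f(\bar x_T)-f^\ast=\mathcal{O}(1).$$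
   Context: Network: $n\ge2$ agents, weighted undirected connected graph with symmetric nonnegative adjacency matrix $A=[A_{ij}]$, $A_{ij}>0$ iff $(j,i)$ is an edge; Laplacian $L=\mathrm{diag}(\sum_jA_{1j},\dots,\sum_j A_{nj})-A=[L_{ij}]$. $\rho(L)$ is the spectral radius, $\rho_2(L)$ the smallest positive eigenvalue. $\|\cdot\|=\|\cdot\|_2$; $p\in[1,\infty]$. $\hat d=d^{1/p-1/2},\ \tilde d=1$ if $p\in[1,2]$; $\hat d=1,\ \tilde d=d^{1/2-1/p}$ if $p>2$. Unified Compression Algorithm: positive parameters $\alpha,\beta,\gamma,\omega$, positive sequence $\{s_k\}$; $x_{i,0}\in\mathbb{R}^d$ arbitrary, $v_{i,0}=\hat x_{i,-1}=y_{i,-1}=\mathbf 0_d$. For $k=0,1,\dots$ and each $i$: $q_{i,k}=\mathcal{C}((x_{i,k}-\hat x_{i,k-1})/s_k)$, $\hat x_{i,k}=\hat x_{i,k-1}+\omega s_kq_{i,k}$, $y_{i,k}=y_{i,k-1}+\omega s_k\sum_{j=1}^nL_{ij}q_{j,k}$, $x_{i,k+1}=x_{i,k}-\alpha(\beta y_{i,k}+\gamma v_{i,k}+\nabla f_i(x_{i,k}))$, $v_{i,k+1}=v_{i,k}+\alpha\gamma y_{i,k}$. Lyapunov function: $\mathbf{x}_k=\mathrm{col}(x_{1,k},\dots,x_{n,k})$, $\mathbf{v}_k=\mathrm{col}(v_{1,k},\dots,v_{n,k})$, $\mathbf{g}_k^0=\mathrm{col}(\nabla f_1(\bar x_k),\dots,\nabla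 f_n(\bar x_k))$. $\mathbf{E}=(\mathbf{I}_n-\frac1n\mathbf 1_n\mathbf 1_n^\top)\otimes\mathbf{I}_d$. $\mathbf{F}=F\otimes \mathbf{I}_d$, $F=[q\ Q]\,\mathrm{diag}(\lambda_{n+1}^{-1},\Lambda_1^{-1})[q\ Q]^\top$, where $L=[q\ Q]\,\mathrm{diag}(0,\Lambda_1)[q\ Q]^\top$ is an orthogonal eigendecomposition, $q=\mathbf 1_n/\sqrt n$, $\Lambda_1=\mathrm{diag}(\lambda_2,\dots,\lambda_n)$, $0<\lambda_2\le\dots\le\lambda_n$, and $\lambda_{n+1}\in[\lambda_2,\lambda_n]$. $\|x\|_A^2=x^\top Ax$. $\mathcal{L}_{1,k}=\frac12\|\mathbf{x}_k\|_{\mathbf E}^2+\frac12\|\mathbf v_k+\frac1\gamma\mathbf g_k^0\|^2_{\frac{\beta+\gamma}{\gamma}\mathbf F}+\mathbf x_k^\top\mathbf E\mathbf F(\mathbf v_k+\frac1\gamma\mathbf g_k^0)+n(f(\bar x_k)-f^\ast)$. Constants (positive numbers divided by $0$ are $+\infty$): $\kappa_1=4/\rho_2(L)$; $\kappa_2=\max\{2+2\ell^2,\ 5/\rho_2(L),\ (16\ell^2(\kappa_1+1)^2/\rho_2(L))^{1/3},\ 2\sqrt2\,\ell/\rho_2(L)\}$; $\varphi_1=\frac12(\rho_2(L)\beta-(3\gamma+2+2\ell^2))$; $\varphi_2=3\rho^2(L)\beta^2-\rho_2(L)\beta\gamma+(\rho(L)+2)\gamma^2+1+\frac52\ell^2$;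 $\varphi_3=\frac\gamma2-\frac52\rho_2^{-1}(L)$; $\varphi_4=2\rho(L)\gamma^2+\frac12\rho(L)$; $\varphi_5=\frac18-\frac{(\beta+\gamma)^2}{\gamma^5}\rho_2^{-1}(L)\ell^2-\frac1{2\gamma^2}\rho_2^{-2}(L)\ell^2$; $\varphi_6=\frac{\beta+\gamma}{2\gamma^3}\rho_2^{-1}(L)\ell^2+\frac1{2\gamma^2}\rho_2^{-2}(L)\ell^2+\frac12\rho_2^{-2}(L)\ell^2+\frac{\ell^2}2+\frac\ell2$; $\varphi_7=(\rho(L)+1)\gamma+\frac12\rho(L)\beta$; $\varphi_8=3\rho^2(L)\beta^2+(\rho(L)-2\rho_2(L))\beta\gamma+(\rho(L)+2)\gamma^2+1$; $\hat\kappa_0=\min\{\varphi_1/\varphi_2,\varphi_3/\varphi_4,\varphi_5/\varphi_6\}$; $\kappa_7=\min\{\hat\kappa_0,1/(2\ell)\}$; $\varepsilon_1=\frac{\tau_1\rho_2(L)-1}{2\tau_1\rho_2(L)}$; $\varepsilon_5=\omega r(\delta-\delta^2/2)$; $\varepsilon_8=(\varepsilon_5+2\varepsilon_5^2)/2$; $\psi_2=\varphi_7+\alpha\varphi_8$; $\psi_3=4(1+\varepsilon_5^{-1})\hat d^2\beta^2\rho^2(L)$; $\psi_4=4(1+\varepsilon_5^{-1})\hat d^2\max\{\beta^2\rho^2(L)+\ell^2,\ \gamma^2\rho(L)\}/\varepsilon_1$; $\tilde\kappa_3=\max\big\{\frac1{n^{1/2}\tilde d^2\kappa_7^2},\ \frac{(1-2\varepsilon_5)\psi_3}{\varepsilon_8}n^{1/2},\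 \frac{2\psi_4\mathcal L_{1,0}}{\varepsilon_8C^2s_0^2n}\frac{n^{1/2}}{\tilde d^2},\ \frac{4(1-2\varepsilon_5)^2\psi_2^2\psi_4^2}{\varepsilon_8^2}\frac{n^{1/2}}{\tilde d^2},\ \frac{\hat\kappa_3\tilde d^2}{n^{1/2}}\big\}$ with $\hat\kappa_3>0$ an arbitrary fixed constant; $\tilde\kappa_4(T)=\psi_4\mathcal L_{1,0}\alpha^2/C^2+(1-2\varepsilon_5)\psi_2\psi_4n\tilde d^2s_0^2\alpha^3T$. $\mathcal O(\cdot)$ hides factors that do not depend on $T$, $n$, $\tilde d$; they may depend on $\ell,\rho(L),\rho_2(L),\beta,\gamma,\tau_1,\omega,r,\delta,C,s_0,\hat d,\hat\kappa_3$ and on the normalized initial value $\mathcal L_{1,0}/n$ (the paper treats $\mathcal L_{1,0}=\mathcal O(n)$). $T$ is a positive integer fixed in advance.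
   Formalization: The formal theorem additionally assumes κ₇ > 0; for negative κ₇ (possible for large τ₁) the condition T > κ̃₃ sees only κ₇² and the claim fails, as iterates can leave the region where the compressor is controlled. *)

theory Defs
  imports "Jordan_Normal_Form.Spectral_Radius" "HOL-Library.Extended_Real"
begin

text \<open>
  The asymptotic bounds are uniform in the number \<open>n\<close> of agents and in the dimension \<open>d\<close>, so both
  must be quantified inside a formula: points of \<open>\<real>\<^sup>d\<close> are elements of \<^term>\<open>carrier_vec d\<close>.
  Agents are numbered \<open>0, \<dots>, n - 1\<close>.
\<close>

definition norm2 :: "real vec \<Rightarrow> real" where
  "norm2 x = sqrt (x \<bullet> x)"

definition pnorm :: "ereal \<Rightarrow> real vec \<Rightarrow> real" where
  "pnorm p x =
    (if p = \<infinity> then Max ((\<lambda>c. \<bar>x $ c\<bar>) ` {..<dim_vec x})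
     else (\<Sum>c<dim_vec x. \<bar>x $ c\<bar> powr real_of_ereal p) powr (1 / real_of_ereal p))"

text \<open>For \<open>p = \<infinity>\<close>, \<open>1 / p = 0\<close> holds in \<^typ>\<open>ereal\<close>.\<close>

definition d_hat :: "nat \<Rightarrow> ereal \<Rightarrow> real" where
  "d_hat d p = (if p \<le> 2 then real d powr (real_of_ereal (1 / p) - 1 / 2) else 1)"

definition d_tilde :: "nat \<Rightarrow> ereal \<Rightarrow> real" where
  "d_tilde d p = (if p \<le> 2 then 1 else real d powr (1 / 2 - real_of_ereal (1 / p)))"

text \<open>Frechet differentiability, stated directly because \<^typ>\<open>real vec\<close> is not a normed space.\<close>

definition has_gradient :: "nat \<Rightarrow> (real vec \<Rightarrow> real) \<Rightarrow> real vec \<Rightarrow> real vec \<Rightarrow> bool" where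
  "has_gradient d f g x \<longleftrightarrow> g \<in> carrier_vec d \<and>
    (\<forall>e>0. \<exists>t>0. \<forall>h\<in>carrier_vec d. norm2 h < t \<longrightarrow> \<bar>f (x + h) - f x - g \<bullet> h\<bar> \<le> e * norm2 h)"

definition grad :: "nat \<Rightarrow> (real vec \<Rightarrow> real) \<Rightarrow> real vec \<Rightarrow> real vec" where
  "grad d f x = (THE g. has_gradient d f g x)"

definition smooth :: "nat \<Rightarrow> real \<Rightarrow> (real vec \<Rightarrow> real) \<Rightarrow> bool" where
  "smooth d l f \<longleftrightarrow>
    (\<forall>x\<in>carrier_vec d. \<exists>g. has_gradient d f g x) \<and>
    (\<forall>x\<in>carrier_vec d. \<forall>y\<in>carrier_vec d. norm2 (grad d f x - grad d f y) \<le> l * norm2 (x - y))"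

definition avg_fun :: "nat \<Rightarrow> (nat \<Rightarrow> real vec \<Rightarrow> real) \<Rightarrow> real vec \<Rightarrow> real" where
  "avg_fun n f x = (\<Sum>i<n. f i x) / real n"

definition mean_vec :: "nat \<Rightarrow> nat \<Rightarrow> (nat \<Rightarrow> real vec) \<Rightarrow> real vec" where
  "mean_vec n d x = (1 / real n) \<cdot>\<^sub>v finsum_vec TYPE(real) d x {..<n}"

definition connected_network :: "nat \<Rightarrow> real mat \<Rightarrow> bool" where
  "connected_network n A \<longleftrightarrow>
    A \<in> carrier_mat n n \<and> transpose_mat A = A \<and> (\<forall>i<n. \<forall>j<n. A $$ (i, j) \<ge> 0) \<and>
    (\<forall>i<n. \<forall>j<n. (i, j) \<in> {(k, l). k < n \<and> l < n \<and> A $$ (l, k) > 0}\<^sup>*)"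

definition laplacian :: "nat \<Rightarrow> real mat \<Rightarrow> real mat" where
  "laplacian n A = mat_diag n (\<lambda>i. \<Sum>j<n. A $$ (i, j)) - A"

definition smallest_pos_eigenvalue :: "real mat \<Rightarrow> real" where
  "smallest_pos_eigenvalue L = Min {e. eigenvalue L e \<and> e > 0}"

text \<open>
  \<open>U = [q Q]\<close> is orthogonal with first column \<open>q\<close> and \<open>L = U diag(0, \<lambda>\<^sub>2, \<dots>, \<lambda>\<^sub>n) U\<^sup>T\<close>. The indices of
  \<open>lam\<close> are the usual ones, starting at \<open>2\<close>; \<open>lam (n + 1)\<close> is the free parameter \<open>\<lambda>\<^bsub>n+1\<^esub>\<close> that replaces
  the eigenvalue \<open>0\<close> in the matrix \<open>F\<close> below.
\<close>

definition laplacian_eigendecomp :: "nat \<Rightarrow> real mat \<Rightarrow> real mat \<Rightarrow> (nat \<Rightarrow> real) \<Rightarrow> bool" where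
  "laplacian_eigendecomp n L U lam \<longleftrightarrow>
    U \<in> carrier_mat n n \<and> U * transpose_mat U = 1\<^sub>m n \<and> transpose_mat U * U = 1\<^sub>m n \<and>
    col U 0 = vec n (\<lambda>_. 1 / sqrt (real n)) \<and>
    L = U * mat_diag n (\<lambda>i. if i = 0 then 0 else lam (i + 1)) * transpose_mat U \<and>
    0 < lam 2 \<and> (\<forall>i\<in>{2..n}. \<forall>j\<in>{2..n}. i \<le> j \<longrightarrow> lam i \<le> lam j) \<and>
    lam (n + 1) \<in> {lam 2..lam n}"

definition locally_bounded_compressor ::
  "nat \<Rightarrow> ereal \<Rightarrow> real \<Rightarrow> real \<Rightarrow> real \<Rightarrow> (real vec \<Rightarrow> real vec) \<Rightarrow> bool" where
  "locally_bounded_compressor d p r C \<delta> \<C> \<longleftrightarrow>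
    (\<forall>x\<in>carrier_vec d. \<C> x \<in> carrier_vec d) \<and>
    (\<forall>x\<in>carrier_vec d. pnorm p x \<le> C \<longrightarrow> pnorm p ((1 / r) \<cdot>\<^sub>v \<C> x - x) \<le> C * (1 - \<delta>))"

text \<open>The iterate with index \<open>k - 1\<close>, where the iterate with index \<open>-1\<close> is the zero vector.\<close>

definition prev :: "nat \<Rightarrow> (nat \<Rightarrow> real vec) \<Rightarrow> nat \<Rightarrow> real vec" where
  "prev d z k = (if k = 0 then 0\<^sub>v d else z (k - 1))"

text \<open>The sequences are indexed as \<open>x i k\<close>, with agent \<open>i\<close> and iteration \<open>k\<close>.\<close>

definition unified_compression ::
  "nat \<Rightarrow> nat \<Rightarrow> real mat \<Rightarrow> (real vec \<Rightarrow> real vec) \<Rightarrow> (nat \<Rightarrow> real vec \<Rightarrow> real) \<Rightarrow>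
   real \<Rightarrow> real \<Rightarrow> real \<Rightarrow> real \<Rightarrow> (nat \<Rightarrow> real) \<Rightarrow>
   (nat \<Rightarrow> nat \<Rightarrow> real vec) \<Rightarrow> (nat \<Rightarrow> nat \<Rightarrow> real vec) \<Rightarrow> (nat \<Rightarrow> nat \<Rightarrow> real vec) \<Rightarrow>
   (nat \<Rightarrow> nat \<Rightarrow> real vec) \<Rightarrow> (nat \<Rightarrow> nat \<Rightarrow> real vec) \<Rightarrow> bool" where
  "unified_compression n d L \<C> f \<alpha> \<beta> \<gamma> \<omega> s x v q xh y \<longleftrightarrow>
    (\<forall>i<n. x i 0 \<in> carrier_vec d \<and> v i 0 = 0\<^sub>v d \<and> (\<forall>k.
      q i k = \<C> ((1 / s k) \<cdot>\<^sub>v (x i k - prev d (xh i) k)) \<and>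
      xh i k = prev d (xh i) k + (\<omega> * s k) \<cdot>\<^sub>v q i k \<and>
      y i k = prev d (y i) k
        + (\<omega> * s k) \<cdot>\<^sub>v finsum_vec TYPE(real) d (\<lambda>j. L $$ (i, j) \<cdot>\<^sub>v q j k) {..<n} \<and>
      x i (k + 1) = x i k - \<alpha> \<cdot>\<^sub>v (\<beta> \<cdot>\<^sub>v y i k + \<gamma> \<cdot>\<^sub>v v i k + grad d (f i) (x i k)) \<and>
      v i (k + 1) = v i k + (\<alpha> * \<gamma>) \<cdot>\<^sub>v y i k))"

definition kron :: "real mat \<Rightarrow> real mat \<Rightarrow> real mat" where
  "kron A B = mat (dim_row A * dim_row B) (dim_col A * dim_col B)
    (\<lambda>(a, b). A $$ (a div dim_row B, b div dim_col B) * B $$ (a mod dim_row B, b mod dim_col B))"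

definition stack :: "nat \<Rightarrow> nat \<Rightarrow> (nat \<Rightarrow> real vec) \<Rightarrow> real vec" where
  "stack n d x = vec (n * d) (\<lambda>a. x (a div d) $ (a mod d))"

definition wnorm_sq :: "real mat \<Rightarrow> real vec \<Rightarrow> real" where
  "wnorm_sq A x = x \<bullet> (A *\<^sub>v x)"

definition E_mat :: "nat \<Rightarrow> nat \<Rightarrow> real mat" where
  "E_mat n d = kron (1\<^sub>m n - mat n n (\<lambda>_. 1 / real n)) (1\<^sub>m d)"

definition F_mat :: "nat \<Rightarrow> nat \<Rightarrow> real mat \<Rightarrow> (nat \<Rightarrow> real) \<Rightarrow> real mat" where
  "F_mat n d U lam =
    kron (U * mat_diag n (\<lambda>i. if i = 0 then 1 / lam (n + 1) else 1 / lam (i + 1)) * transpose_mat U)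
      (1\<^sub>m d)"

definition f_star :: "nat \<Rightarrow> nat \<Rightarrow> (nat \<Rightarrow> real vec \<Rightarrow> real) \<Rightarrow> real" where
  "f_star n d f = (INF z\<in>carrier_vec d. avg_fun n f z)"

definition lyapunov ::
  "nat \<Rightarrow> nat \<Rightarrow> real mat \<Rightarrow> (nat \<Rightarrow> real) \<Rightarrow> (nat \<Rightarrow> real vec \<Rightarrow> real) \<Rightarrow> real \<Rightarrow> real \<Rightarrow>
   (nat \<Rightarrow> real vec) \<Rightarrow> (nat \<Rightarrow> real vec) \<Rightarrow> real" where
  "lyapunov n d U lam f \<beta> \<gamma> x v =
    (let xm = mean_vec n d x;
         X = stack n d x;
         W = stack n d v + (1 / \<gamma>) \<cdot>\<^sub>v stack n d (\<lambda>i. grad d (f i) xm);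
         E = E_mat n d;
         F = F_mat n d U lam
     in wnorm_sq E X / 2 + wnorm_sq (((\<beta> + \<gamma>) / \<gamma>) \<cdot>\<^sub>m F) W / 2 + X \<bullet> ((E * F) *\<^sub>v W)
        + real n * (avg_fun n f xm - f_star n d f))"

text \<open>
  The quantities on which the factors hidden in \<open>O(\<cdot>)\<close> may depend: the Lipschitz constant \<open>\<ell>\<close>
  (\<open>lip\<close>), the spectral radius and smallest positive eigenvalue of the Laplacian, the algorithm
  parameters, the compressor parameters \<open>r\<close> (\<open>scale\<close>), \<open>C\<close> (\<open>rad\<close>) and \<open>\<delta>\<close>, the initial scaling,
  the value \<open>dh\<close> of \<^const>\<open>d_hat\<close>, the free constant \<open>kh\<close> in the last entry of \<open>\<kappa>\<^sub>3_tilde\<close> below, and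
  the initial value of the Lyapunov function divided by \<open>n\<close> (\<open>lyap0\<close>).
\<close>

record params =
  lip :: real
  \<rho> :: real
  \<rho>\<^sub>2 :: real
  \<beta> :: real
  \<gamma> :: real
  \<tau>\<^sub>1 :: real
  \<omega> :: real
  scale :: real
  \<delta> :: real
  rad :: real
  s\<^sub>0 :: real
  dh :: real
  kh :: real
  lyap0 :: real

definition \<kappa>\<^sub>1 :: "params \<Rightarrow> real" where
  "\<kappa>\<^sub>1 P = 4 / \<rho>\<^sub>2 P"

definition \<kappa>\<^sub>2 :: "params \<Rightarrow> real" where
  "\<kappa>\<^sub>2 P = Max {2 + 2 * (lip P)^2, 5 / \<rho>\<^sub>2 P,
     root 3 (16 * (lip P)^2 * (\<kappa>\<^sub>1 P + 1)^2 / \<rho>\<^sub>2 P), 2 * sqrt 2 * lip P / \<rho>\<^sub>2 P}"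

definition \<phi>\<^sub>1 :: "params \<Rightarrow> real" where
  "\<phi>\<^sub>1 P = (\<rho>\<^sub>2 P * \<beta> P - (3 * \<gamma> P + 2 + 2 * (lip P)^2)) / 2"

definition \<phi>\<^sub>2 :: "params \<Rightarrow> real" where
  "\<phi>\<^sub>2 P = 3 * (\<rho> P)^2 * (\<beta> P)^2 - \<rho>\<^sub>2 P * \<beta> P * \<gamma> P + (\<rho> P + 2) * (\<gamma> P)^2 + 1 + 5 / 2 * (lip P)^2"

definition \<phi>\<^sub>3 :: "params \<Rightarrow> real" where
  "\<phi>\<^sub>3 P = \<gamma> P / 2 - 5 / 2 * (1 / \<rho>\<^sub>2 P)"

definition \<phi>\<^sub>4 :: "params \<Rightarrow> real" where
  "\<phi>\<^sub>4 P = 2 * \<rho> P * (\<gamma> P)^2 + \<rho> P / 2"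

definition \<phi>\<^sub>5 :: "params \<Rightarrow> real" where
  "\<phi>\<^sub>5 P = 1 / 8 - (\<beta> P + \<gamma> P)^2 / (\<gamma> P)^5 * (1 / \<rho>\<^sub>2 P) * (lip P)^2
     - 1 / (2 * (\<gamma> P)^2) * (1 / (\<rho>\<^sub>2 P)^2) * (lip P)^2"

definition \<phi>\<^sub>6 :: "params \<Rightarrow> real" where
  "\<phi>\<^sub>6 P = (\<beta> P + \<gamma> P) / (2 * (\<gamma> P)^3) * (1 / \<rho>\<^sub>2 P) * (lip P)^2
     + 1 / (2 * (\<gamma> P)^2) * (1 / (\<rho>\<^sub>2 P)^2) * (lip P)^2
     + 1 / 2 * (1 / (\<rho>\<^sub>2 P)^2) * (lip P)^2 + (lip P)^2 / 2 + lip P / 2"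

definition \<phi>\<^sub>7 :: "params \<Rightarrow> real" where
  "\<phi>\<^sub>7 P = (\<rho> P + 1) * \<gamma> P + \<rho> P * \<beta> P / 2"

definition \<phi>\<^sub>8 :: "params \<Rightarrow> real" where
  "\<phi>\<^sub>8 P = 3 * (\<rho> P)^2 * (\<beta> P)^2 + (\<rho> P - 2 * \<rho>\<^sub>2 P) * \<beta> P * \<gamma> P + (\<rho> P + 2) * (\<gamma> P)^2 + 1"

definition \<kappa>\<^sub>0_hat :: "params \<Rightarrow> real" where
  "\<kappa>\<^sub>0_hat P = Min {\<phi>\<^sub>1 P / \<phi>\<^sub>2 P, \<phi>\<^sub>3 P / \<phi>\<^sub>4 P, \<phi>\<^sub>5 P / \<phi>\<^sub>6 P}"

text \<open>
  \<open>\<kappa>\<^sub>7\<close> is the upper bound that the first entry of \<open>\<kappa>\<^sub>3_tilde\<close> imposes on the step size. It need not be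
  positive: \<open>\<kappa>\<^sub>2\<close> bounds \<open>\<phi>\<^sub>5\<close> from below only through \<open>\<kappa>\<^sub>1\<close>, whereas \<open>\<phi>\<^sub>5\<close> becomes negative for large
  \<open>\<tau>\<^sub>1\<close>. Since \<open>\<kappa>\<^sub>3_tilde\<close> only sees the square of \<open>\<kappa>\<^sub>7\<close>, positivity has to be required separately; it
  also excludes \<open>\<kappa>\<^sub>7 = 0\<close>, where the entry stands for \<open>\<infinity>\<close>.
\<close>

definition \<kappa>\<^sub>7 :: "params \<Rightarrow> real" where
  "\<kappa>\<^sub>7 P = min (\<kappa>\<^sub>0_hat P) (1 / (2 * lip P))"

definition \<epsilon>\<^sub>1 :: "params \<Rightarrow> real" where
  "\<epsilon>\<^sub>1 P = (\<tau>\<^sub>1 P * \<rho>\<^sub>2 P - 1) / (2 * \<tau>\<^sub>1 P * \<rho>\<^sub>2 P)"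

definition \<epsilon>\<^sub>5 :: "params \<Rightarrow> real" where
  "\<epsilon>\<^sub>5 P = \<omega> P * scale P * (\<delta> P - (\<delta> P)^2 / 2)"

definition \<epsilon>\<^sub>8 :: "params \<Rightarrow> real" where
  "\<epsilon>\<^sub>8 P = (\<epsilon>\<^sub>5 P + 2 * (\<epsilon>\<^sub>5 P)^2) / 2"

definition \<psi>\<^sub>2 :: "params \<Rightarrow> real \<Rightarrow> real" where
  "\<psi>\<^sub>2 P \<alpha> = \<phi>\<^sub>7 P + \<alpha> * \<phi>\<^sub>8 P"

definition \<psi>\<^sub>3 :: "params \<Rightarrow> real" where
  "\<psi>\<^sub>3 P = 4 * (1 + 1 / \<epsilon>\<^sub>5 P) * (dh P)^2 * (\<beta> P)^2 * (\<rho> P)^2"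

definition \<psi>\<^sub>4 :: "params \<Rightarrow> real" where
  "\<psi>\<^sub>4 P = 4 * (1 + 1 / \<epsilon>\<^sub>5 P) * (dh P)^2
     * max ((\<beta> P)^2 * (\<rho> P)^2 + (lip P)^2) ((\<gamma> P)^2 * \<rho> P) / \<epsilon>\<^sub>1 P"

definition step_size :: "nat \<Rightarrow> real \<Rightarrow> nat \<Rightarrow> real" where
  "step_size n dt T = 1 / (real n powr (1 / 4) * dt * sqrt (real T))"

text \<open>Below, \<open>dt\<close> is the value of \<^const>\<open>d_tilde\<close> and \<open>L10\<close> is the initial value of the Lyapunov function.\<close>

definition \<kappa>\<^sub>3_tilde :: "params \<Rightarrow> nat \<Rightarrow> real \<Rightarrow> real \<Rightarrow> real \<Rightarrow> real" where
  "\<kappa>\<^sub>3_tilde P n dt L10 \<alpha> = Max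
    {1 / (sqrt (real n) * dt^2 * (\<kappa>\<^sub>7 P)^2),
     (1 - 2 * \<epsilon>\<^sub>5 P) * \<psi>\<^sub>3 P / \<epsilon>\<^sub>8 P * sqrt (real n),
     2 * \<psi>\<^sub>4 P * L10 / (\<epsilon>\<^sub>8 P * (rad P)^2 * (s\<^sub>0 P)^2 * real n) * (sqrt (real n) / dt^2),
     4 * (1 - 2 * \<epsilon>\<^sub>5 P)^2 * (\<psi>\<^sub>2 P \<alpha>)^2 * (\<psi>\<^sub>4 P)^2 / (\<epsilon>\<^sub>8 P)^2 * (sqrt (real n) / dt^2),
     kh P * dt^2 / sqrt (real n)}"

definition \<kappa>\<^sub>4_tilde :: "params \<Rightarrow> nat \<Rightarrow> real \<Rightarrow> real \<Rightarrow> real \<Rightarrow> nat \<Rightarrow> real" where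
  "\<kappa>\<^sub>4_tilde P n dt L10 \<alpha> T =
     \<psi>\<^sub>4 P * L10 * \<alpha>^2 / (rad P)^2
     + (1 - 2 * \<epsilon>\<^sub>5 P) * \<psi>\<^sub>2 P \<alpha> * \<psi>\<^sub>4 P * real n * dt^2 * (s\<^sub>0 P)^2 * \<alpha>^3 * real T"

end

theory Submission
  imports Defs "HOL-Analysis.L2_Norm"
begin

text \<open>
  In an orthonormal eigenbasis of the Laplacian the linear part of the algorithm decouples into scalar
  modes, and the Lyapunov function becomes a sum of one quadratic form per mode plus the optimality
  gap of the average. Young's inequality, applied per mode, shows that one step decreases it up to
  \<open>\<alpha> \<psi>\<^sub>2\<close> times the squared compression error. Conversely, the distance travelled in one step is
  controlled by the compression error and the Lyapunov function, so by induction the quantity to be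
  compressed never leaves the ball of radius \<open>C s\<^sub>k\<close> on which the compressor is accurate: the
  lower bounds on \<open>T\<close> make the recursion of \<open>s\<^sub>k\<close> absorb both terms. Summing the descent inequality
  gives the rate. If \<open>\<alpha>\<close> is close to \<open>\<kappa>\<^sub>7\<close>, the descent coefficient \<open>\<phi>\<^sub>1 - \<alpha> \<phi>\<^sub>2\<close> may degenerate, but then the
  claimed rate is bounded below and the boundedness of the Lyapunov function suffices.
\<close>

text \<open>Two features shape the argument. The compressor is accurate only on a ball, so the
  Lyapunov bound presupposes that the scaled inputs stay there, while staying there presupposes the
  Lyapunov bound. The circle is broken by \<open>\<kappa>\<^sub>4_tilde\<close>: up to the factor
  \<open>\<psi>\<^sub>4 P * \<alpha>^2 / (rad P)^2\<close> it is the Lyapunov bound over the whole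
  horizon with every \<open>s k\<close> replaced by its initial value, which is legitimate because
  the recursion then keeps \<open>s k\<close> below that value. Moreover, the hidden factor must not
  see n, T or the norm constant dt. All of them cancel through the normalization \<alpha>^2 * sqrt n
  * dt^2 * T = 1, and where a stray power of them remains, an entry of
  \<open>\<kappa>\<^sub>3_tilde\<close> bounds it. The mode of the average is special: the Laplacian
  annihilates it, so it carries no compression error and follows the mean of the local gradients. It
  meets the other modes only through gradient differences, which the consensus error and the
  movement of the average control.\<close>

section \<open>Norms\<close>

text \<open>Bernoulli's inequality: the tangent of the power at 1. Rescaled by a mean value m, it
  yields both Jensen inequalities below, because the linear terms cancel after averaging.\<close>

lemma powr_ge_tangent:
  fixes a x :: real
  assumes "a \<ge> 1" "x \<ge> 0"
  shows "1 + a * (x - 1) \<le> x powr a"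
proof (cases "x = 0")
  case True
  then show ?thesis using assms by simp
next
  case False
  then have x: "x > 0" using assms by simp
  define t where "t = exp (ln x * a)"
  \<comment> \<open>One factor x is split off and exp is bounded by its tangent; x * ln x >= x - 1
    then finishes.\<close>
  have e1: "exp (a * ln x) \<ge> x * (1 + (a - 1) * ln x)"
  proof -
    have "x * exp ((a - 1) * ln x) = exp (ln x + (a - 1) * ln x)"
      using x by (simp add: exp_add)
    also have "ln x + (a - 1) * ln x = a * ln x" by (simp add: algebra_simps)
    finally show ?thesis
      using mult_left_mono[OF exp_ge_add_one_self[of "(a - 1) * ln x"], of x] x by simp
  qed
  have "x * ln x \<ge> x - 1"
  proof -
    have "ln (1 / x) \<le> 1 / x - 1" using x by (intro ln_le_minus_one) simp
    then have "- ln x \<le> 1 / x - 1" using x by (simp add: ln_div)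
    from mult_left_mono[OF this, of x] x show ?thesis by (simp add: algebra_simps)
  qed
  from mult_left_mono[OF this, of "a - 1"] assms
  have "x * (1 + (a - 1) * ln x) \<ge> 1 + a * (x - 1)" by (simp add: algebra_simps)
  with e1 show ?thesis using x by (simp add: powr_def)
qed

text \<open>Jensen with equal weights: the tangent inequality is summed over u c / m, and the
  deviations of u from its mean m add up to zero. Division by m forces the case split.\<close>

lemma powr_sum_mean_le:
  fixes u :: "'b \<Rightarrow> real"
  assumes "finite S" "S \<noteq> {}" "a \<ge> 1" "\<And>c. c \<in> S \<Longrightarrow> u c \<ge> 0"
  shows "((\<Sum>c\<in>S. u c) / real (card S)) powr a \<le> (\<Sum>c\<in>S. u c powr a) / real (card S)"
proof (cases "(\<Sum>c\<in>S. u c) = 0")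
  case True
  then show ?thesis by (auto intro!: sum_nonneg divide_nonneg_nonneg)
next
  case False
  define m where "m = (\<Sum>c\<in>S. u c) / real (card S)"
  have c: "real (card S) > 0" using assms by (simp add: card_gt_0_iff)
  have m: "m > 0" using False assms c sum_nonneg[of S u] unfolding m_def
    by (auto simp: less_le)
  have "m powr a * (1 + a * (u c / m - 1)) \<le> u c powr a" if "c \<in> S" for c
  proof -
    have "m powr a * (1 + a * (u c / m - 1)) \<le> m powr a * (u c / m) powr a"
      using assms that m by (intro mult_left_mono powr_ge_tangent) auto
    also have "\<dots> = u c powr a" using assms that m by (simp add: powr_mult[symmetric])
    finally show ?thesis .
  qed
  then have "(\<Sum>c\<in>S. m powr a * (1 + a * (u c / m - 1))) \<le> (\<Sum>c\<in>S. u c powr a)"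
    by (rule sum_mono)
  also have "(\<Sum>c\<in>S. m powr a * (1 + a * (u c / m - 1)))
      = m powr a * (real (card S) + a * ((\<Sum>c\<in>S. u c) / m - real (card S)))"
    by (simp add: sum_distrib_left[symmetric] sum.distrib sum_subtractf sum_divide_distrib[symmetric])
  also have "(\<Sum>c\<in>S. u c) / m = real (card S)" using False c unfolding m_def by simp
  finally show ?thesis using c unfolding m_def[symmetric] by (simp add: field_simps)
qed

lemma powr_convex_comb_le:
  fixes a b s t :: real
  assumes "p \<ge> 1" "a \<ge> 0" "b \<ge> 0" "s \<ge> 0" "t \<ge> 0" "s + t = 1"
  shows "(s * a + t * b) powr p \<le> s * a powr p + t * b powr p"
proof (cases "s * a + t * b = 0")
  case True
  then show ?thesis using assms by simp
next
  case False
  define m where "m = s * a + t * b"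
  have m: "m > 0" using False assms unfolding m_def by (simp add: add_nonneg_eq_0_iff less_le)
  have tg: "m powr p * (1 + p * (x / m - 1)) \<le> x powr p" if "x \<ge> 0" for x
  proof -
    have "m powr p * (1 + p * (x / m - 1)) \<le> m powr p * (x / m) powr p"
      using assms that m by (intro mult_left_mono powr_ge_tangent) auto
    also have "\<dots> = x powr p" using assms that m by (simp add: powr_mult[symmetric])
    finally show ?thesis .
  qed
  have "s * (m powr p * (1 + p * (a / m - 1))) + t * (m powr p * (1 + p * (b / m - 1)))
      \<le> s * a powr p + t * b powr p"
    using assms by (intro add_mono mult_left_mono tg) auto
  also have "s * (m powr p * (1 + p * (a / m - 1))) + t * (m powr p * (1 + p * (b / m - 1)))
      = m powr p * ((s + t) + p * ((s * a + t * b) / m - (s + t)))"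
    by (simp add: algebra_simps add_divide_distrib)
  also have "\<dots> = m powr p" using assms m unfolding m_def[symmetric] by simp
  finally show ?thesis unfolding m_def .
qed

section \<open>Euclidean norm and p-norms: triangle inequality and comparison\<close>

lemma norm2_nonneg [simp]: "norm2 x \<ge> 0"
  by (simp add: norm2_def scalar_prod_def sum_nonneg)

lemma norm2_sq: "(norm2 x)\<^sup>2 = (\<Sum>c<dim_vec x. (x $ c)\<^sup>2)"
  by (simp add: norm2_def scalar_prod_def sum_nonneg power2_eq_square atLeast0LessThan)

lemma powr_inverse_powr [simp]:
  fixes x :: real assumes "x \<ge> 0" "p \<noteq> 0" shows "(x powr (1 / p)) powr p = x"
  using assms by (simp add: powr_powr)

lemma pnorm_nonneg: "dim_vec x > 0 \<Longrightarrow> pnorm p x \<ge> 0"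
proof -
  assume d: "dim_vec x > 0"
  have "\<bar>x $ 0\<bar> \<le> Max ((\<lambda>c. \<bar>x $ c\<bar>) ` {..<dim_vec x})"
    using d by (intro Max_ge) auto
  then show ?thesis by (auto simp: pnorm_def)
qed

lemma pnorm_infty_le_iff:
  assumes "dim_vec x > 0" shows "pnorm \<infinity> x \<le> b \<longleftrightarrow> (\<forall>c<dim_vec x. \<bar>x $ c\<bar> \<le> b)"
proof -
  have "pnorm \<infinity> x = Max ((\<lambda>c. \<bar>x $ c\<bar>) ` {..<dim_vec x})" by (simp add: pnorm_def)
  moreover have "(\<lambda>c. \<bar>x $ c\<bar>) ` {..<dim_vec x} \<noteq> {}"
    using assms by (metis lessThan_iff image_is_empty empty_iff)
  ultimately show ?thesis using Max_le_iff[of "(\<lambda>c. \<bar>x $ c\<bar>) ` {..<dim_vec x}" b] by auto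
qed

lemma abs_le_pnorm_infty: "c < dim_vec x \<Longrightarrow> \<bar>x $ c\<bar> \<le> pnorm \<infinity> x"
  by (subst pnorm_def) (auto intro!: Max_ge)

lemma pnorm_ereal:
  "pnorm (ereal p) x = (\<Sum>c<dim_vec x. \<bar>x $ c\<bar> powr p) powr (1 / p)"
  by (simp add: pnorm_def)

lemma pnorm_ereal_powr:
  "p \<ge> 1 \<Longrightarrow> (pnorm (ereal p) x) powr p = (\<Sum>c<dim_vec x. \<bar>x $ c\<bar> powr p)"
  by (simp add: pnorm_ereal sum_nonneg)

lemma pnorm_ereal_le_iff:
  assumes "p \<ge> 1" "b \<ge> 0"
  shows "pnorm (ereal p) x \<le> b \<longleftrightarrow> (\<Sum>c<dim_vec x. \<bar>x $ c\<bar> powr p) \<le> b powr p"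
proof -
  have "pnorm (ereal p) x \<ge> 0" by (simp add: pnorm_ereal)
  then have "pnorm (ereal p) x \<le> b \<longleftrightarrow> (pnorm (ereal p) x) powr p \<le> b powr p"
    using assms powr_less_mono2[of p b "pnorm (ereal p) x"] powr_mono2[of p "pnorm (ereal p) x" b]
    by linarith
  then show ?thesis using pnorm_ereal_powr assms by simp
qed

lemma pnorm_smult:
  assumes "dim_vec x > 0" "1 \<le> p"
  shows "pnorm p (a \<cdot>\<^sub>v x) = \<bar>a\<bar> * pnorm p x"
proof (cases p)
  case (real r)
  then have r: "r \<ge> 1" using assms by simp
  have "(\<Sum>c<dim_vec x. \<bar>(a \<cdot>\<^sub>v x) $ c\<bar> powr r) = \<bar>a\<bar> powr r * (\<Sum>c<dim_vec x. \<bar>x $ c\<bar> powr r)"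
    by (simp add: sum_distrib_left abs_mult powr_mult)
  then show ?thesis using r unfolding real
    by (simp add: pnorm_ereal powr_mult sum_nonneg powr_powr)
next
  case PInf
  have ne: "(\<lambda>c. \<bar>x $ c\<bar>) ` {..<dim_vec x} \<noteq> {}" using assms by (auto simp: lessThan_empty_iff)
  have "Max ((\<lambda>y. \<bar>a\<bar> * y) ` (\<lambda>c. \<bar>x $ c\<bar>) ` {..<dim_vec x})
      = \<bar>a\<bar> * Max ((\<lambda>c. \<bar>x $ c\<bar>) ` {..<dim_vec x})"
    using ne by (intro mono_Max_commute[symmetric]) (auto simp: mono_def mult_left_mono)
  moreover have "(\<lambda>c. \<bar>(a \<cdot>\<^sub>v x) $ c\<bar>) ` {..<dim_vec x}
      = (\<lambda>y. \<bar>a\<bar> * y) ` (\<lambda>c. \<bar>x $ c\<bar>) ` {..<dim_vec x}"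
    by (auto simp: image_image abs_mult)
  ultimately show ?thesis unfolding PInf pnorm_def by simp
next
  case MInf
  then show ?thesis using assms by simp
qed

text \<open>Minkowski's inequality from convexity of the power: x + y is a convex combination of x /
  s and y / t, with weights proportional to the two norms. A zero norm forces the vector to vanish
  and is treated apart.\<close>

lemma pnorm_triangle:
  assumes "x \<in> carrier_vec d" "y \<in> carrier_vec d" "d > 0" "1 \<le> p"
  shows "pnorm p (x + y) \<le> pnorm p x + pnorm p y"
proof (cases p)
  case (real r)
  then have r: "r \<ge> 1" using assms by simp
  define a where "a = pnorm p x"
  define b where "b = pnorm p y"
  have ab: "a \<ge> 0" "b \<ge> 0" unfolding a_def b_def using assms by (auto intro!: pnorm_nonneg)
  have sx: "(\<Sum>c<d. \<bar>x $ c\<bar> powr r) = a powr r" and sy: "(\<Sum>c<d. \<bar>y $ c\<bar> powr r) = b powr r"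
    unfolding a_def b_def real using assms pnorm_ereal_powr[OF r, of x] pnorm_ereal_powr[OF r, of y]
    by auto
  show ?thesis
  proof (cases "a = 0 \<or> b = 0")
    case True
    have z: "\<forall>c<d. z $ c = 0" if "(\<Sum>c<d. \<bar>z $ c\<bar> powr r) = 0" for z :: "real vec"
      using that by (subst (asm) sum_nonneg_eq_0_iff) auto
    from True show ?thesis
    proof
      assume "a = 0"
      then have "\<forall>c<d. x $ c = 0" using z[of x] sx by simp
      then have "x + y = y" using assms by auto
      then show ?thesis using ab unfolding a_def b_def by simp
    next
      assume "b = 0"
      then have "\<forall>c<d. y $ c = 0" using z[of y] sy by simp
      then have "x + y = x" using assms by auto
      then show ?thesis using ab unfolding a_def b_def by simp
    qed
  next
    case False
    then have pos: "a > 0" "b > 0" using ab by auto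
    \<comment> \<open>With these weights x / s and y / t both have norm a + b, so the weighted
      powers add up to (a + b) powr r.\<close>
    define s where "s = a / (a + b)"
    define t where "t = b / (a + b)"
    have st: "s > 0" "t > 0" "s + t = 1" "a / s = a + b" "b / t = a + b" unfolding s_def t_def using pos
      by (auto simp: add_divide_distrib[symmetric])
    have "\<bar>(x + y) $ c\<bar> powr r \<le> s * (\<bar>x $ c\<bar> / s) powr r + t * (\<bar>y $ c\<bar> / t) powr r" if "c < d" for c
    proof -
      have "\<bar>(x + y) $ c\<bar> \<le> s * (\<bar>x $ c\<bar> / s) + t * (\<bar>y $ c\<bar> / t)"
        using that assms st by (simp add: abs_triangle_ineq)
      then have "\<bar>(x + y) $ c\<bar> powr r \<le> (s * (\<bar>x $ c\<bar> / s) + t * (\<bar>y $ c\<bar> / t)) powr r"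
        using r by (intro powr_mono2) auto
      also have "\<dots> \<le> s * (\<bar>x $ c\<bar> / s) powr r + t * (\<bar>y $ c\<bar> / t) powr r"
        using st r by (intro powr_convex_comb_le) auto
      finally show ?thesis .
    qed
    then have "(\<Sum>c<d. \<bar>(x + y) $ c\<bar> powr r)
        \<le> (\<Sum>c<d. s * (\<bar>x $ c\<bar> / s) powr r + t * (\<bar>y $ c\<bar> / t) powr r)"
      by (intro sum_mono) auto
    also have "\<dots> = s * ((\<Sum>c<d. \<bar>x $ c\<bar> powr r) / s powr r)
        + t * ((\<Sum>c<d. \<bar>y $ c\<bar> powr r) / t powr r)"
      using st by (simp add: powr_divide sum.distrib sum_distrib_left[symmetric] sum_divide_distrib[symmetric])
    also have "\<dots> = s * (a / s) powr r + t * (b / t) powr r"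
      using st(1,2) pos unfolding sx sy by (simp add: powr_divide)
    also have "\<dots> = (a + b) powr r"
      unfolding st using st(3) by (simp add: distrib_right[symmetric])
    finally show ?thesis
      using pnorm_ereal_le_iff[OF r, of "a + b" "x + y"] ab assms unfolding a_def b_def real by simp
  qed
next
  case PInf
  have "\<bar>(x + y) $ c\<bar> \<le> pnorm \<infinity> x + pnorm \<infinity> y" if "c < d" for c
    using abs_le_pnorm_infty[of c x] abs_le_pnorm_infty[of c y] that assms by auto
  then show ?thesis unfolding PInf using assms by (subst pnorm_infty_le_iff) auto
next
  case MInf
  then show ?thesis using assms by simp
qed

text \<open>Every coordinate is at most the p-norm N, so the excess power q - p of a coordinate can
  be traded for N powr (q - p).\<close>

lemma pnorm_ereal_antimono:
  assumes "1 \<le> p" "p \<le> q" "dim_vec x > 0"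
  shows "pnorm (ereal q) x \<le> pnorm (ereal p) x"
proof -
  define N where "N = pnorm (ereal p) x"
  have N: "N \<ge> 0" unfolding N_def using assms by (auto intro: pnorm_nonneg)
  have sN: "(\<Sum>c<dim_vec x. \<bar>x $ c\<bar> powr p) = N powr p"
    unfolding N_def using pnorm_ereal_powr assms by simp
  have le: "\<bar>x $ c\<bar> \<le> N" if "c < dim_vec x" for c
  proof -
    have "\<bar>x $ c\<bar> powr p \<le> N powr p" unfolding sN[symmetric]
      using that by (intro member_le_sum) auto
    then show ?thesis using N assms powr_less_mono2[of p N "\<bar>x $ c\<bar>"] by linarith
  qed
  have "\<bar>x $ c\<bar> powr q \<le> N powr (q - p) * \<bar>x $ c\<bar> powr p" if "c < dim_vec x" for c
  proof -
    have "\<bar>x $ c\<bar> powr q = \<bar>x $ c\<bar> powr (q - p) * \<bar>x $ c\<bar> powr p" by (simp add: powr_add[symmetric])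
    also have "\<dots> \<le> N powr (q - p) * \<bar>x $ c\<bar> powr p"
      using le[OF that] assms by (intro mult_right_mono powr_mono2) auto
    finally show ?thesis .
  qed
  then have "(\<Sum>c<dim_vec x. \<bar>x $ c\<bar> powr q) \<le> (\<Sum>c<dim_vec x. N powr (q - p) * \<bar>x $ c\<bar> powr p)"
    by (intro sum_mono) auto
  also have "\<dots> = N powr q" by (simp add: sum_distrib_left[symmetric] sN powr_add[symmetric])
  finally show ?thesis unfolding N_def[symmetric] using assms N by (subst pnorm_ereal_le_iff) auto
qed

text \<open>The power mean inequality with exponent q / p, applied to the p-th powers of the
  coordinates.\<close>

lemma pnorm_ereal_le_powr_dim:
  assumes "1 \<le> p" "p \<le> q" "dim_vec x > 0"
  shows "pnorm (ereal p) x \<le> real (dim_vec x) powr (1 / p - 1 / q) * pnorm (ereal q) x"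
proof -
  define N where "N = pnorm (ereal q) x"
  define d where "d = real (dim_vec x)"
  define S where "S = (\<Sum>c<dim_vec x. \<bar>x $ c\<bar> powr p)"
  have N: "N \<ge> 0" unfolding N_def using assms by (auto intro: pnorm_nonneg)
  have d: "d > 0" using assms unfolding d_def by simp
  have S: "S \<ge> 0" unfolding S_def by (auto intro: sum_nonneg)
  have sN: "(\<Sum>c<dim_vec x. \<bar>x $ c\<bar> powr q) = N powr q"
    unfolding N_def using pnorm_ereal_powr assms by simp
  have ne: "{..<dim_vec x} \<noteq> {}" using assms(3) by blast
  have "(S / d) powr (q / p) \<le> (\<Sum>c<dim_vec x. (\<bar>x $ c\<bar> powr p) powr (q / p)) / d"
    using powr_sum_mean_le[of "{..<dim_vec x}" "q / p" "\<lambda>c. \<bar>x $ c\<bar> powr p"] assms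
      ne
    unfolding S_def d_def by simp
  also have "\<dots> = N powr q / d" using assms by (simp add: powr_powr sN)
  finally have "((S / d) powr (q / p)) powr (p / q) \<le> (N powr q / d) powr (p / q)"
    using assms by (intro powr_mono2) auto
  then have "S / d \<le> N powr p / d powr (p / q)"
    using assms S d by (simp add: powr_powr powr_divide)
  then have "S \<le> N powr p * d powr (1 - p / q)"
    using d by (simp add: field_simps powr_diff)
  also have "\<dots> = (d powr (1 / p - 1 / q) * N) powr p"
  proof -
    have "(1 / p - 1 / q) * p = 1 - p / q" using assms by (simp add: field_simps)
    then have "(d powr (1 / p - 1 / q)) powr p = d powr (1 - p / q)" by (simp add: powr_powr)
    then show ?thesis using d N by (simp add: powr_mult)
  qed
  finally show ?thesis unfolding S_def N_def d_def
    using assms N by (subst pnorm_ereal_le_iff) (auto simp: N_def)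
qed

lemma norm2_eq_pnorm: "norm2 x = pnorm 2 x"
proof -
  have "pnorm (ereal 2) x = sqrt (\<Sum>c<dim_vec x. (x $ c)\<^sup>2)"
    unfolding pnorm_ereal by (simp add: powr_half_sqrt sum_nonneg)
  then show ?thesis using norm2_sq[of x] by (simp add: real_sqrt_unique[symmetric])
qed

text \<open>Monotonicity in the exponent settles p at most 2, the power mean inequality larger
  finite p. An infinite exponent is separate because \<open>pnorm\<close> is then a maximum.\<close>

lemma norm2_le_d_tilde_pnorm:
  assumes "x \<in> carrier_vec d" "d > 0" "1 \<le> p"
  shows "norm2 x \<le> d_tilde d p * pnorm p x"
proof (cases p)
  case (real r)
  then have r: "r \<ge> 1" using assms by simp
  show ?thesis
  proof (cases "r \<le> 2")
    case True
    then show ?thesis using pnorm_ereal_antimono[of r 2 x] r assms unfolding real norm2_eq_pnorm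
      by (simp add: d_tilde_def)
  next
    case False
    then show ?thesis using pnorm_ereal_le_powr_dim[of 2 r x] r assms unfolding real norm2_eq_pnorm
      by (simp add: d_tilde_def one_ereal_def)
  qed
next
  case PInf
  define N where "N = pnorm \<infinity> x"
  have N: "N \<ge> 0" unfolding N_def using assms by (auto intro: pnorm_nonneg)
  have "(norm2 x)\<^sup>2 \<le> (\<Sum>c<d. N\<^sup>2)" unfolding norm2_sq
  proof (rule sum_mono2[OF _ _ _, THEN order_trans])
    show "(\<Sum>c<d. (x $ c)\<^sup>2) \<le> (\<Sum>c<d. N\<^sup>2)"
    proof (rule sum_mono)
      fix c assume "c \<in> {..<d}"
      then have "\<bar>x $ c\<bar> \<le> \<bar>N\<bar>" using abs_le_pnorm_infty[of c x] assms N unfolding N_def by auto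
      then show "(x $ c)\<^sup>2 \<le> N\<^sup>2" by (simp add: abs_le_square_iff)
    qed
  qed (use assms in auto)
  also have "\<dots> = (sqrt (real d) * N)\<^sup>2" by (simp add: power_mult_distrib)
  finally have "norm2 x \<le> sqrt (real d) * N" using N by (auto intro: power2_le_imp_le)
  then show ?thesis unfolding PInf N_def by (simp add: d_tilde_def powr_half_sqrt)
next
  case MInf
  then show ?thesis using assms by simp
qed

lemma pnorm_le_d_hat_norm2:
  assumes "x \<in> carrier_vec d" "d > 0" "1 \<le> p"
  shows "pnorm p x \<le> d_hat d p * norm2 x"
proof (cases p)
  case (real r)
  then have r: "r \<ge> 1" using assms by simp
  show ?thesis
  proof (cases "r \<le> 2")
    case True
    then show ?thesis using pnorm_ereal_le_powr_dim[of r 2 x] r assms unfolding real norm2_eq_pnorm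
      by (simp add: d_hat_def one_ereal_def)
  next
    case False
    then show ?thesis using pnorm_ereal_antimono[of 2 r x] r assms unfolding real norm2_eq_pnorm
      by (simp add: d_hat_def)
  qed
next
  case PInf
  have "\<bar>x $ c\<bar> \<le> norm2 x" if "c < d" for c
  proof -
    have "(x $ c)\<^sup>2 \<le> (norm2 x)\<^sup>2" unfolding norm2_sq using that assms by (intro member_le_sum) auto
    then show ?thesis by (simp add: abs_le_square_iff[symmetric])
  qed
  then show ?thesis unfolding PInf using assms by (simp add: d_hat_def pnorm_infty_le_iff)
next
  case MInf
  then show ?thesis using assms by simp
qed

lemma d_tilde_ge_1: "d > 0 \<Longrightarrow> d_tilde d p \<ge> 1"
proof -
  assume d: "d > 0"
  show ?thesis
  proof (cases "p \<le> 2")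
    case False
    have "real_of_ereal (1 / p) \<le> 1 / 2"
    proof (cases p)
      case (real r)
      then have "2 < r" using False by simp
      then show ?thesis unfolding real by (simp add: one_ereal_def)
    qed (use False in auto)
    then have "real d powr (1 / 2 - real_of_ereal (1 / p)) \<ge> 1"
      using d by (intro ge_one_powr_ge_zero) auto
    then show ?thesis using False by (simp add: d_tilde_def)
  qed (simp add: d_tilde_def)
qed

section \<open>Gradients\<close>

lemma norm2_sq_scalar_prod: "(norm2 x)\<^sup>2 = x \<bullet> x"
  by (simp add: norm2_def scalar_prod_def sum_nonneg)

lemma norm2_smult: "norm2 (a \<cdot>\<^sub>v x) = \<bar>a\<bar> * norm2 x"
proof -
  have "(norm2 (a \<cdot>\<^sub>v x))\<^sup>2 = (\<bar>a\<bar> * norm2 x)\<^sup>2"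
    by (simp add: norm2_sq power_mult_distrib sum_distrib_left)
  then show ?thesis by (simp add: power2_eq_iff_nonneg)
qed

lemma scalar_prod_le_norm2:
  assumes "x \<in> carrier_vec d" "y \<in> carrier_vec d"
  shows "x \<bullet> y \<le> norm2 x * norm2 y"
proof -
  have n2: "norm2 z = L2_set (\<lambda>c. z $ c) {..<d}" if "z \<in> carrier_vec d" for z
    using that norm2_sq[of z] unfolding L2_set_def
    by (metis carrier_vecD norm2_nonneg real_sqrt_abs abs_of_nonneg)
  have "x \<bullet> y \<le> (\<Sum>c<d. \<bar>x $ c\<bar> * \<bar>y $ c\<bar>)"
    using assms by (auto simp: scalar_prod_def atLeast0LessThan abs_mult[symmetric] intro!: sum_mono)
  also have "\<dots> \<le> norm2 x * norm2 y"
    unfolding n2[OF assms(1)] n2[OF assms(2)] by (rule L2_set_mult_ineq)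
  finally show ?thesis .
qed

text \<open>Along a small multiple h of u = g - g' both expansions are accurate up to a quarter of
  norm2 u * norm2 h, yet they differ by all of it. Uniqueness gives the definite description in
  \<open>grad\<close> its value.\<close>

lemma has_gradient_unique:
  assumes "has_gradient d f g x" "has_gradient d f g' x"
  shows "g = g'"
proof (rule ccontr)
  assume "g \<noteq> g'"
  have g: "g \<in> carrier_vec d" "g' \<in> carrier_vec d" using assms by (auto simp: has_gradient_def)
  define u where "u = g - g'"
  have u: "u \<in> carrier_vec d" using g by (simp add: u_def)
  define N where "N = norm2 u"
  have "N \<noteq> 0"
  proof
    assume "N = 0"
    then have "(\<Sum>c<d. (u $ c)\<^sup>2) = 0" using norm2_sq[of u] u unfolding N_def by simp
    then have "\<forall>c<d. u $ c = 0" by (simp add: sum_nonneg_eq_0_iff)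
    then have "g = g'" using g unfolding u_def by (intro eq_vecI) auto
    then show False using \<open>g \<noteq> g'\<close> by simp
  qed
  then have N: "N > 0" unfolding N_def using norm2_nonneg[of u] by linarith
  obtain t1 where t1: "t1 > 0" "\<And>h. h \<in> carrier_vec d \<Longrightarrow> norm2 h < t1 \<Longrightarrow>
      \<bar>f (x + h) - f x - g \<bullet> h\<bar> \<le> N / 4 * norm2 h"
    using assms(1) N unfolding has_gradient_def by (meson divide_pos_pos zero_less_numeral)
  obtain t2 where t2: "t2 > 0" "\<And>h. h \<in> carrier_vec d \<Longrightarrow> norm2 h < t2 \<Longrightarrow>
      \<bar>f (x + h) - f x - g' \<bullet> h\<bar> \<le> N / 4 * norm2 h"
    using assms(2) N unfolding has_gradient_def by (meson divide_pos_pos zero_less_numeral)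
  \<comment> \<open>This makes norm2 h half of the smaller radius, hence positive and inside
    both.\<close>
  define s where "s = min t1 t2 / (2 * N)"
  define h where "h = s \<cdot>\<^sub>v u"
  have s: "s > 0" using t1 t2 N by (simp add: s_def)
  have h: "h \<in> carrier_vec d" using u by (simp add: h_def)
  have nh: "norm2 h = min t1 t2 / 2" using s N by (simp add: h_def norm2_smult N_def[symmetric]) (simp add: s_def)
  have "u \<bullet> h = g \<bullet> h - g' \<bullet> h" using g h by (simp add: u_def minus_scalar_prod_distrib)
  moreover have "u \<bullet> h = N * norm2 h"
  proof -
    have "u \<bullet> h = s * (u \<bullet> u)" using u by (simp add: h_def)
    also have "\<dots> = s * N\<^sup>2" by (simp add: N_def norm2_sq_scalar_prod)
    also have "\<dots> = N * norm2 h" using s by (simp add: h_def norm2_smult N_def power2_eq_square)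
    finally show ?thesis .
  qed
  ultimately have "N * norm2 h \<le> N / 4 * norm2 h + N / 4 * norm2 h"
    using t1(2)[OF h] t2(2)[OF h] nh t1(1) t2(1) by linarith
  moreover have "N * norm2 h > 0" using N nh t1(1) t2(1) by simp
  ultimately show False by simp
qed

lemma grad_eqI: "has_gradient d f g x \<Longrightarrow> grad d f x = g"
  unfolding grad_def using has_gradient_unique by blast

lemma smooth_has_gradient:
  assumes "smooth d l f" "x \<in> carrier_vec d"
  shows "has_gradient d f (grad d f x) x"
  using assms grad_eqI unfolding smooth_def by metis

lemma grad_carrier: "smooth d l f \<Longrightarrow> x \<in> carrier_vec d \<Longrightarrow> grad d f x \<in> carrier_vec d"
  using smooth_has_gradient unfolding has_gradient_def by blast

text \<open>Restriction to a line reduces the smoothness estimates to one-variable calculus.\<close>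

lemma has_gradient_line_derivative:
  assumes x: "x \<in> carrier_vec d" and h: "h \<in> carrier_vec d"
    and g: "has_gradient d f g (x + t \<cdot>\<^sub>v h)"
  shows "((\<lambda>t. f (x + t \<cdot>\<^sub>v h)) has_real_derivative g \<bullet> h) (at t)"
  unfolding DERIV_def
proof (rule LIM_I)
  fix r :: real assume r: "r > 0"
  \<comment> \<open>The summand 1 keeps the denominator positive when h = 0.\<close>
  define e where "e = r / (2 * (norm2 h + 1))"
  have p: "norm2 h + 1 > 0" using norm2_nonneg[of h] by linarith
  have e: "e > 0" using r p by (simp add: e_def)
  obtain t1 where t1: "t1 > 0" "\<And>k. k \<in> carrier_vec d \<Longrightarrow> norm2 k < t1 \<Longrightarrow>
      \<bar>f (x + t \<cdot>\<^sub>v h + k) - f (x + t \<cdot>\<^sub>v h) - g \<bullet> k\<bar> \<le> e * norm2 k"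
    using g e unfolding has_gradient_def by meson
  have gc: "g \<in> carrier_vec d" using g by (simp add: has_gradient_def)
  show "\<exists>s>0. \<forall>y. y \<noteq> 0 \<and> norm (y - 0) < s \<longrightarrow>
      norm ((f (x + (t + y) \<cdot>\<^sub>v h) - f (x + t \<cdot>\<^sub>v h)) / y - g \<bullet> h) < r"
  proof (intro exI conjI allI impI)
    show "t1 / (norm2 h + 1) > 0" using t1 p by simp
    fix y :: real assume y: "y \<noteq> 0 \<and> norm (y - 0) < t1 / (norm2 h + 1)"
    have eq: "x + (t + y) \<cdot>\<^sub>v h = x + t \<cdot>\<^sub>v h + y \<cdot>\<^sub>v h"
      using x h by (auto simp: algebra_simps)
    have "\<bar>y\<bar> * (norm2 h + 1) < t1" using y p by (simp add: field_simps)
    moreover have "\<bar>y\<bar> * norm2 h \<le> \<bar>y\<bar> * (norm2 h + 1)" by (intro mult_left_mono) auto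
    ultimately have "norm2 (y \<cdot>\<^sub>v h) < t1" by (simp add: norm2_smult)
    then have b: "\<bar>f (x + (t + y) \<cdot>\<^sub>v h) - f (x + t \<cdot>\<^sub>v h) - y * (g \<bullet> h)\<bar> \<le> e * (\<bar>y\<bar> * norm2 h)"
      unfolding eq using t1(2)[of "y \<cdot>\<^sub>v h"] h gc by (simp add: norm2_smult)
    have "(f (x + (t + y) \<cdot>\<^sub>v h) - f (x + t \<cdot>\<^sub>v h)) / y - g \<bullet> h
        = (f (x + (t + y) \<cdot>\<^sub>v h) - f (x + t \<cdot>\<^sub>v h) - y * (g \<bullet> h)) / y"
      using y by (simp add: field_simps)
    then have "\<bar>(f (x + (t + y) \<cdot>\<^sub>v h) - f (x + t \<cdot>\<^sub>v h)) / y - g \<bullet> h\<bar> \<le> e * norm2 h"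
      using b y by (simp add: abs_divide field_simps)
    also have "\<dots> \<le> e * (norm2 h + 1)" using e by simp
    also have "\<dots> = r / 2" proof -
      have "r / (2 * k) * k = r / 2" if "k > 0" for k :: real using that by simp
      from this[OF p] show ?thesis by (simp only: e_def)
    qed
    finally show "norm ((f (x + (t + y) \<cdot>\<^sub>v h) - f (x + t \<cdot>\<^sub>v h)) / y - g \<bullet> h) < r"
      using r by simp
  qed
qed

text \<open>The descent lemma: on the segment, the function minus its quadratic upper model is
  nonincreasing, since the Lipschitz gradient bounds the growth of the directional
  derivative.\<close>

lemma smooth_upper_bound:
  assumes sm: "smooth d l f" and x: "x \<in> carrier_vec d" and h: "h \<in> carrier_vec d"
  shows "f (x + h) \<le> f x + grad d f x \<bullet> h + l / 2 * (norm2 h)\<^sup>2"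
proof -
  define \<phi> where "\<phi> t = f (x + t \<cdot>\<^sub>v h) - t * (grad d f x \<bullet> h) - l / 2 * (norm2 h)\<^sup>2 * t\<^sup>2" for t
  have gx: "grad d f x \<in> carrier_vec d" using grad_carrier[OF sm x] .
  have "\<phi> 1 \<le> \<phi> 0"
  proof (rule DERIV_nonpos_imp_nonincreasing[of 0 1 \<phi>])
    fix t :: real assume t: "0 \<le> t" "t \<le> 1"
    define D where "D = grad d f (x + t \<cdot>\<^sub>v h)"
    have xt: "x + t \<cdot>\<^sub>v h \<in> carrier_vec d" using x h by simp
    have Dc: "D \<in> carrier_vec d" unfolding D_def using grad_carrier[OF sm xt] .
    have "(\<phi> has_real_derivative (D \<bullet> h - grad d f x \<bullet> h - l / 2 * (norm2 h)\<^sup>2 * (2 * t))) (at t)"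
      unfolding \<phi>_def D_def
      by (rule derivative_eq_intros has_gradient_line_derivative[OF x h smooth_has_gradient[OF sm xt]] refl)+
        simp
    moreover have "D \<bullet> h - grad d f x \<bullet> h \<le> l * (norm2 h)\<^sup>2 * t"
    proof -
      have "D \<bullet> h - grad d f x \<bullet> h = (D - grad d f x) \<bullet> h"
        using Dc gx h by (simp add: minus_scalar_prod_distrib)
      also have "\<dots> \<le> norm2 (D - grad d f x) * norm2 h"
        using Dc gx h by (intro scalar_prod_le_norm2[of _ d]) auto
      also have "\<dots> \<le> (l * norm2 (x + t \<cdot>\<^sub>v h - x)) * norm2 h"
        using sm x xt unfolding smooth_def D_def by (intro mult_right_mono) auto
      also have "x + t \<cdot>\<^sub>v h - x = t \<cdot>\<^sub>v h" using x h by auto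
      finally show ?thesis using t by (simp add: norm2_smult power2_eq_square algebra_simps)
    qed
    then have "D \<bullet> h - grad d f x \<bullet> h - l / 2 * (norm2 h)\<^sup>2 * (2 * t) \<le> 0" by simp
    ultimately show "\<exists>y. (\<phi> has_real_derivative y) (at t) \<and> y \<le> 0" by blast
  qed simp
  moreover have "x + 0 \<cdot>\<^sub>v h = x" "x + 1 \<cdot>\<^sub>v h = x + h" using x h by auto
  ultimately show ?thesis unfolding \<phi>_def by simp
qed

section \<open>Averages over the agents\<close>

lemma mean_vec_carrier [simp]:
  assumes "\<And>i. i < n \<Longrightarrow> z i \<in> carrier_vec d"
  shows "mean_vec n d z \<in> carrier_vec d"
  unfolding mean_vec_def using assms by (intro smult_carrier_vec[THEN iffD2] finsum_vec_closed) auto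

lemma index_mean_vec:
  assumes "\<And>i. i < n \<Longrightarrow> z i \<in> carrier_vec d" "c < d"
  shows "mean_vec n d z $ c = (\<Sum>i<n. z i $ c) / real n"
proof -
  have "finsum_vec TYPE(real) d z {..<n} \<in> carrier_vec d"
    using assms by (intro finsum_vec_closed) auto
  moreover have "finsum_vec TYPE(real) d z {..<n} $ c = (\<Sum>i<n. z i $ c)"
    using assms by (intro index_finsum_vec) auto
  ultimately show ?thesis using assms unfolding mean_vec_def by auto
qed

lemma mean_vec_scalar_prod:
  assumes "\<And>i. i < n \<Longrightarrow> z i \<in> carrier_vec d" "h \<in> carrier_vec d"
  shows "mean_vec n d z \<bullet> h = (\<Sum>i<n. z i \<bullet> h) / real n"
proof -
  have "mean_vec n d z \<bullet> h = (\<Sum>c<d. (\<Sum>i<n. z i $ c) / real n * h $ c)"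
    unfolding scalar_prod_def using assms by (auto simp: index_mean_vec atLeast0LessThan intro!: sum.cong)
  also have "\<dots> = (\<Sum>c<d. \<Sum>i<n. z i $ c * h $ c) / real n"
    by (simp add: sum_divide_distrib sum_distrib_right)
  also have "\<dots> = (\<Sum>i<n. \<Sum>c<d. z i $ c * h $ c) / real n"
    by (subst sum.swap) simp
  finally show ?thesis using assms unfolding scalar_prod_def by (simp add: atLeast0LessThan)
qed

lemma has_gradient_avg_fun:
  assumes n: "n > 0" and g: "\<And>i. i < n \<Longrightarrow> has_gradient d (f i) (g i) x"
  shows "has_gradient d (avg_fun n f) (mean_vec n d g) x"
  unfolding has_gradient_def
proof (intro conjI allI impI)
  have gc: "g i \<in> carrier_vec d" if "i < n" for i using g[OF that] by (simp add: has_gradient_def)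
  show "mean_vec n d g \<in> carrier_vec d" using gc by simp
  fix e :: real assume e: "e > 0"
  have "\<forall>i\<in>{..<n}. \<exists>t>0. \<forall>h\<in>carrier_vec d. norm2 h < t \<longrightarrow>
      \<bar>f i (x + h) - f i x - g i \<bullet> h\<bar> \<le> e * norm2 h"
    using g e unfolding has_gradient_def by auto
  then obtain t where t: "\<forall>i\<in>{..<n}. t i > 0 \<and> (\<forall>h\<in>carrier_vec d. norm2 h < t i \<longrightarrow>
      \<bar>f i (x + h) - f i x - g i \<bullet> h\<bar> \<le> e * norm2 h)"
    by (subst (asm) bchoice_iff) blast
  have ne: "t ` {..<n} \<noteq> {}" using n by auto
  show "\<exists>s>0. \<forall>h\<in>carrier_vec d. norm2 h < s \<longrightarrow>
      \<bar>avg_fun n f (x + h) - avg_fun n f x - mean_vec n d g \<bullet> h\<bar> \<le> e * norm2 h"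
  proof (intro exI conjI ballI impI)
    show "Min (t ` {..<n}) > 0" using ne t by (subst Min_gr_iff) auto
    fix h assume h: "h \<in> carrier_vec d" and lt: "norm2 h < Min (t ` {..<n})"
    have "avg_fun n f (x + h) - avg_fun n f x - mean_vec n d g \<bullet> h
        = (\<Sum>i<n. f i (x + h) - f i x - g i \<bullet> h) / real n"
      using gc h by (simp add: avg_fun_def mean_vec_scalar_prod sum_subtractf diff_divide_distrib)
    moreover have "\<bar>\<Sum>i<n. f i (x + h) - f i x - g i \<bullet> h\<bar> \<le> (\<Sum>i<n. e * norm2 h)"
      using t h lt ne by (intro order_trans[OF sum_abs] sum_mono) (auto simp: Min_gr_iff)
    ultimately show "\<bar>avg_fun n f (x + h) - avg_fun n f x - mean_vec n d g \<bullet> h\<bar> \<le> e * norm2 h"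
      using n by (simp add: abs_divide pos_divide_le_eq mult.commute)
  qed
qed

lemma grad_avg_fun:
  assumes "n > 0" "\<And>i. i < n \<Longrightarrow> smooth d l (f i)" "x \<in> carrier_vec d"
  shows "grad d (avg_fun n f) x = mean_vec n d (\<lambda>i. grad d (f i) x)"
  using assms by (intro grad_eqI has_gradient_avg_fun smooth_has_gradient) auto

lemma avg_fun_upper_bound:
  assumes n: "n > 0" and sm: "\<And>i. i < n \<Longrightarrow> smooth d l (f i)"
    and x: "x \<in> carrier_vec d" and h: "h \<in> carrier_vec d"
  shows "avg_fun n f (x + h)
    \<le> avg_fun n f x + mean_vec n d (\<lambda>i. grad d (f i) x) \<bullet> h + l / 2 * (norm2 h)\<^sup>2"
proof -
  have "(\<Sum>i<n. f i (x + h)) \<le> (\<Sum>i<n. f i x + grad d (f i) x \<bullet> h + l / 2 * (norm2 h)\<^sup>2)"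
    using smooth_upper_bound[OF sm x h] by (intro sum_mono) auto
  then have "(\<Sum>i<n. f i (x + h)) / real n
      \<le> (\<Sum>i<n. f i x + grad d (f i) x \<bullet> h + l / 2 * (norm2 h)\<^sup>2) / real n"
    using n by (intro divide_right_mono) auto
  then show ?thesis using n grad_carrier[OF sm x] h
    by (simp add: avg_fun_def mean_vec_scalar_prod sum.distrib add_divide_distrib)
qed

text \<open>A gradient step of size 1 / l lowers the average objective by at least the squared
  gradient norm over 2 * l, and no value lies below the infimum. This turns a bound on the
  optimality gap into one on the gradient.\<close>

lemma norm2_grad_avg_fun_le:
  assumes n: "n > 0" and sm: "\<And>i. i < n \<Longrightarrow> smooth d l (f i)" and l: "l > 0"
    and bdd: "bdd_below (avg_fun n f ` carrier_vec d)" and x: "x \<in> carrier_vec d"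
  shows "(norm2 (grad d (avg_fun n f) x))\<^sup>2 \<le> 2 * l * (avg_fun n f x - f_star n d f)"
proof -
  define g where "g = grad d (avg_fun n f) x"
  have ge: "g = mean_vec n d (\<lambda>i. grad d (f i) x)"
    unfolding g_def using grad_avg_fun[OF n sm x] .
  have gc: "g \<in> carrier_vec d" unfolding ge using grad_carrier[OF sm x] by simp
  define h where "h = (- 1 / l) \<cdot>\<^sub>v g"
  have h: "h \<in> carrier_vec d" using gc by (simp add: h_def)
  have "f_star n d f \<le> avg_fun n f (x + h)"
    unfolding f_star_def using x h bdd by (intro cINF_lower) auto
  also have "\<dots> \<le> avg_fun n f x + g \<bullet> h + l / 2 * (norm2 h)\<^sup>2"
    unfolding ge using avg_fun_upper_bound[OF n sm x h] .
  also have "g \<bullet> h = - (norm2 g)\<^sup>2 / l" using gc by (simp add: h_def norm2_sq_scalar_prod)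
  also have "l / 2 * (norm2 h)\<^sup>2 = (norm2 g)\<^sup>2 / (2 * l)"
    using l by (simp add: h_def norm2_smult power_mult_distrib power_divide field_simps power2_eq_square)
  finally show ?thesis using l unfolding g_def[symmetric] by (simp add: field_simps)
qed

section \<open>Descent of a single mode\<close>

text \<open>Stated in discriminant form: the weights p and q are free, so each later use reduces to
  comparing coefficients.\<close>

lemma young:
  fixes a b p q c :: real
  assumes "p \<ge> 0" "q \<ge> 0" "c\<^sup>2 \<le> 4 * p * q"
  shows "c * a * b \<le> p * a\<^sup>2 + q * b\<^sup>2"
proof -
  have "(c * a * b)\<^sup>2 = c\<^sup>2 * (a\<^sup>2 * b\<^sup>2)" by (simp add: power_mult_distrib)
  also have "\<dots> \<le> 4 * p * q * (a\<^sup>2 * b\<^sup>2)" using assms by (intro mult_right_mono) auto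
  also have "\<dots> = 4 * (p * a\<^sup>2) * (q * b\<^sup>2)" by simp
  also have "\<dots> \<le> (p * a\<^sup>2 + q * b\<^sup>2)\<^sup>2"
    using zero_le_power2[of "p * a\<^sup>2 - q * b\<^sup>2"] by (simp add: power2_eq_square algebra_simps)
  finally show ?thesis using assms by (meson abs_le_D1 abs_le_square_iff abs_ge_self
        add_nonneg_nonneg mult_nonneg_nonneg zero_le_power2 power2_le_imp_le)
qed

text \<open>The share of one coordinate of one mode in the Lyapunov function: on an eigenvector with
  eigenvalue \<mu> > 0 the matrix E acts as 1 and F as 1 / \<mu>. Here \<xi> stands for the iterate
  and w for the shifted dual variable.\<close>

definition mode_lyap :: "real \<Rightarrow> real \<Rightarrow> real \<Rightarrow> real \<Rightarrow> real" where
  "mode_lyap a \<mu> \<xi> w = \<xi>\<^sup>2 / 2 + a / (2 * \<mu>) * w\<^sup>2 + \<xi> * w / \<mu>"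

text \<open>The choice \<open>a = (\<beta> + \<gamma>) / \<gamma>\<close> cancels the first-order terms in \<open>\<xi> w\<close>.\<close>

lemma mode_lyap_diff:
  fixes \<alpha> \<beta> \<gamma> \<mu> \<xi> w e h D :: real
  assumes "\<gamma> > 0" "\<mu> > 0" "a = (\<beta> + \<gamma>) / \<gamma>"
  shows "mode_lyap a \<mu> (\<xi> - \<alpha> * (\<beta> * \<mu> * (\<xi> - e) + \<gamma> * w + h)) (w + \<alpha> * \<gamma> * \<mu> * (\<xi> - e) + D / \<gamma>)
      - mode_lyap a \<mu> \<xi> w =
    - \<alpha> * (\<beta> * \<mu> - \<gamma>) * \<xi>\<^sup>2 - \<alpha> * \<gamma> * w\<^sup>2 / \<mu> + \<alpha> * ((\<beta> * \<mu> - \<gamma>) * \<xi> * e) - \<alpha> * (\<gamma> * w * e)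
    - \<alpha> * (\<xi> * h) - \<alpha> * (1 / \<mu> * w * h) + a / (\<gamma> * \<mu>) * w * D + 1 / (\<gamma> * \<mu>) * \<xi> * D
    + \<alpha>\<^sup>2 * ((\<beta>\<^sup>2 * \<mu>\<^sup>2 - \<beta> * \<gamma> * \<mu> + \<gamma>\<^sup>2 * \<mu>) / 2 * (\<xi> - e)\<^sup>2 + (\<beta> * \<mu> - \<gamma>) * \<gamma> * (\<xi> - e) * w
        + (\<beta> * \<mu> - \<gamma>) * (\<xi> - e) * h + \<gamma>\<^sup>2 / 2 * w\<^sup>2 + \<gamma> * w * h + h\<^sup>2 / 2)
    + \<alpha> * (\<xi> - e) * D - \<alpha> / \<mu> * w * D - \<alpha> / (\<gamma> * \<mu>) * h * D + a / (2 * \<mu> * \<gamma>\<^sup>2) * D\<^sup>2"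
  using assms(1,2) unfolding mode_lyap_def assms(3)
  by (simp add: divide_simps) (simp add: algebra_simps power2_eq_square power3_eq_cube power4_eq_xxxx)

text \<open>Here e is the compression error, h the effect of evaluating gradients at the agents
  instead of the average, and D the drift of the gradients at the average. Young's inequality splits
  every product such that half of the leading decreases, with factors
  \<open>\<beta> * \<mu> - \<gamma>\<close> and \<gamma>, survives; 4 * \<gamma> <= \<beta> * lo
  keeps the former positive. Only then is \<mu> replaced by lo or hi, as the coefficients must serve
  all modes.\<close>

lemma mode_lyap_descent:
  fixes \<alpha> \<beta> \<gamma> \<mu> \<xi> w e h D lo hi :: real
  assumes \<alpha>: "\<alpha> > 0" and \<gamma>: "\<gamma> > 0" and \<beta>: "\<beta> > 0" and lo: "lo > 0" "lo \<le> \<mu>" and hi: "\<mu> \<le> hi"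
    and big: "4 * \<gamma> \<le> \<beta> * lo" and a: "a = (\<beta> + \<gamma>) / \<gamma>"
  shows "mode_lyap a \<mu> (\<xi> - \<alpha> * (\<beta> * \<mu> * (\<xi> - e) + \<gamma> * w + h)) (w + \<alpha> * \<gamma> * \<mu> * (\<xi> - e) + D / \<gamma>)
      - mode_lyap a \<mu> \<xi> w \<le>
    (\<alpha> * (1 - (\<beta> * lo - \<gamma>) / 2) + \<alpha>\<^sup>2 * (3 * hi\<^sup>2 * \<beta>\<^sup>2 - lo * \<beta> * \<gamma> + (hi + 2) * \<gamma>\<^sup>2 + 1)) * \<xi>\<^sup>2
    + (\<alpha> * (1 / (2 * lo) - \<gamma> / 2) + \<alpha>\<^sup>2 * (2 * hi * \<gamma>\<^sup>2 + hi / 2)) * (w\<^sup>2 / \<mu>)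
    + (\<alpha> * (\<beta> * hi / 2 + hi * \<gamma>)
        + \<alpha>\<^sup>2 * (3 * hi\<^sup>2 * \<beta>\<^sup>2 + (hi - 2 * lo) * \<beta> * \<gamma> + (hi + 2) * \<gamma>\<^sup>2 + 1)) * e\<^sup>2
    + (\<alpha> + 2 * \<alpha>\<^sup>2) * h\<^sup>2
    + (a\<^sup>2 / (\<gamma>^3 * lo) / \<alpha> + 1 / (2 * \<gamma>\<^sup>2 * lo\<^sup>2) / \<alpha>
        + (a / (2 * \<gamma>\<^sup>2 * lo) + 1 / (2 * \<gamma>\<^sup>2 * lo\<^sup>2) + 1 / (2 * lo\<^sup>2) + 1 / 2)) * D\<^sup>2"
    (is "?L \<le> ?cx * \<xi>\<^sup>2 + ?cw * (w\<^sup>2 / \<mu>) + ?ce * e\<^sup>2 + ?ch * h\<^sup>2 + ?cd * D\<^sup>2")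
proof -
  define m where "m = \<xi> - e"
  define b where "b = \<beta> * \<mu>"
  define W where "W = w\<^sup>2 / \<mu>"
  have \<mu>: "\<mu> > 0" using lo by simp
  have w2: "w\<^sup>2 = \<mu> * W" using \<mu> by (simp add: W_def)
  have W: "W \<ge> 0" using \<mu> by (simp add: W_def)
  have a0: "a > 0" using a \<beta> \<gamma> by simp
  have blo: "\<beta> * lo \<le> b" "b \<le> \<beta> * hi" unfolding b_def using \<beta> lo hi by auto
  then have b4: "4 * \<gamma> \<le> b" using big by simp
  have inv: "1 / \<mu> \<le> 1 / lo" using lo by (simp add: frac_le)
  have inv2: "1 / \<mu>\<^sup>2 \<le> 1 / lo\<^sup>2" using lo by (intro frac_le) auto
  have m2: "m\<^sup>2 \<le> 2 * \<xi>\<^sup>2 + 2 * e\<^sup>2"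
    using zero_le_power2[of "\<xi> + e"] unfolding m_def by (simp add: power2_eq_square algebra_simps)

  have f1: "(b - \<gamma>) * \<xi> * e \<le> (b - \<gamma>) / 2 * \<xi>\<^sup>2 + (b - \<gamma>) / 2 * e\<^sup>2"
    using b4 \<gamma> by (intro young) (auto simp: power2_eq_square)
  have f2: "(- \<gamma>) * w * e \<le> \<gamma> / (4 * \<mu>) * w\<^sup>2 + \<gamma> * \<mu> * e\<^sup>2"
    using \<gamma> \<mu> by (intro young) (auto simp: power2_eq_square)
  have f3: "(- 1) * \<xi> * h \<le> 1 / 2 * \<xi>\<^sup>2 + 1 / 2 * h\<^sup>2" by (intro young) auto
  have f4: "(- (1 / \<mu>)) * w * h \<le> 1 / (2 * \<mu>\<^sup>2) * w\<^sup>2 + 1 / 2 * h\<^sup>2"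
    using \<mu> by (intro young) (auto simp: power2_eq_square)
  \<comment> \<open>A weight 1 / \<alpha> on D^2 is affordable: D will turn out to be of order
    \<alpha>, so these terms are of first order in \<alpha>.\<close>
  have f5: "a / (\<gamma> * \<mu>) * w * D \<le> \<alpha> * \<gamma> / (4 * \<mu>) * w\<^sup>2 + a\<^sup>2 / (\<gamma>^3 * \<mu>) / \<alpha> * D\<^sup>2"
    using \<alpha> \<gamma> \<mu> by (intro young) (auto simp: power2_eq_square power3_eq_cube field_simps)
  have f6: "1 / (\<gamma> * \<mu>) * \<xi> * D \<le> \<alpha> / 2 * \<xi>\<^sup>2 + 1 / (2 * \<gamma>\<^sup>2 * \<mu>\<^sup>2) / \<alpha> * D\<^sup>2"
    using \<alpha> \<gamma> \<mu> by (intro young) (auto simp: power2_eq_square field_simps)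
  have s1: "(b - \<gamma>) * \<gamma> * m * w \<le> (b - \<gamma>)\<^sup>2 / 4 * m\<^sup>2 + \<gamma>\<^sup>2 * w\<^sup>2"
    by (intro young) (auto simp: power2_eq_square)
  have s2: "(b - \<gamma>) * m * h \<le> (b - \<gamma>)\<^sup>2 / 2 * m\<^sup>2 + 1 / 2 * h\<^sup>2"
    by (intro young) (auto simp: power2_eq_square)
  have s3: "\<gamma> * w * h \<le> \<gamma>\<^sup>2 / 2 * w\<^sup>2 + 1 / 2 * h\<^sup>2"
    by (intro young) (auto simp: power2_eq_square)
  have s4: "\<alpha> * m * D \<le> \<alpha>\<^sup>2 / 2 * m\<^sup>2 + 1 / 2 * D\<^sup>2"
    by (intro young) (auto simp: power2_eq_square)
  have s5: "(- (\<alpha> / \<mu>)) * w * D \<le> \<alpha>\<^sup>2 / 2 * w\<^sup>2 + 1 / (2 * \<mu>\<^sup>2) * D\<^sup>2"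
    using \<mu> by (intro young) (auto simp: power2_eq_square)
  have s6: "(- (\<alpha> / (\<gamma> * \<mu>))) * h * D \<le> \<alpha>\<^sup>2 / 2 * h\<^sup>2 + 1 / (2 * \<gamma>\<^sup>2 * \<mu>\<^sup>2) * D\<^sup>2"
    using \<mu> \<gamma> by (intro young) (auto simp: power2_eq_square field_simps)

  \<comment> \<open>K collects the coefficients of \<open>\<alpha>\<^sup>2 * m\<^sup>2\<close>: the
    first summand comes from the exact expansion, 3 / 4 is 1 / 4 from \<open>s1\<close> plus 1 / 2
    from \<open>s2\<close>, and the final 1 / 2 comes from \<open>s4\<close>. By \<open>m2\<close>
    it is later shared between \<xi> and e.\<close>
  define K where "K = (b\<^sup>2 - \<gamma> * b + \<gamma>\<^sup>2 * \<mu>) / 2 + 3 / 4 * (b - \<gamma>)\<^sup>2 + 1 / 2"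
  define dd where "dd = (a\<^sup>2 / (\<gamma>^3 * \<mu>) / \<alpha> + 1 / (2 * \<gamma>\<^sup>2 * \<mu>\<^sup>2) / \<alpha>
        + (a / (2 * \<gamma>\<^sup>2 * \<mu>) + 1 / (2 * \<gamma>\<^sup>2 * \<mu>\<^sup>2) + 1 / (2 * \<mu>\<^sup>2) + 1 / 2))"
  have first: "\<alpha> * ((b - \<gamma>) * \<xi> * e) + \<alpha> * ((- \<gamma>) * w * e) + \<alpha> * ((- 1) * \<xi> * h)
      + \<alpha> * ((- (1 / \<mu>)) * w * h)
    \<le> \<alpha> * ((b - \<gamma>) / 2 * \<xi>\<^sup>2 + (b - \<gamma>) / 2 * e\<^sup>2) + \<alpha> * (\<gamma> / (4 * \<mu>) * w\<^sup>2 + \<gamma> * \<mu> * e\<^sup>2)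
      + \<alpha> * (1 / 2 * \<xi>\<^sup>2 + 1 / 2 * h\<^sup>2) + \<alpha> * (1 / (2 * \<mu>\<^sup>2) * w\<^sup>2 + 1 / 2 * h\<^sup>2)"
    using f1 f2 f3 f4 \<alpha> by (intro add_mono mult_left_mono) auto
  have second: "\<alpha>\<^sup>2 * ((b - \<gamma>) * \<gamma> * m * w + (b - \<gamma>) * m * h + \<gamma> * w * h)
    \<le> \<alpha>\<^sup>2 * (((b - \<gamma>)\<^sup>2 / 4 * m\<^sup>2 + \<gamma>\<^sup>2 * w\<^sup>2) + ((b - \<gamma>)\<^sup>2 / 2 * m\<^sup>2 + 1 / 2 * h\<^sup>2)
        + (\<gamma>\<^sup>2 / 2 * w\<^sup>2 + 1 / 2 * h\<^sup>2))"
    using s1 s2 s3 by (intro add_mono mult_left_mono) auto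
  have "?L = - \<alpha> * (b - \<gamma>) * \<xi>\<^sup>2 - \<alpha> * \<gamma> * W
    + (\<alpha> * ((b - \<gamma>) * \<xi> * e) + \<alpha> * ((- \<gamma>) * w * e) + \<alpha> * ((- 1) * \<xi> * h) + \<alpha> * ((- (1 / \<mu>)) * w * h))
    + a / (\<gamma> * \<mu>) * w * D + 1 / (\<gamma> * \<mu>) * \<xi> * D
    + \<alpha>\<^sup>2 * ((b\<^sup>2 - \<gamma> * b + \<gamma>\<^sup>2 * \<mu>) / 2 * m\<^sup>2 + \<gamma>\<^sup>2 / 2 * w\<^sup>2 + h\<^sup>2 / 2)
    + \<alpha>\<^sup>2 * ((b - \<gamma>) * \<gamma> * m * w + (b - \<gamma>) * m * h + \<gamma> * w * h)
    + \<alpha> * m * D + (- (\<alpha> / \<mu>)) * w * D + (- (\<alpha> / (\<gamma> * \<mu>))) * h * D + a / (2 * \<mu> * \<gamma>\<^sup>2) * D\<^sup>2"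
    unfolding mode_lyap_diff[OF \<gamma> \<mu> a] unfolding m_def[symmetric] W_def b_def
    by (simp add: algebra_simps power_mult_distrib)
  also have "\<dots> \<le> - \<alpha> * (b - \<gamma>) * \<xi>\<^sup>2 - \<alpha> * \<gamma> * W
    + (\<alpha> * ((b - \<gamma>) / 2 * \<xi>\<^sup>2 + (b - \<gamma>) / 2 * e\<^sup>2) + \<alpha> * (\<gamma> / (4 * \<mu>) * w\<^sup>2 + \<gamma> * \<mu> * e\<^sup>2)
      + \<alpha> * (1 / 2 * \<xi>\<^sup>2 + 1 / 2 * h\<^sup>2) + \<alpha> * (1 / (2 * \<mu>\<^sup>2) * w\<^sup>2 + 1 / 2 * h\<^sup>2))
    + (\<alpha> * \<gamma> / (4 * \<mu>) * w\<^sup>2 + a\<^sup>2 / (\<gamma>^3 * \<mu>) / \<alpha> * D\<^sup>2)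
    + (\<alpha> / 2 * \<xi>\<^sup>2 + 1 / (2 * \<gamma>\<^sup>2 * \<mu>\<^sup>2) / \<alpha> * D\<^sup>2)
    + \<alpha>\<^sup>2 * ((b\<^sup>2 - \<gamma> * b + \<gamma>\<^sup>2 * \<mu>) / 2 * m\<^sup>2 + \<gamma>\<^sup>2 / 2 * w\<^sup>2 + h\<^sup>2 / 2)
    + \<alpha>\<^sup>2 * (((b - \<gamma>)\<^sup>2 / 4 * m\<^sup>2 + \<gamma>\<^sup>2 * w\<^sup>2) + ((b - \<gamma>)\<^sup>2 / 2 * m\<^sup>2 + 1 / 2 * h\<^sup>2)
        + (\<gamma>\<^sup>2 / 2 * w\<^sup>2 + 1 / 2 * h\<^sup>2))
    + (\<alpha>\<^sup>2 / 2 * m\<^sup>2 + 1 / 2 * D\<^sup>2) + (\<alpha>\<^sup>2 / 2 * w\<^sup>2 + 1 / (2 * \<mu>\<^sup>2) * D\<^sup>2)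
    + (\<alpha>\<^sup>2 / 2 * h\<^sup>2 + 1 / (2 * \<gamma>\<^sup>2 * \<mu>\<^sup>2) * D\<^sup>2) + a / (2 * \<mu> * \<gamma>\<^sup>2) * D\<^sup>2"
    using first second f5 f6 s4 s5 s6 by linarith
  also have "\<dots> = (\<alpha> * (1 - (b - \<gamma>) / 2)) * \<xi>\<^sup>2 + (\<alpha> * (1 / (2 * \<mu>) - \<gamma> / 2) + \<alpha>\<^sup>2 * ((2 * \<gamma>\<^sup>2 + 1 / 2) * \<mu>)) * W
      + \<alpha> * ((b - \<gamma>) / 2 + \<gamma> * \<mu>) * e\<^sup>2 + \<alpha>\<^sup>2 * K * m\<^sup>2 + ?ch * h\<^sup>2 + dd * D\<^sup>2"
  proof -
    have "1 / (2 * \<mu>\<^sup>2) * w\<^sup>2 = 1 / (2 * \<mu>) * W" "\<gamma> / (4 * \<mu>) * w\<^sup>2 = \<gamma> / 4 * W"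
      "\<alpha> * \<gamma> / (4 * \<mu>) * w\<^sup>2 = \<alpha> * \<gamma> / 4 * W"
      using \<mu> unfolding w2 by (auto simp: power2_eq_square)
    then show ?thesis unfolding K_def dd_def w2[symmetric]
      by (simp only: w2) (simp add: algebra_simps add_divide_distrib diff_divide_distrib)
  qed
  also have "\<dots> \<le> (\<alpha> * (1 - (b - \<gamma>) / 2)) * \<xi>\<^sup>2 + ?cw * W
      + \<alpha> * ((b - \<gamma>) / 2 + \<gamma> * \<mu>) * e\<^sup>2 + \<alpha>\<^sup>2 * K * (2 * \<xi>\<^sup>2 + 2 * e\<^sup>2) + ?ch * h\<^sup>2 + ?cd * D\<^sup>2"
  proof -
    have "b * b \<ge> \<gamma> * b" using b4 \<gamma> by (intro mult_right_mono) auto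
    then have "K \<ge> 0" unfolding K_def using \<mu> by (auto intro!: add_nonneg_nonneg simp: power2_eq_square)
    then have k: "\<alpha>\<^sup>2 * K * m\<^sup>2 \<le> \<alpha>\<^sup>2 * K * (2 * \<xi>\<^sup>2 + 2 * e\<^sup>2)" using m2 by (intro mult_left_mono) auto
    have "(2 * \<gamma>\<^sup>2 + 1 / 2) * \<mu> \<le> (2 * \<gamma>\<^sup>2 + 1 / 2) * hi" using hi by (intro mult_left_mono) auto
    then have "\<alpha>\<^sup>2 * ((2 * \<gamma>\<^sup>2 + 1 / 2) * \<mu>) \<le> \<alpha>\<^sup>2 * (2 * hi * \<gamma>\<^sup>2 + hi / 2)"
      by (intro mult_left_mono) (auto simp: algebra_simps)
    moreover have "\<alpha> * (1 / (2 * \<mu>) - \<gamma> / 2) \<le> \<alpha> * (1 / (2 * lo) - \<gamma> / 2)"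
      using inv \<alpha> by (intro mult_left_mono) auto
    ultimately have w: "(\<alpha> * (1 / (2 * \<mu>) - \<gamma> / 2) + \<alpha>\<^sup>2 * ((2 * \<gamma>\<^sup>2 + 1 / 2) * \<mu>)) * W \<le> ?cw * W"
      using W by (intro mult_right_mono) auto
    have "dd \<le> ?cd" unfolding dd_def using inv inv2 \<alpha> \<gamma> a0 lo
      by (intro add_mono divide_right_mono frac_le mult_mono power_mono) auto
    then have "dd * D\<^sup>2 \<le> ?cd * D\<^sup>2" by (intro mult_right_mono) auto
    with k w show ?thesis by linarith
  qed
  also have "\<dots> = (\<alpha> * (1 - (b - \<gamma>) / 2) + \<alpha>\<^sup>2 * (2 * K)) * \<xi>\<^sup>2 + ?cw * W
      + (\<alpha> * ((b - \<gamma>) / 2 + \<gamma> * \<mu>) + \<alpha>\<^sup>2 * (2 * K)) * e\<^sup>2 + ?ch * h\<^sup>2 + ?cd * D\<^sup>2"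
    by (simp add: algebra_simps)
  also have "\<dots> \<le> ?cx * \<xi>\<^sup>2 + ?cw * W + ?ce * e\<^sup>2 + ?ch * h\<^sup>2 + ?cd * D\<^sup>2"
  proof -
    have bb: "b\<^sup>2 \<le> hi\<^sup>2 * \<beta>\<^sup>2" using blo(2) b4 \<gamma>
      by (metis mult.commute power_mult_distrib power_mono order_trans less_imp_le mult_nonneg_nonneg zero_le_numeral)
    have gb: "\<gamma> * (\<beta> * lo) \<le> \<gamma> * b" using blo \<gamma> by (intro mult_left_mono) auto
    have gb0: "0 \<le> \<gamma> * b" using b4 \<gamma> by simp
    have gl: "\<gamma>\<^sup>2 * \<mu> \<le> \<gamma>\<^sup>2 * hi" using hi by (intro mult_left_mono) auto
    \<comment> \<open>The reserve - 4 * (\<gamma> * b) lets the same K fit below both targets, whose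
      mixed terms in \<beta> * \<gamma> differ.\<close>
    have "2 * K = 5 / 2 * b\<^sup>2 - 4 * (\<gamma> * b) + \<gamma>\<^sup>2 * \<mu> + 3 / 2 * \<gamma>\<^sup>2 + 1"
      unfolding K_def by (simp add: power2_eq_square field_simps)
    then have K2: "2 * K \<le> 3 * (hi\<^sup>2 * \<beta>\<^sup>2) - 4 * (\<gamma> * b) + \<gamma>\<^sup>2 * hi + 2 * \<gamma>\<^sup>2 + 1"
      using bb gl zero_le_power2[of b] zero_le_power2[of \<gamma>] by linarith
    have K3: "2 * K \<le> 3 * hi\<^sup>2 * \<beta>\<^sup>2 - lo * \<beta> * \<gamma> + (hi + 2) * \<gamma>\<^sup>2 + 1"
      using K2 gb gb0 by (simp add: algebra_simps)
    have "0 \<le> hi * \<beta> * \<gamma>" using lo hi \<beta> \<gamma> by simp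
    then have K4: "2 * K \<le> 3 * hi\<^sup>2 * \<beta>\<^sup>2 + (hi - 2 * lo) * \<beta> * \<gamma> + (hi + 2) * \<gamma>\<^sup>2 + 1"
      using K2 gb gb0 by (simp add: algebra_simps)
    have gl': "\<gamma> * \<mu> \<le> \<gamma> * hi" using hi \<gamma> by (intro mult_left_mono) auto
    have cx: "\<alpha> * (1 - (b - \<gamma>) / 2) + \<alpha>\<^sup>2 * (2 * K) \<le> ?cx"
      using blo K3 \<alpha> by (intro add_mono mult_left_mono) auto
    have ce: "\<alpha> * ((b - \<gamma>) / 2 + \<gamma> * \<mu>) + \<alpha>\<^sup>2 * (2 * K) \<le> ?ce"
      using blo K4 gl' \<alpha> \<gamma> by (intro add_mono mult_left_mono) (auto simp: mult.commute)
    show ?thesis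
      using mult_right_mono[OF cx zero_le_power2[of \<xi>]] mult_right_mono[OF ce zero_le_power2[of e]]
      by linarith
  qed
  finally show ?thesis unfolding W_def .
qed

text \<open>The cross term is split with weight \<tau>: its w part consumes exactly the surplus
  \<tau> in the coefficient 1 + \<tau>, and its \<xi> part leaves 1 / 2 - 1 / (2 * \<tau> * \<mu>).
  The factor in front is this value at \<mu> = lo; it becomes
  \<open>\<epsilon>\<^sub>1\<close>.\<close>

lemma mode_lyap_lower_bound:
  assumes "lo > 0" "lo \<le> \<mu>" "\<tau> > 0"
  shows "(\<tau> * lo - 1) / (2 * \<tau> * lo) * (\<xi>\<^sup>2 + w\<^sup>2 / \<mu>) \<le> mode_lyap (1 + \<tau>) \<mu> \<xi> w"
proof -
  have \<mu>: "\<mu> > 0" using assms by simp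
  have y: "(- (1 / \<mu>)) * \<xi> * w \<le> 1 / (2 * \<tau> * \<mu>) * \<xi>\<^sup>2 + \<tau> / (2 * \<mu>) * w\<^sup>2"
    using assms \<mu> by (intro young) (auto simp: power2_eq_square field_simps)
  have e: "(\<tau> * lo - 1) / (2 * \<tau> * lo) = 1 / 2 - 1 / (2 * \<tau> * lo)"
    using assms by (simp add: field_simps)
  have "1 / (2 * \<tau> * \<mu>) \<le> 1 / (2 * \<tau> * lo)" using assms by (intro frac_le) auto
  then have "(\<tau> * lo - 1) / (2 * \<tau> * lo) * \<xi>\<^sup>2 \<le> (1 / 2 - 1 / (2 * \<tau> * \<mu>)) * \<xi>\<^sup>2"
    unfolding e by (intro mult_right_mono) auto
  moreover have "(\<tau> * lo - 1) / (2 * \<tau> * lo) * (w\<^sup>2 / \<mu>) \<le> 1 / 2 * (w\<^sup>2 / \<mu>)"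
    unfolding e using assms \<mu> by (intro mult_right_mono) auto
  moreover have "(1 + \<tau>) / (2 * \<mu>) * w\<^sup>2 = 1 / 2 * (w\<^sup>2 / \<mu>) + \<tau> / (2 * \<mu>) * w\<^sup>2"
    using \<mu> by (simp add: field_simps)
  moreover have "(1 / 2 - 1 / (2 * \<tau> * \<mu>)) * \<xi>\<^sup>2 = \<xi>\<^sup>2 / 2 - 1 / (2 * \<tau> * \<mu>) * \<xi>\<^sup>2"
    by (simp add: algebra_simps)
  moreover have "(- (1 / \<mu>)) * \<xi> * w = - (\<xi> * w / \<mu>)" by simp
  ultimately show ?thesis using y unfolding mode_lyap_def distrib_left by linarith
qed

section \<open>Modal coordinates\<close>

text \<open>The coordinates of column c of z in the orthonormal basis formed by the columns of U;
  mode 0 is the direction of the average. Taking z as a plain function of agent and coordinate makes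
  linearity unconditional.\<close>

definition modal :: "nat \<Rightarrow> real mat \<Rightarrow> (nat \<Rightarrow> nat \<Rightarrow> real) \<Rightarrow> nat \<Rightarrow> nat \<Rightarrow> real" where
  "modal n U z m c = (\<Sum>i<n. U $$ (i, m) * z i c)"

lemma modal_linear:
  "modal n U (\<lambda>i c. z i c + w i c) m c = modal n U z m c + modal n U w m c"
  "modal n U (\<lambda>i c. z i c - w i c) m c = modal n U z m c - modal n U w m c"
  "modal n U (\<lambda>i c. b * z i c) m c = b * modal n U z m c"
  by (simp_all add: modal_def sum.distrib sum_subtractf sum_distrib_left algebra_simps)

lemma modal_cong: "(\<And>i. i < n \<Longrightarrow> z i c = w i c) \<Longrightarrow> modal n U z m c = modal n U w m c"
  by (simp add: modal_def)

lemma orthogonal_columns: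
  fixes U :: "real mat"
  assumes "U \<in> carrier_mat n n" "transpose_mat U * U = 1\<^sub>m n" "m < n" "k < n"
  shows "(\<Sum>i<n. U $$ (i, m) * U $$ (i, k)) = (if m = k then 1 else 0)"
proof -
  have "(transpose_mat U * U) $$ (m, k) = (\<Sum>i<n. U $$ (i, m) * U $$ (i, k))"
    using assms(1,3,4) by (auto simp: scalar_prod_def atLeast0LessThan intro!: sum.cong)
  from this[unfolded assms(2)] show ?thesis using assms(3,4) by simp
qed

lemma orthogonal_rows:
  fixes U :: "real mat"
  assumes "U \<in> carrier_mat n n" "U * transpose_mat U = 1\<^sub>m n" "i < n" "j < n"
  shows "(\<Sum>m<n. U $$ (i, m) * U $$ (j, m)) = (if i = j then 1 else 0)"
proof -
  have "(U * transpose_mat U) $$ (i, j) = (\<Sum>m<n. U $$ (i, m) * U $$ (j, m))"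
    using assms(1,3,4) by (auto simp: scalar_prod_def atLeast0LessThan intro!: sum.cong)
  from this[unfolded assms(2)] show ?thesis using assms(3,4) by simp
qed

lemma index_diagonalized:
  fixes U :: "real mat"
  assumes U: "U \<in> carrier_mat n n" and ij: "i < n" "j < n"
  shows "(U * mat_diag n \<kappa> * transpose_mat U) $$ (i, j) = (\<Sum>m<n. \<kappa> m * U $$ (i, m) * U $$ (j, m))"
  using assms unfolding mat_diag_mult_right[OF U]
  by (auto simp: scalar_prod_def atLeast0LessThan mult.commute mult.left_commute intro!: sum.cong)

lemma modal_parseval:
  assumes "U \<in> carrier_mat n n" "U * transpose_mat U = 1\<^sub>m n"
  shows "(\<Sum>m<n. modal n U z m c * modal n U w m c) = (\<Sum>i<n. z i c * w i c)"
proof -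
  have "(\<Sum>m<n. modal n U z m c * modal n U w m c)
      = (\<Sum>m<n. \<Sum>i<n. \<Sum>j<n. z i c * w j c * (U $$ (i, m) * U $$ (j, m)))"
    unfolding modal_def sum_product by (simp add: algebra_simps)
  also have "\<dots> = (\<Sum>i<n. \<Sum>j<n. \<Sum>m<n. z i c * w j c * (U $$ (i, m) * U $$ (j, m)))"
    by (subst sum.swap, rule sum.cong[OF refl], rule sum.swap)
  also have "\<dots> = (\<Sum>i<n. \<Sum>j<n. z i c * w j c * (if i = j then 1 else 0))"
    unfolding sum_distrib_left[symmetric] using orthogonal_rows[OF assms]
    by (intro sum.cong refl) auto
  also have "\<dots> = (\<Sum>i<n. z i c * w i c)" by (simp add: if_distrib cong: if_cong)
  finally show ?thesis .
qed

lemma modal_diagonalized: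
  assumes U: "U \<in> carrier_mat n n" and orth: "transpose_mat U * U = 1\<^sub>m n" and m: "m < n"
    and L: "L = U * mat_diag n \<kappa> * transpose_mat U"
  shows "modal n U (\<lambda>i c. \<Sum>j<n. L $$ (i, j) * z j c) m c = \<kappa> m * modal n U z m c"
proof -
  have "modal n U (\<lambda>i c. \<Sum>j<n. L $$ (i, j) * z j c) m c
      = (\<Sum>i<n. \<Sum>j<n. \<Sum>k<n. \<kappa> k * U $$ (j, k) * z j c * (U $$ (i, m) * U $$ (i, k)))"
    unfolding modal_def L using index_diagonalized[OF U]
    by (simp add: sum_distrib_left sum_distrib_right algebra_simps)
  also have "\<dots> = (\<Sum>j<n. \<Sum>k<n. \<Sum>i<n. \<kappa> k * U $$ (j, k) * z j c * (U $$ (i, m) * U $$ (i, k)))"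
    by (subst sum.swap, rule sum.cong[OF refl], rule sum.swap)
  also have "\<dots> = (\<Sum>j<n. \<Sum>k<n. \<kappa> k * U $$ (j, k) * z j c * (if m = k then 1 else 0))"
    unfolding sum_distrib_left[symmetric] using orthogonal_columns[OF U orth m]
    by (intro sum.cong refl) auto
  also have "\<dots> = \<kappa> m * modal n U z m c"
    using m by (simp add: if_distrib modal_def sum_distrib_left algebra_simps cong: if_cong)
  finally show ?thesis .
qed

lemma diagonalized_form:
  assumes U: "U \<in> carrier_mat n n" and orth: "U * transpose_mat U = 1\<^sub>m n" "transpose_mat U * U = 1\<^sub>m n"
    and L: "L = U * mat_diag n \<kappa> * transpose_mat U"
  shows "(\<Sum>i<n. z i c * (\<Sum>j<n. L $$ (i, j) * w j c)) = (\<Sum>m<n. \<kappa> m * modal n U z m c * modal n U w m c)"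
proof -
  have "(\<Sum>i<n. z i c * (\<Sum>j<n. L $$ (i, j) * w j c))
      = (\<Sum>m<n. modal n U z m c * modal n U (\<lambda>i c. \<Sum>j<n. L $$ (i, j) * w j c) m c)"
    by (rule modal_parseval[OF U orth(1), symmetric])
  also have "\<dots> = (\<Sum>m<n. \<kappa> m * modal n U z m c * modal n U w m c)"
    using modal_diagonalized[OF U orth(2) _ L] by (intro sum.cong) auto
  finally show ?thesis .
qed

lemma modal_0:
  assumes U: "U \<in> carrier_mat n n" and c0: "col U 0 = vec n (\<lambda>_. 1 / sqrt (real n))" and n: "n > 0"
  shows "modal n U z 0 c = (\<Sum>i<n. z i c) / sqrt (real n)"
proof -
  have "U $$ (i, 0) = 1 / sqrt (real n)" if "i < n" for i
    using arg_cong[OF c0, of "\<lambda>v. v $ i"] that U n by simp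
  then show ?thesis unfolding modal_def by (simp add: sum_divide_distrib)
qed

section \<open>Spectrum of the Laplacian\<close>

text \<open>Similarity to a diagonal matrix fixes the characteristic polynomial. The field is
  arbitrary because the smallest positive eigenvalue is taken over the reals and the spectral radius
  over the complex numbers.\<close>

lemma eigenvalue_diagonalized:
  fixes U V :: "'a::field mat"
  assumes U: "U \<in> carrier_mat n n" and V: "V \<in> carrier_mat n n" and UV: "U * V = 1\<^sub>m n" "V * U = 1\<^sub>m n"
  shows "eigenvalue (U * mat_diag n \<kappa> * V) e \<longleftrightarrow> e \<in> \<kappa> ` {..<n}"
proof -
  have D: "mat_diag n \<kappa> \<in> carrier_mat n n" by simp
  have LD: "U * mat_diag n \<kappa> * V \<in> carrier_mat n n" using U V D by (intro mult_carrier_mat)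
  have "similar_mat (U * mat_diag n \<kappa> * V) (mat_diag n \<kappa>)"
    by (rule similar_matI[of _ _ U V n]) (use U V UV D LD in auto)
  then have cp: "char_poly (U * mat_diag n \<kappa> * V) = char_poly (mat_diag n \<kappa>)"
    by (rule char_poly_similar)
  have "char_poly (mat_diag n \<kappa>) = (\<Prod>a\<leftarrow>diag_mat (mat_diag n \<kappa>). [:- a, 1:])"
    by (rule char_poly_upper_triangular[OF D]) (auto simp: upper_triangular_def mat_diag_def)
  moreover have "set (diag_mat (mat_diag n \<kappa>)) = \<kappa> ` {..<n}"
    by (auto simp: diag_mat_def mat_diag_def)
  ultimately show ?thesis unfolding eigenvalue_root_char_poly[OF LD] cp
    by (auto simp: poly_prod_list prod_list_zero_iff)
qed

text \<open>The eigenvalue 0 sits at index 0 alone, as all later entries are at least lam 2 > 0;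
  monotonicity makes lam 2 and lam n the extremes of the rest.\<close>

lemma laplacian_spectrum:
  assumes ed: "laplacian_eigendecomp n L U lam" and n: "n \<ge> 2"
  shows "smallest_pos_eigenvalue L = lam 2"
    and "spectral_radius (map_mat complex_of_real L) = lam n"
proof -
  define \<kappa> where "\<kappa> i = (if i = 0 then 0 else lam (i + 1))" for i :: nat
  have U: "U \<in> carrier_mat n n" and UU: "U * transpose_mat U = 1\<^sub>m n" "transpose_mat U * U = 1\<^sub>m n"
    and L: "L = U * mat_diag n \<kappa> * transpose_mat U" and p: "0 < lam 2"
    and mono: "\<And>i j. i \<in> {2..n} \<Longrightarrow> j \<in> {2..n} \<Longrightarrow> i \<le> j \<Longrightarrow> lam i \<le> lam j"
    using ed unfolding laplacian_eigendecomp_def \<kappa>_def by auto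
  have ev: "eigenvalue L e \<longleftrightarrow> e \<in> \<kappa> ` {..<n}" for e
    unfolding L using eigenvalue_diagonalized[OF U _ UU, of \<kappa> e] U by simp
  have pos: "\<kappa> i \<ge> lam 2 \<and> \<kappa> i \<le> lam n" if "0 < i" "i < n" for i
    using that mono[of 2 "i + 1"] mono[of "i + 1" n] n unfolding \<kappa>_def by auto
  have set: "{e. eigenvalue L e \<and> e > 0} = \<kappa> ` {1..<n}"
  proof (rule subset_antisym; rule subsetI)
    fix e assume "e \<in> {e. eigenvalue L e \<and> e > 0}"
    then obtain i where "i < n" "e = \<kappa> i" "\<kappa> i > 0" unfolding ev by auto
    moreover from this have "i > 0" by (cases "i = 0") (auto simp: \<kappa>_def)
    ultimately show "e \<in> \<kappa> ` {1..<n}" by simp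
  next
    fix e assume "e \<in> \<kappa> ` {1..<n}"
    then obtain i where "i \<in> {1..<n}" and e: "e = \<kappa> i" by blast
    then have "0 < i" "i < n" by auto
    then show "e \<in> {e. eigenvalue L e \<and> e > 0}" unfolding ev e using pos[of i] p by auto
  qed
  have k1: "\<kappa> 1 = lam 2" "1 \<in> {1..<n}" using n by (auto simp: \<kappa>_def numeral_2_eq_2)
  show "smallest_pos_eigenvalue L = lam 2"
    unfolding smallest_pos_eigenvalue_def set
  proof (rule Min_eqI)
    show "lam 2 \<in> \<kappa> ` {1..<n}" using k1 by (metis imageI)
  next
    fix y assume "y \<in> \<kappa> ` {1..<n}"
    then obtain i where "i \<in> {1..<n}" "y = \<kappa> i" by blast
    then show "lam 2 \<le> y" using pos[of i] by simp
  qed simp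

  \<comment> \<open>Over the complex numbers U and its transpose are still mutually inverse, so the
    complex spectrum consists of the same real values.\<close>
  define cU where "cU = map_mat complex_of_real U"
  define cV where "cV = map_mat complex_of_real (transpose_mat U)"
  define c\<kappa> where "c\<kappa> i = complex_of_real (\<kappa> i)" for i
  have Vc: "transpose_mat U \<in> carrier_mat n n" using U by simp
  have cc: "cU \<in> carrier_mat n n" "cV \<in> carrier_mat n n" unfolding cU_def cV_def using U by auto
  have one: "map_mat complex_of_real (1\<^sub>m n) = 1\<^sub>m n" by (rule eq_matI) auto
  have cUV: "cU * cV = 1\<^sub>m n" "cV * cU = 1\<^sub>m n"
    unfolding cU_def cV_def of_real_hom.mat_hom_mult[OF U Vc, symmetric]
      of_real_hom.mat_hom_mult[OF Vc U, symmetric] UU one by auto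
  have dg: "map_mat complex_of_real (mat_diag n \<kappa>) = mat_diag n c\<kappa>"
    by (rule eq_matI) (auto simp: mat_diag_def c\<kappa>_def)
  have cL: "map_mat complex_of_real L = cU * mat_diag n c\<kappa> * cV"
    unfolding L cU_def cV_def dg[symmetric] using U
    by (simp add: of_real_hom.mat_hom_mult[of _ n n _ n])
  have "spectrum (map_mat complex_of_real L) = c\<kappa> ` {..<n}"
    unfolding spectrum_def cL using eigenvalue_diagonalized[OF cc cUV] by auto
  then have "norm ` spectrum (map_mat complex_of_real L) = (\<lambda>i. \<bar>\<kappa> i\<bar>) ` {..<n}"
    by (auto simp: c\<kappa>_def image_image)
  moreover have "Max ((\<lambda>i. \<bar>\<kappa> i\<bar>) ` {..<n}) = lam n"
  proof (rule Max_eqI)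
    have l: "lam n \<ge> lam 2" using mono[of 2 n] n by auto
    fix y assume "y \<in> (\<lambda>i. \<bar>\<kappa> i\<bar>) ` {..<n}"
    then obtain i where i: "i < n" "y = \<bar>\<kappa> i\<bar>" by auto
    then show "y \<le> lam n" using pos[of i] l p by (cases "i = 0") (auto simp: \<kappa>_def)
  next
    have "lam n = \<bar>\<kappa> (n - 1)\<bar>" using n pos[of "n - 1"] p by (auto simp: \<kappa>_def)
    then show "lam n \<in> (\<lambda>i. \<bar>\<kappa> i\<bar>) ` {..<n}" using n by auto
  qed simp
  ultimately show "spectral_radius (map_mat complex_of_real L) = lam n"
    unfolding spectral_radius_def by simp
qed

section \<open>Stacked vectors, Kronecker products and the Lyapunov function\<close>

lemma sum_stack_index: "(\<Sum>a<n * d. g (a div d) (a mod d)) = (\<Sum>i<n. \<Sum>c<d. g i c)" for d :: nat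
proof -
  have "(\<Sum>a<n * d. g (a div d) (a mod d)) = (\<Sum>i<n. \<Sum>a\<in>{i * d..<i * d + d}. g (a div d) (a mod d))"
    by (rule sum.nat_group[symmetric])
  also have "\<dots> = (\<Sum>i<n. \<Sum>c<d. g i c)"
  proof (rule sum.cong[OF refl])
    fix i show "(\<Sum>a\<in>{i * d..<i * d + d}. g (a div d) (a mod d)) = (\<Sum>c<d. g i c)"
      by (subst sum.atLeastLessThan_shift_0) (auto simp: atLeast0LessThan intro!: sum.cong)
  qed
  finally show ?thesis .
qed

lemma stack_carrier [simp]: "stack n d x \<in> carrier_vec (n * d)"
  by (simp add: stack_def)

lemma stack_scalar_prod: "stack n d x \<bullet> stack n d y = (\<Sum>i<n. \<Sum>c<d. x i $ c * y i $ c)"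
proof -
  have "stack n d x \<bullet> stack n d y = (\<Sum>a<n * d. x (a div d) $ (a mod d) * y (a div d) $ (a mod d))"
    by (auto simp: scalar_prod_def stack_def atLeast0LessThan intro!: sum.cong)
  then show ?thesis using sum_stack_index[where g = "\<lambda>i c. x i $ c * y i $ c"] by simp
qed

lemma kron_one_carrier:
  "A \<in> carrier_mat n n \<Longrightarrow> kron A (1\<^sub>m d) \<in> carrier_mat (n * d) (n * d)"
  unfolding kron_def by auto

lemma kron_one_mult_stack:
  assumes A: "A \<in> carrier_mat n n" and d: "d > 0"
  shows "kron A (1\<^sub>m d) *\<^sub>v stack n d x = stack n d (\<lambda>i. vec d (\<lambda>c. \<Sum>j<n. A $$ (i, j) * x j $ c))"
proof (rule eq_vecI)
  fix a assume "a < dim_vec (stack n d (\<lambda>i. vec d (\<lambda>c. \<Sum>j<n. A $$ (i, j) * x j $ c)))"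
  then have a: "a < n * d" by (simp add: stack_def)
  have m: "a mod d < d" using d by simp
  have "(kron A (1\<^sub>m d) *\<^sub>v stack n d x) $ a
      = (\<Sum>b<n * d. A $$ (a div d, b div d) * (1\<^sub>m d) $$ (a mod d, b mod d) * x (b div d) $ (b mod d))"
    using a A by (auto simp: kron_def stack_def scalar_prod_def atLeast0LessThan intro!: sum.cong)
  also have "\<dots> = (\<Sum>j<n. \<Sum>c<d. A $$ (a div d, j) * (1\<^sub>m d) $$ (a mod d, c) * x j $ c)"
    by (rule sum_stack_index[where g = "\<lambda>j c. A $$ (a div d, j) * (1\<^sub>m d) $$ (a mod d, c) * x j $ c"])
  also have "\<dots> = (\<Sum>j<n. \<Sum>c<d. if a mod d = c then A $$ (a div d, j) * x j $ c else 0)"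
    using m by (intro sum.cong refl) auto
  also have "\<dots> = (\<Sum>j<n. A $$ (a div d, j) * x j $ (a mod d))" using m by simp
  finally show "(kron A (1\<^sub>m d) *\<^sub>v stack n d x) $ a
      = stack n d (\<lambda>i. vec d (\<lambda>c. \<Sum>j<n. A $$ (i, j) * x j $ c)) $ a"
    using a m by (simp add: stack_def)
qed (use A in \<open>simp add: kron_def stack_def\<close>)

text \<open>A Kronecker product with the identity acts on each coordinate separately, so
  diagonalizing the n by n factor diagonalizes the stacked form.\<close>

lemma kron_form:
  assumes U: "U \<in> carrier_mat n n" and orth: "U * transpose_mat U = 1\<^sub>m n" "transpose_mat U * U = 1\<^sub>m n"
    and d: "d > 0"
  shows "stack n d x \<bullet> (kron (U * mat_diag n \<kappa> * transpose_mat U) (1\<^sub>m d) *\<^sub>v stack n d w)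
    = (\<Sum>c<d. \<Sum>m<n. \<kappa> m * modal n U (\<lambda>i c. x i $ c) m c * modal n U (\<lambda>i c. w i $ c) m c)"
proof -
  have K: "U * mat_diag n \<kappa> * transpose_mat U \<in> carrier_mat n n"
    using U by (intro mult_carrier_mat[of _ n n] mat_diag_dim) auto
  show ?thesis
    unfolding kron_one_mult_stack[OF K d] stack_scalar_prod
    by (subst sum.swap) (simp add: diagonalized_form[OF U orth refl,
          where z = "\<lambda>i c. x i $ c" and w = "\<lambda>i c. w i $ c"])
qed

text \<open>Orthogonality of the rows expresses the identity through all columns of U; removing the
  projection onto the first one leaves the centering matrix. Hence E, F and the Laplacian share one
  eigenbasis.\<close>

lemma centering_diagonalized:
  fixes U :: "real mat"
  assumes U: "U \<in> carrier_mat n n" and orth: "U * transpose_mat U = 1\<^sub>m n"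
    and c0: "col U 0 = vec n (\<lambda>_. 1 / sqrt (real n))" and n: "n > 0"
  shows "1\<^sub>m n - mat n n (\<lambda>_. 1 / real n) = U * mat_diag n (\<lambda>m. if m = 0 then 0 else 1) * transpose_mat U"
proof (rule eq_matI)
  fix i j assume "i < dim_row (U * mat_diag n (\<lambda>m. if m = 0 then 0 else 1) * transpose_mat U)"
    "j < dim_col (U * mat_diag n (\<lambda>m. if m = 0 then 0 else 1) * transpose_mat U)"
  then have ij: "i < n" "j < n" using U by auto
  have u0: "U $$ (i, 0) = 1 / sqrt (real n)" if "i < n" for i
    using arg_cong[OF c0, of "\<lambda>v. v $ i"] that U n by simp
  have "(\<Sum>m<n. (if m = 0 then 0 else 1) * U $$ (i, m) * U $$ (j, m))
      = (\<Sum>m<n. U $$ (i, m) * U $$ (j, m) - (if m = 0 then U $$ (i, m) * U $$ (j, m) else 0))"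
    by (intro sum.cong) auto
  also have "\<dots> = (if i = j then 1 else 0) - 1 / real n"
    using n ij u0 by (simp add: sum_subtractf orthogonal_rows[OF U orth])
  finally show "(1\<^sub>m n - mat n n (\<lambda>_. 1 / real n)) $$ (i, j)
      = (U * mat_diag n (\<lambda>m. if m = 0 then 0 else 1) * transpose_mat U) $$ (i, j)"
    using ij index_diagonalized[OF U ij] by simp
qed (use U in auto)

lemma sum_lessThan_head: "n > 0 \<Longrightarrow> (\<Sum>m<n. g m) = g 0 + (\<Sum>m\<in>{1..<n}. g m)" for g :: "nat \<Rightarrow> real"
  using sum.atLeast_Suc_lessThan[of 0 n g] by (simp add: atLeast0LessThan)

text \<open>E and F are diagonal in the basis U. On mode 0 the matrix E vanishes, so besides the
  optimality gap only the F term sees that mode, with \<open>lam (n + 1)\<close> in place of the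
  eigenvalue 0.\<close>

lemma lyapunov_modal:
  fixes \<beta> \<gamma> :: real and f :: "nat \<Rightarrow> real vec \<Rightarrow> real" and x v :: "nat \<Rightarrow> real vec"
  assumes ed: "laplacian_eigendecomp n L U lam" and n: "n > 0" and d: "d > 0"
  defines "g0 \<equiv> \<lambda>i. grad d (f i) (mean_vec n d x)"
  defines "\<xi> \<equiv> modal n U (\<lambda>i c. x i $ c)"
  defines "\<eta> \<equiv> modal n U (\<lambda>i c. v i $ c + 1 / \<gamma> * g0 i $ c)"
  defines "a \<equiv> (\<beta> + \<gamma>) / \<gamma>"
  shows "lyapunov n d U lam f \<beta> \<gamma> x v =
    (\<Sum>c<d. (\<Sum>m\<in>{1..<n}. mode_lyap a (lam (m + 1)) (\<xi> m c) (\<eta> m c))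
        + a / (2 * lam (n + 1)) * (\<eta> 0 c)\<^sup>2)
    + real n * (avg_fun n f (mean_vec n d x) - f_star n d f)"
proof -
  have U: "U \<in> carrier_mat n n" and UU: "U * transpose_mat U = 1\<^sub>m n" "transpose_mat U * U = 1\<^sub>m n"
    and c0: "col U 0 = vec n (\<lambda>_. 1 / sqrt (real n))"
    using ed unfolding laplacian_eigendecomp_def by auto
  define \<kappa> where "\<kappa> i = (if i = 0 then 1 / lam (n + 1) else 1 / lam (i + 1))" for i :: nat
  define KF where "KF = U * mat_diag n \<kappa> * transpose_mat U"
  define w where "w i = vec d (\<lambda>c. v i $ c + 1 / \<gamma> * g0 i $ c)" for i
  define X where "X = stack n d x"
  define W where "W = stack n d v + (1 / \<gamma>) \<cdot>\<^sub>v stack n d g0"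
  have W: "W = stack n d w" unfolding W_def w_def
    using d by (intro eq_vecI) (auto simp: stack_def)
  have KF: "KF \<in> carrier_mat n n"
    unfolding KF_def using U by (intro mult_carrier_mat[of _ n n] mat_diag_dim) auto
  have F: "F_mat n d U lam = kron KF (1\<^sub>m d)" unfolding F_mat_def KF_def \<kappa>_def by simp
  have E: "E_mat n d = kron (U * mat_diag n (\<lambda>m. if m = 0 then 0 else 1) * transpose_mat U) (1\<^sub>m d)"
    unfolding E_mat_def centering_diagonalized[OF U UU(1) c0 n] ..
  have Fc: "F_mat n d U lam \<in> carrier_mat (n * d) (n * d)" unfolding F by (rule kron_one_carrier[OF KF])
  have Ec: "E_mat n d \<in> carrier_mat (n * d) (n * d)"
    unfolding E_mat_def by (rule kron_one_carrier) (auto intro!: minus_carrier_mat)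
  have mw: "modal n U (\<lambda>i c. w i $ c) m c = \<eta> m c" if "c < d" for m c
    unfolding \<eta>_def w_def modal_def using that by simp
  have tE: "wnorm_sq (E_mat n d) X = (\<Sum>c<d. \<Sum>m\<in>{1..<n}. (\<xi> m c)\<^sup>2)"
    unfolding wnorm_sq_def X_def E kron_form[OF U UU d] unfolding \<xi>_def[symmetric] sum_lessThan_head[OF n]
    by (auto intro!: sum.cong simp: power2_eq_square)
  have "wnorm_sq (a \<cdot>\<^sub>m F_mat n d U lam) W = a * wnorm_sq (F_mat n d U lam) W"
  proof -
    have Wc: "W \<in> carrier_vec (n * d)" unfolding W by simp
    have "(a \<cdot>\<^sub>m F_mat n d U lam) *\<^sub>v W = a \<cdot>\<^sub>v (F_mat n d U lam *\<^sub>v W)"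
    proof (rule eq_vecI)
      fix i assume "i < dim_vec (a \<cdot>\<^sub>v (F_mat n d U lam *\<^sub>v W))"
      then have i: "i < n * d" using Fc by simp
      then have "row (F_mat n d U lam) i \<in> carrier_vec (n * d)" using Fc by simp
      then show "((a \<cdot>\<^sub>m F_mat n d U lam) *\<^sub>v W) $ i = (a \<cdot>\<^sub>v (F_mat n d U lam *\<^sub>v W)) $ i"
        using i Fc smult_scalar_prod_distrib[OF _ Wc] by simp
    qed (use Fc in simp)
    moreover have "F_mat n d U lam *\<^sub>v W \<in> carrier_vec (n * d)" using Fc by (rule mult_mat_vec_carrier) (rule Wc)
    moreover note Wc
    ultimately show ?thesis unfolding wnorm_sq_def by simp
  qed
  also have "wnorm_sq (F_mat n d U lam) W
      = (\<Sum>c<d. (\<eta> 0 c)\<^sup>2 / lam (n + 1) + (\<Sum>m\<in>{1..<n}. (\<eta> m c)\<^sup>2 / lam (m + 1)))"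
    unfolding wnorm_sq_def W F KF_def kron_form[OF U UU d] unfolding sum_lessThan_head[OF n]
    by (auto intro!: sum.cong arg_cong2[where f = "(+)"] simp: mw \<kappa>_def power2_eq_square)
  finally have tF: "wnorm_sq (a \<cdot>\<^sub>m F_mat n d U lam) W
      = a * (\<Sum>c<d. (\<eta> 0 c)\<^sup>2 / lam (n + 1) + (\<Sum>m\<in>{1..<n}. (\<eta> m c)\<^sup>2 / lam (m + 1)))" .
  have "X \<bullet> ((E_mat n d * F_mat n d U lam) *\<^sub>v W) = X \<bullet> (E_mat n d *\<^sub>v (F_mat n d U lam *\<^sub>v W))"
    using Ec Fc W by (simp add: assoc_mult_mat_vec[of _ "n * d" "n * d"])
  also have "\<dots> = (\<Sum>c<d. \<Sum>m<n. (if m = 0 then 0 else 1) * \<xi> m c * (\<kappa> m * \<eta> m c))"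
    unfolding X_def W F kron_one_mult_stack[OF KF d] unfolding E kron_form[OF U UU d] \<xi>_def[symmetric]
  proof (intro sum.cong refl arg_cong2[where f = "(*)"])
    fix c m assume cm: "c \<in> {..<d}" "m \<in> {..<n}"
    have "modal n U (\<lambda>i c. vec d (\<lambda>c. \<Sum>j<n. KF $$ (i, j) * w j $ c) $ c) m c
        = modal n U (\<lambda>i c. \<Sum>j<n. KF $$ (i, j) * w j $ c) m c"
      using cm by (intro modal_cong) auto
    also have "\<dots> = \<kappa> m * \<eta> m c"
      using modal_diagonalized[OF U UU(2) _ KF_def, where z = "\<lambda>i c. w i $ c"] cm mw by simp
    finally show "modal n U (\<lambda>i c. vec d (\<lambda>c. \<Sum>j<n. KF $$ (i, j) * w j $ c) $ c) m c = \<kappa> m * \<eta> m c" .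
  qed
  also have "\<dots> = (\<Sum>c<d. \<Sum>m\<in>{1..<n}. \<xi> m c * \<eta> m c / lam (m + 1))"
    unfolding sum_lessThan_head[OF n] by (auto intro!: sum.cong simp: \<kappa>_def)
  finally have tX: "X \<bullet> ((E_mat n d * F_mat n d U lam) *\<^sub>v W)
      = (\<Sum>c<d. \<Sum>m\<in>{1..<n}. \<xi> m c * \<eta> m c / lam (m + 1))" .
  have "lyapunov n d U lam f \<beta> \<gamma> x v = wnorm_sq (E_mat n d) X / 2
      + wnorm_sq (a \<cdot>\<^sub>m F_mat n d U lam) W / 2 + X \<bullet> ((E_mat n d * F_mat n d U lam) *\<^sub>v W)
      + real n * (avg_fun n f (mean_vec n d x) - f_star n d f)"
    unfolding lyapunov_def Let_def X_def W_def a_def g0_def ..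
  also have "\<dots> = (\<Sum>c<d. (\<Sum>m\<in>{1..<n}. (\<xi> m c)\<^sup>2) / 2
      + a / 2 * ((\<eta> 0 c)\<^sup>2 / lam (n + 1) + (\<Sum>m\<in>{1..<n}. (\<eta> m c)\<^sup>2 / lam (m + 1)))
      + (\<Sum>m\<in>{1..<n}. \<xi> m c * \<eta> m c / lam (m + 1)))
      + real n * (avg_fun n f (mean_vec n d x) - f_star n d f)"
    unfolding tE tF tX sum.distrib sum_divide_distrib[symmetric] sum_distrib_left[symmetric] by simp
  also have "(\<Sum>c<d. (\<Sum>m\<in>{1..<n}. (\<xi> m c)\<^sup>2) / 2
      + a / 2 * ((\<eta> 0 c)\<^sup>2 / lam (n + 1) + (\<Sum>m\<in>{1..<n}. (\<eta> m c)\<^sup>2 / lam (m + 1)))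
      + (\<Sum>m\<in>{1..<n}. \<xi> m c * \<eta> m c / lam (m + 1)))
    = (\<Sum>c<d. (\<Sum>m\<in>{1..<n}. mode_lyap a (lam (m + 1)) (\<xi> m c) (\<eta> m c))
        + a / (2 * lam (n + 1)) * (\<eta> 0 c)\<^sup>2)"
    unfolding mode_lyap_def sum.distrib[of _ _ "{1..<n}"] distrib_left sum_divide_distrib sum_distrib_left
    by (intro sum.cong refl) simp
  finally show ?thesis .
qed

section \<open>The network\<close>

text \<open>Facts about the constants and about abstract modes. The last four conditions follow from
  an actual network and run; stating them here keeps the inequalities among the constants separate
  from both.\<close>

locale compression_params =
  fixes P :: params
  assumes lip_pos: "lip P > 0"
    and tau_ge: "\<tau>\<^sub>1 P \<ge> \<kappa>\<^sub>1 P" and beta_eq: "\<beta> P = \<tau>\<^sub>1 P * \<gamma> P" and gamma_gt: "\<gamma> P > \<kappa>\<^sub>2 P"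
    and scale_pos: "scale P > 0" and rad_pos: "rad P > 0" and delta: "0 < \<delta> P" "\<delta> P \<le> 1"
    and omega_pos: "0 < \<omega> P" and omega_le: "\<omega> P \<le> 1 / scale P"
    and kh_pos: "kh P > 0" and kappa7_pos: "\<kappa>\<^sub>7 P > 0"
    and rho2_pos: "\<rho>\<^sub>2 P > 0" and rho2_le_rho: "\<rho>\<^sub>2 P \<le> \<rho> P"
    and dh_pos: "dh P > 0" and s0_pos: "s\<^sub>0 P > 0"
begin

section \<open>Signs and ranges of the constants\<close>

lemma gamma_bounds: "\<gamma> P > 2 + 2 * (lip P)\<^sup>2" "\<gamma> P > 5 / \<rho>\<^sub>2 P"
  using gamma_gt unfolding \<kappa>\<^sub>2_def by (simp_all add: Max_less_iff)

lemma gamma_pos: "\<gamma> P > 0"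
  using gamma_bounds(1) by (smt (verit) zero_le_power2)

lemma tau_rho2: "4 \<le> \<tau>\<^sub>1 P * \<rho>\<^sub>2 P"
  using tau_ge rho2_pos unfolding \<kappa>\<^sub>1_def by (simp add: field_simps)

lemma tau_pos: "\<tau>\<^sub>1 P > 0"
  using tau_rho2 rho2_pos by (smt (verit) mult_nonpos_nonneg)

lemma beta_pos: "\<beta> P > 0"
  unfolding beta_eq using tau_pos gamma_pos by simp

lemma rho_pos: "\<rho> P > 0"
  using rho2_pos rho2_le_rho by simp

lemma four_gamma_le: "4 * \<gamma> P \<le> \<beta> P * \<rho>\<^sub>2 P"
  using mult_right_mono[OF tau_rho2, of "\<gamma> P"] gamma_pos unfolding beta_eq by (simp add: algebra_simps)

lemma gamma_rho2: "\<gamma> P * \<rho>\<^sub>2 P \<ge> 1"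
  using gamma_bounds(2) rho2_pos by (simp add: field_simps)

lemma phi1_pos: "\<phi>\<^sub>1 P > 0"
  using four_gamma_le gamma_bounds(1) unfolding \<phi>\<^sub>1_def by (simp add: mult.commute)

text \<open>One factor \<gamma> is exchanged for the larger
  \<open>\<rho>\<^sub>2 P * \<beta> P\<close>. This makes \<open>\<phi>\<^sub>2\<close> and
  \<open>\<phi>\<^sub>8\<close> positive despite their negative mixed terms.\<close>

lemma rho_beta_sq_ge: "\<rho>\<^sub>2 P * \<beta> P * \<gamma> P \<le> (\<rho> P)\<^sup>2 * (\<beta> P)\<^sup>2"
proof -
  have b: "0 \<le> \<rho>\<^sub>2 P * \<beta> P" using rho2_pos beta_pos by simp
  have "\<gamma> P \<le> \<rho>\<^sub>2 P * \<beta> P" using four_gamma_le gamma_pos by (simp add: mult.commute)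
  then have "\<rho>\<^sub>2 P * \<beta> P * \<gamma> P \<le> (\<rho>\<^sub>2 P * \<beta> P) * (\<rho>\<^sub>2 P * \<beta> P)"
    using b by (intro mult_left_mono) auto
  also have "\<dots> = (\<rho>\<^sub>2 P * \<beta> P)\<^sup>2" by (simp add: power2_eq_square)
  also have "\<dots> \<le> (\<rho> P * \<beta> P)\<^sup>2" using rho2_pos rho2_le_rho beta_pos by (intro power_mono) auto
  finally show ?thesis by (simp add: power_mult_distrib)
qed

lemma phi2_pos: "\<phi>\<^sub>2 P > 0"
proof -
  have "(\<rho> P + 2) * (\<gamma> P)\<^sup>2 \<ge> 0" using rho_pos by simp
  moreover have "5 / 2 * (lip P)\<^sup>2 \<ge> 0" "(\<rho> P)\<^sup>2 * (\<beta> P)\<^sup>2 \<ge> 0" by auto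
  ultimately show ?thesis using rho_beta_sq_ge unfolding \<phi>\<^sub>2_def by (simp only: mult.assoc)
qed

lemma phi4_pos: "\<phi>\<^sub>4 P > 0"
  unfolding \<phi>\<^sub>4_def using rho_pos by (intro add_nonneg_pos) auto

lemma phi6_pos: "\<phi>\<^sub>6 P > 0"
  unfolding \<phi>\<^sub>6_def using rho2_pos gamma_pos beta_pos lip_pos
  by (intro add_nonneg_pos) auto

lemma phi7_pos: "\<phi>\<^sub>7 P > 0"
  unfolding \<phi>\<^sub>7_def using rho_pos gamma_pos beta_pos by (intro add_pos_pos) auto

lemma phi8_pos: "\<phi>\<^sub>8 P > 0"
proof -
  have "(\<rho> P + 2) * (\<gamma> P)\<^sup>2 \<ge> 0" "(\<rho> P)\<^sup>2 * (\<beta> P)\<^sup>2 \<ge> 0" "\<rho> P * \<beta> P * \<gamma> P \<ge> 0"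
    using rho_pos beta_pos gamma_pos by auto
  then show ?thesis using rho_beta_sq_ge unfolding \<phi>\<^sub>8_def left_diff_distrib by (simp only: mult.assoc)
qed

lemma psi2_pos: "\<alpha> \<ge> 0 \<Longrightarrow> \<psi>\<^sub>2 P \<alpha> > 0"
  unfolding \<psi>\<^sub>2_def using phi7_pos phi8_pos by (intro add_pos_nonneg) auto

lemma psi2_mono: "\<alpha> \<le> \<alpha>' \<Longrightarrow> \<psi>\<^sub>2 P \<alpha> \<le> \<psi>\<^sub>2 P \<alpha>'"
  unfolding \<psi>\<^sub>2_def using phi8_pos by simp

text \<open>Each entry of the minimum is the step size at which one descent coefficient vanishes. At
  the bound itself a coefficient may be zero, so only nonnegativity is available.\<close>

lemma kappa7_coeffs:
  assumes "\<alpha> \<le> \<kappa>\<^sub>7 P"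
  shows "\<alpha> * \<phi>\<^sub>2 P \<le> \<phi>\<^sub>1 P" "\<alpha> * \<phi>\<^sub>4 P \<le> \<phi>\<^sub>3 P" "\<alpha> * \<phi>\<^sub>6 P \<le> \<phi>\<^sub>5 P"
proof -
  have "\<alpha> \<le> \<phi>\<^sub>1 P / \<phi>\<^sub>2 P" "\<alpha> \<le> \<phi>\<^sub>3 P / \<phi>\<^sub>4 P" "\<alpha> \<le> \<phi>\<^sub>5 P / \<phi>\<^sub>6 P"
    using assms unfolding \<kappa>\<^sub>7_def \<kappa>\<^sub>0_hat_def by (auto simp: Min_ge_iff)
  then show "\<alpha> * \<phi>\<^sub>2 P \<le> \<phi>\<^sub>1 P" "\<alpha> * \<phi>\<^sub>4 P \<le> \<phi>\<^sub>3 P" "\<alpha> * \<phi>\<^sub>6 P \<le> \<phi>\<^sub>5 P"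
    using phi2_pos phi4_pos phi6_pos by (simp_all add: pos_le_divide_eq)
qed

lemma omega_scale: "0 < \<omega> P * scale P" "\<omega> P * scale P \<le> 1"
  using omega_pos omega_le scale_pos by (simp_all add: field_simps)

text \<open>With t = \<omega> * scale, the squared contraction factor is 1 - 2 * t * \<delta> + t^2
  * \<delta>^2, and t^2 <= t turns it into the bound that defines \<open>\<epsilon>\<^sub>5\<close>.
  The upper bound 1 / 2 keeps \<open>1 - 2 * \<epsilon>\<^sub>5 P\<close> nonnegative.\<close>

lemma eps5: "0 < \<epsilon>\<^sub>5 P" "\<epsilon>\<^sub>5 P \<le> 1 / 2" "(1 - \<omega> P * scale P * \<delta> P)\<^sup>2 \<le> 1 - 2 * \<epsilon>\<^sub>5 P"
proof -
  define t where "t = \<omega> P * scale P"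
  define D where "D = \<delta> P"
  have t: "0 < t" "t \<le> 1" and D: "0 < D" "D \<le> 1" unfolding t_def D_def using omega_scale delta by auto
  have e: "\<epsilon>\<^sub>5 P = t * (D - D\<^sup>2 / 2)" unfolding \<epsilon>\<^sub>5_def t_def D_def by simp
  have d2: "D\<^sup>2 \<le> D" using D by (simp add: power2_eq_square mult_left_le)
  then have pd: "0 < D - D\<^sup>2 / 2" using D by simp
  show "0 < \<epsilon>\<^sub>5 P" unfolding e using t pd by simp
  have "D - D\<^sup>2 / 2 \<le> 1 / 2" using zero_le_power2[of "D - 1"] by (simp add: power2_eq_square algebra_simps)
  then have "t * (D - D\<^sup>2 / 2) \<le> 1 * (1 / 2)" using t pd by (intro mult_mono) auto
  then show "\<epsilon>\<^sub>5 P \<le> 1 / 2" unfolding e by simp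
  have "t\<^sup>2 \<le> t" using t by (simp add: power2_eq_square mult_left_le)
  then have "t\<^sup>2 * D\<^sup>2 \<le> t * D\<^sup>2" by (intro mult_right_mono) auto
  then show "(1 - \<omega> P * scale P * \<delta> P)\<^sup>2 \<le> 1 - 2 * \<epsilon>\<^sub>5 P"
    unfolding e t_def[symmetric] D_def[symmetric] by (simp add: power2_eq_square algebra_simps)
qed

text \<open>The last part is the origin of \<open>\<epsilon>\<^sub>8\<close>: Young's inequality
  with weight \<open>\<epsilon>\<^sub>5\<close> multiplies the contraction by
  \<open>1 + \<epsilon>\<^sub>5 P\<close>. Of the margin \<open>2 * \<epsilon>\<^sub>8 P\<close>,
  one half is later spent on the compression part of the movement, the other stays in the recursion
  of s.\<close>

lemma eps8: "0 < \<epsilon>\<^sub>8 P" "\<epsilon>\<^sub>8 P \<le> 1 / 2" "(1 + \<epsilon>\<^sub>5 P) * (1 - 2 * \<epsilon>\<^sub>5 P) = 1 - 2 * \<epsilon>\<^sub>8 P"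
proof -
  show "0 < \<epsilon>\<^sub>8 P" unfolding \<epsilon>\<^sub>8_def using eps5(1) by (simp add: add_pos_nonneg)
  have "(\<epsilon>\<^sub>5 P)\<^sup>2 \<le> (1 / 2)\<^sup>2" using eps5 by (intro power_mono) auto
  then have "2 * (\<epsilon>\<^sub>5 P)\<^sup>2 \<le> 1 / 2" by (simp add: power2_eq_square)
  then show "\<epsilon>\<^sub>8 P \<le> 1 / 2" unfolding \<epsilon>\<^sub>8_def using eps5 by simp
  show "(1 + \<epsilon>\<^sub>5 P) * (1 - 2 * \<epsilon>\<^sub>5 P) = 1 - 2 * \<epsilon>\<^sub>8 P"
    unfolding \<epsilon>\<^sub>8_def by (simp add: power2_eq_square algebra_simps)
qed

lemma eps1: "0 < \<epsilon>\<^sub>1 P" "\<epsilon>\<^sub>1 P < 1 / 2"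
  unfolding \<epsilon>\<^sub>1_def using tau_rho2 tau_pos rho2_pos by (auto simp: field_simps)

lemma psi3_pos: "\<psi>\<^sub>3 P > 0"
  unfolding \<psi>\<^sub>3_def using eps5(1) dh_pos beta_pos rho_pos by (simp add: add_pos_pos)

lemma psi4_pos: "\<psi>\<^sub>4 P > 0"
proof -
  have "max ((\<beta> P)\<^sup>2 * (\<rho> P)\<^sup>2 + (lip P)\<^sup>2) ((\<gamma> P)\<^sup>2 * \<rho> P) > 0"
    using gamma_pos rho_pos by (simp add: less_max_iff_disj)
  then show ?thesis unfolding \<psi>\<^sub>4_def using eps5(1) eps1(1) dh_pos by (simp add: add_pos_pos)
qed

text \<open>The modes with positive eigenvalue obey \<open>mode_lyap_descent\<close>; mode 0 changes
  only through the gradient drift D, and the decrease of the gap F pays for it. The bounds on h and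
  D concern all modes together, so mode 0 is carried along until both sums are complete.\<close>

lemma network_descent:
  fixes \<xi> w e h D \<xi>' w' :: "nat \<Rightarrow> nat \<Rightarrow> real" and lam :: "nat \<Rightarrow> real" and gb gb0 :: "nat \<Rightarrow> real"
  assumes n: "n > 0" and \<alpha>: "\<alpha> > 0"
    and lam: "\<And>m. m \<in> {1..<n} \<Longrightarrow> \<rho>\<^sub>2 P \<le> lam (m + 1) \<and> lam (m + 1) \<le> \<rho> P"
    and lam0: "\<rho>\<^sub>2 P \<le> lam (n + 1)"
    and a: "a = (\<beta> P + \<gamma> P) / \<gamma> P"
    and \<xi>': "\<And>m c. m \<in> {1..<n} \<Longrightarrow> c < d \<Longrightarrow>
      \<xi>' m c = \<xi> m c - \<alpha> * (\<beta> P * lam (m + 1) * (\<xi> m c - e m c) + \<gamma> P * w m c + h m c)"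
    and w': "\<And>m c. m \<in> {1..<n} \<Longrightarrow> c < d \<Longrightarrow>
      w' m c = w m c + \<alpha> * \<gamma> P * lam (m + 1) * (\<xi> m c - e m c) + D m c / \<gamma> P"
    and w'0: "\<And>c. c < d \<Longrightarrow> w' 0 c = w 0 c + D 0 c / \<gamma> P"
    and w0: "\<And>c. c < d \<Longrightarrow> w 0 c = gb0 c / \<gamma> P" and h0: "\<And>c. c < d \<Longrightarrow> h 0 c = gb c - gb0 c"
    and hb: "(\<Sum>c<d. \<Sum>m<n. (h m c)\<^sup>2) \<le> (lip P)\<^sup>2 * (\<Sum>c<d. \<Sum>m\<in>{1..<n}. (\<xi> m c)\<^sup>2)"
    and Db: "(\<Sum>c<d. \<Sum>m<n. (D m c)\<^sup>2) \<le> (lip P)\<^sup>2 * \<alpha>\<^sup>2 * (\<Sum>c<d. (gb c)\<^sup>2)"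
    and Fb: "F' \<le> F - \<alpha> * (\<Sum>c<d. gb0 c * gb c) + lip P / 2 * \<alpha>\<^sup>2 * (\<Sum>c<d. (gb c)\<^sup>2)"
  shows "(\<Sum>c<d. (\<Sum>m\<in>{1..<n}. mode_lyap a (lam (m + 1)) (\<xi>' m c) (w' m c))
        + a / (2 * lam (n + 1)) * (w' 0 c)\<^sup>2) + F'
    \<le> (\<Sum>c<d. (\<Sum>m\<in>{1..<n}. mode_lyap a (lam (m + 1)) (\<xi> m c) (w m c))
        + a / (2 * lam (n + 1)) * (w 0 c)\<^sup>2) + F
      - \<alpha> * (\<phi>\<^sub>1 P - \<alpha> * \<phi>\<^sub>2 P) * (\<Sum>c<d. \<Sum>m\<in>{1..<n}. (\<xi> m c)\<^sup>2)
      - \<alpha> * (\<phi>\<^sub>3 P - \<alpha> * \<phi>\<^sub>4 P) * (\<Sum>c<d. \<Sum>m\<in>{1..<n}. (w m c)\<^sup>2 / lam (m + 1))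
      - \<alpha> * (\<phi>\<^sub>5 P - \<alpha> * \<phi>\<^sub>6 P) * (\<Sum>c<d. (gb c)\<^sup>2)
      - \<alpha> / 4 * (\<Sum>c<d. (gb0 c)\<^sup>2)
      + \<alpha> * \<psi>\<^sub>2 P \<alpha> * (\<Sum>c<d. \<Sum>m\<in>{1..<n}. (e m c)\<^sup>2)"
proof -
  define lo where "lo = \<rho>\<^sub>2 P"
  define hi where "hi = \<rho> P"
  define b where "b = \<beta> P"
  define g where "g = \<gamma> P"
  define l where "l = lip P"
  define cx where "cx = \<alpha> * (1 - (b * lo - g) / 2) + \<alpha>\<^sup>2 * (3 * hi\<^sup>2 * b\<^sup>2 - lo * b * g + (hi + 2) * g\<^sup>2 + 1)"
  define cw where "cw = \<alpha> * (1 / (2 * lo) - g / 2) + \<alpha>\<^sup>2 * (2 * hi * g\<^sup>2 + hi / 2)"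
  define ce where "ce = \<alpha> * (b * hi / 2 + hi * g)
        + \<alpha>\<^sup>2 * (3 * hi\<^sup>2 * b\<^sup>2 + (hi - 2 * lo) * b * g + (hi + 2) * g\<^sup>2 + 1)"
  define ch where "ch = \<alpha> + 2 * \<alpha>\<^sup>2"
  define cd where "cd = a\<^sup>2 / (g^3 * lo) / \<alpha> + 1 / (2 * g\<^sup>2 * lo\<^sup>2) / \<alpha>
        + (a / (2 * g\<^sup>2 * lo) + 1 / (2 * g\<^sup>2 * lo\<^sup>2) + 1 / (2 * lo\<^sup>2) + 1 / 2)"
  have pos: "lo > 0" "g > 0" "b > 0" "a > 0" "hi > 0" unfolding lo_def g_def b_def hi_def a
    using rho2_pos gamma_pos beta_pos rho_pos by auto
  have big: "4 * g \<le> b * lo" unfolding g_def b_def lo_def using four_gamma_le .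
  define S where "S f = (\<Sum>c<d. \<Sum>m\<in>{1..<n}. f m c)" for f :: "nat \<Rightarrow> nat \<Rightarrow> real"
  have S_add: "S (\<lambda>m c. p m c + q m c) = S p + S q" for p q unfolding S_def by (simp add: sum.distrib)
  have S_mult: "S (\<lambda>m c. k * p m c) = k * S p" for k p unfolding S_def by (simp add: sum_distrib_left)
  have S_pos: "S (\<lambda>m c. (p m c)\<^sup>2) \<ge> 0" for p unfolding S_def by (intro sum_nonneg) auto
  define X where "X = S (\<lambda>m c. (\<xi> m c)\<^sup>2)"
  define W where "W = S (\<lambda>m c. (w m c)\<^sup>2 / lam (m + 1))"
  define Er where "Er = S (\<lambda>m c. (e m c)\<^sup>2)"
  define H where "H = S (\<lambda>m c. (h m c)\<^sup>2)"
  define Dd where "Dd = S (\<lambda>m c. (D m c)\<^sup>2)"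
  define H0 where "H0 = (\<Sum>c<d. (h 0 c)\<^sup>2)"
  define D0 where "D0 = (\<Sum>c<d. (D 0 c)\<^sup>2)"
  define Gb where "Gb = (\<Sum>c<d. (gb c)\<^sup>2)"
  define G0 where "G0 = (\<Sum>c<d. (gb0 c)\<^sup>2)"
  have nn: "X \<ge> 0" "Er \<ge> 0" "H \<ge> 0" "Dd \<ge> 0" "H0 \<ge> 0" "D0 \<ge> 0" "Gb \<ge> 0" "G0 \<ge> 0"
    unfolding X_def Er_def H_def Dd_def H0_def D0_def Gb_def G0_def by (auto intro!: sum_nonneg simp: S_pos)
  have Wn: "W \<ge> 0" unfolding W_def S_def using lam rho2_pos
    by (intro sum_nonneg divide_nonneg_nonneg) (auto, meson atLeastLessThan_iff less_imp_le order_trans)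
  have split: "(\<Sum>c<d. \<Sum>m<n. (p m c)\<^sup>2) = (\<Sum>c<d. (p 0 c)\<^sup>2) + S (\<lambda>m c. (p m c)\<^sup>2)" for p :: "nat \<Rightarrow> nat \<Rightarrow> real"
    unfolding S_def by (simp add: sum_lessThan_head[OF n] sum.distrib)
  have hb': "H0 + H \<le> l\<^sup>2 * X" using hb unfolding split H0_def H_def X_def l_def S_def .
  have Db': "D0 + Dd \<le> l\<^sup>2 * \<alpha>\<^sup>2 * Gb" using Db unfolding split D0_def Dd_def Gb_def l_def .

  have mode: "mode_lyap a (lam (m + 1)) (\<xi>' m c) (w' m c) \<le> mode_lyap a (lam (m + 1)) (\<xi> m c) (w m c)
      + (cx * (\<xi> m c)\<^sup>2 + (cw * ((w m c)\<^sup>2 / lam (m + 1)) + (ce * (e m c)\<^sup>2 + (ch * (h m c)\<^sup>2 + cd * (D m c)\<^sup>2))))"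
    if m: "m \<in> {1..<n}" and c: "c < d" for m c
    using mode_lyap_descent[OF \<alpha> pos(2) pos(3) pos(1) _ _ big, of "lam (m + 1)" hi a "\<xi> m c" "e m c" "w m c"
        "h m c" "D m c"] lam[OF m]
    unfolding \<xi>'[OF m c] w'[OF m c] cx_def cw_def ce_def ch_def cd_def a lo_def hi_def g_def b_def by simp
  have modes: "S (\<lambda>m c. mode_lyap a (lam (m + 1)) (\<xi>' m c) (w' m c))
      \<le> S (\<lambda>m c. mode_lyap a (lam (m + 1)) (\<xi> m c) (w m c)) + cx * X + cw * W + ce * Er + ch * H + cd * Dd"
  proof -
    have "S (\<lambda>m c. mode_lyap a (lam (m + 1)) (\<xi>' m c) (w' m c)) \<le> S (\<lambda>m c. mode_lyap a (lam (m + 1)) (\<xi> m c) (w m c)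
      + (cx * (\<xi> m c)\<^sup>2 + (cw * ((w m c)\<^sup>2 / lam (m + 1)) + (ce * (e m c)\<^sup>2 + (ch * (h m c)\<^sup>2 + cd * (D m c)\<^sup>2)))))"
      unfolding S_def using mode by (intro sum_mono) auto
    then show ?thesis unfolding S_add S_mult X_def W_def Er_def H_def Dd_def by simp
  qed

  define z where "z = a / (2 * lam (n + 1))"
  have l0: "lam (n + 1) \<ge> lo" using lam0 unfolding lo_def .
  then have l0p: "lam (n + 1) > 0" using pos by simp
  have inv0: "1 / lam (n + 1) \<le> 1 / lo" using l0 pos by (simp add: frac_le)
  \<comment> \<open>The increase costs \<alpha> / 4 of the squared mean gradient gb0, since w 0 is
    gb0 divided by \<gamma> and \<gamma> * \<mu> >= 1.\<close>
  have mode0: "z * (w' 0 c)\<^sup>2 \<le> z * (w 0 c)\<^sup>2 + \<alpha> / 4 * (gb0 c)\<^sup>2 + cd * (D 0 c)\<^sup>2" if c: "c < d" for c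
  proof -
    define \<mu> where "\<mu> = lam (n + 1)"
    have \<mu>: "\<mu> > 0" "lo \<le> \<mu>" unfolding \<mu>_def using l0p l0 by auto
    have y: "a / (g * \<mu>) * w 0 c * D 0 c \<le> \<alpha> * g / (4 * \<mu>) * (w 0 c)\<^sup>2 + a\<^sup>2 / (g^3 * \<mu>) / \<alpha> * (D 0 c)\<^sup>2"
      using \<alpha> pos \<mu> by (intro young) (auto simp: power2_eq_square power3_eq_cube field_simps)
    have "z * (w' 0 c)\<^sup>2 = z * (w 0 c)\<^sup>2 + a / (g * \<mu>) * w 0 c * D 0 c + a / (2 * g\<^sup>2 * \<mu>) * (D 0 c)\<^sup>2"
      unfolding w'0[OF c] z_def g_def[symmetric] \<mu>_def[symmetric] using pos \<mu> by (simp add: field_simps power2_eq_square)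
    moreover have "\<alpha> * g / (4 * \<mu>) * (w 0 c)\<^sup>2 \<le> \<alpha> / 4 * (gb0 c)\<^sup>2"
    proof -
      have "g * \<mu> \<ge> g * lo" using \<mu> pos by (intro mult_left_mono) auto
      then have gm: "g * \<mu> \<ge> 1" using gamma_rho2 unfolding g_def lo_def by simp
      have "\<alpha> * g / (4 * \<mu>) * (w 0 c)\<^sup>2 = \<alpha> / 4 * ((gb0 c)\<^sup>2 / (g * \<mu>))"
        unfolding w0[OF c] g_def[symmetric] using pos \<mu> by (simp add: field_simps power2_eq_square)
      also have "(gb0 c)\<^sup>2 / (g * \<mu>) \<le> (gb0 c)\<^sup>2 / 1" using gm by (intro frac_le) auto
      finally show ?thesis using \<alpha> by simp
    qed
    moreover have "(a\<^sup>2 / (g^3 * \<mu>) / \<alpha> + a / (2 * g\<^sup>2 * \<mu>)) * (D 0 c)\<^sup>2 \<le> cd * (D 0 c)\<^sup>2"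
    proof (intro mult_right_mono)
      have "a\<^sup>2 / (g^3 * \<mu>) / \<alpha> \<le> a\<^sup>2 / (g^3 * lo) / \<alpha>"
        using pos \<mu> \<alpha> by (intro divide_right_mono frac_le mult_left_mono) auto
      moreover have "a / (2 * g\<^sup>2 * \<mu>) \<le> a / (2 * g\<^sup>2 * lo)"
        using pos \<mu> \<alpha> by (intro frac_le mult_left_mono) auto
      moreover have "1 / (2 * g\<^sup>2 * lo\<^sup>2) / \<alpha> \<ge> 0" "1 / (2 * g\<^sup>2 * lo\<^sup>2) \<ge> 0" "1 / (2 * lo\<^sup>2) \<ge> 0"
        using \<alpha> by auto
      ultimately show "a\<^sup>2 / (g^3 * \<mu>) / \<alpha> + a / (2 * g\<^sup>2 * \<mu>) \<le> cd" unfolding cd_def by linarith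
    qed auto
    ultimately show ?thesis using y by (simp only: distrib_right)
  qed
  have modes0: "(\<Sum>c<d. z * (w' 0 c)\<^sup>2) \<le> (\<Sum>c<d. z * (w 0 c)\<^sup>2) + \<alpha> / 4 * G0 + cd * D0"
  proof -
    have "(\<Sum>c<d. z * (w' 0 c)\<^sup>2) \<le> (\<Sum>c<d. z * (w 0 c)\<^sup>2 + \<alpha> / 4 * (gb0 c)\<^sup>2 + cd * (D 0 c)\<^sup>2)"
      by (intro sum_mono mode0) simp
    then show ?thesis unfolding G0_def D0_def by (simp only: sum.distrib sum_distrib_left)
  qed

  \<comment> \<open>By polarization the inner product of gb0 and gb is half of Gb + G0 - H0. The gap
    thus yields \<alpha> / 2 of G0: one half compensates mode 0, the other remains in the
    conclusion.\<close>
  have F: "F' \<le> F - \<alpha> / 2 * G0 - \<alpha> / 2 * Gb + \<alpha> / 2 * H0 + l / 2 * \<alpha>\<^sup>2 * Gb"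
  proof -
    have "H0 = (\<Sum>c<d. (gb c - gb0 c)\<^sup>2)" unfolding H0_def by (simp add: h0)
    also have "\<dots> = Gb + G0 - 2 * (\<Sum>c<d. gb0 c * gb c)"
      unfolding Gb_def G0_def
      by (simp add: power2_diff sum.distrib sum_subtractf sum_distrib_left algebra_simps)
    finally have e: "(\<Sum>c<d. gb0 c * gb c) = (Gb + G0 - H0) / 2" by simp
    have "\<alpha> * (\<Sum>c<d. gb0 c * gb c) = \<alpha> / 2 * Gb + \<alpha> / 2 * G0 - \<alpha> / 2 * H0"
      unfolding e by (simp add: field_simps)
    then show ?thesis using Fb unfolding Gb_def[symmetric] l_def[symmetric] by linarith
  qed

  have chn: "ch \<ge> 0" unfolding ch_def using \<alpha> by simp
  have cdn: "cd \<ge> 0" unfolding cd_def using \<alpha> pos by simp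
  have tH: "ch * H + \<alpha> / 2 * H0 \<le> ch * l\<^sup>2 * X"
  proof -
    have "\<alpha> / 2 * H0 \<le> ch * H0" using nn \<alpha> unfolding ch_def by (intro mult_right_mono) auto
    moreover have "ch * (H0 + H) \<le> ch * (l\<^sup>2 * X)" using hb' chn by (intro mult_left_mono) auto
    ultimately show ?thesis by (simp add: algebra_simps)
  qed
  have tD: "cd * D0 + cd * Dd \<le> cd * (l\<^sup>2 * \<alpha>\<^sup>2) * Gb"
    using mult_left_mono[OF Db' cdn] by (simp add: algebra_simps)
  \<comment> \<open>Here and in the next three estimates the coefficient obtained is compared with
    the one in terms of the named constants; it is better by a nonnegative slack.\<close>
  have kx: "(cx + ch * l\<^sup>2) * X \<le> - (\<alpha> * (\<phi>\<^sub>1 P - \<alpha> * \<phi>\<^sub>2 P)) * X"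
  proof (intro mult_right_mono)
    have "- (\<alpha> * (\<phi>\<^sub>1 P - \<alpha> * \<phi>\<^sub>2 P)) - (cx + ch * l\<^sup>2) = \<alpha> * g + \<alpha>\<^sup>2 * (l\<^sup>2 / 2)"
      unfolding cx_def ch_def \<phi>\<^sub>1_def \<phi>\<^sub>2_def lo_def hi_def b_def g_def l_def
      by (simp add: field_simps power2_eq_square)
    moreover have "\<alpha> * g + \<alpha>\<^sup>2 * (l\<^sup>2 / 2) \<ge> 0" using \<alpha> pos by simp
    ultimately show "cx + ch * l\<^sup>2 \<le> - (\<alpha> * (\<phi>\<^sub>1 P - \<alpha> * \<phi>\<^sub>2 P))" by linarith
  qed (use nn in auto)
  have kw: "cw * W \<le> - (\<alpha> * (\<phi>\<^sub>3 P - \<alpha> * \<phi>\<^sub>4 P)) * W"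
  proof (intro mult_right_mono)
    have "- (\<alpha> * (\<phi>\<^sub>3 P - \<alpha> * \<phi>\<^sub>4 P)) - cw = \<alpha> * (2 / lo)"
      unfolding cw_def \<phi>\<^sub>3_def \<phi>\<^sub>4_def lo_def hi_def g_def using rho2_pos
      by (simp add: field_simps power2_eq_square)
    moreover have "\<alpha> * (2 / lo) \<ge> 0" using \<alpha> pos by simp
    ultimately show "cw \<le> - (\<alpha> * (\<phi>\<^sub>3 P - \<alpha> * \<phi>\<^sub>4 P))" by linarith
  qed (use Wn in auto)
  have ke: "ce * Er \<le> \<alpha> * \<psi>\<^sub>2 P \<alpha> * Er"
  proof (intro mult_right_mono)
    have "\<alpha> * \<psi>\<^sub>2 P \<alpha> - ce = \<alpha> * g"
      unfolding ce_def \<psi>\<^sub>2_def \<phi>\<^sub>7_def \<phi>\<^sub>8_def lo_def hi_def g_def b_def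
      by (simp add: field_simps power2_eq_square)
    moreover have "\<alpha> * g \<ge> 0" using \<alpha> pos by simp
    ultimately show "ce \<le> \<alpha> * \<psi>\<^sub>2 P \<alpha>" by linarith
  qed (use nn in auto)
  have kg: "(cd * (l\<^sup>2 * \<alpha>\<^sup>2) - \<alpha> / 2 + l / 2 * \<alpha>\<^sup>2) * Gb \<le> - (\<alpha> * (\<phi>\<^sub>5 P - \<alpha> * \<phi>\<^sub>6 P)) * Gb"
  proof (intro mult_right_mono)
    have a2: "a\<^sup>2 / (g^3 * lo) = (b + g)\<^sup>2 / g^5 * (1 / lo)"
      unfolding a b_def[symmetric] g_def[symmetric] using pos
      by (simp add: field_simps power2_eq_square power3_eq_cube numeral_eq_Suc)
    have a1: "a / (2 * g\<^sup>2 * lo) = (b + g) / (2 * g^3) * (1 / lo)"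
      unfolding a b_def[symmetric] g_def[symmetric] using pos
      by (simp add: field_simps power2_eq_square power3_eq_cube)
    have "cd * (l\<^sup>2 * \<alpha>\<^sup>2) = \<alpha> * ((a\<^sup>2 / (g^3 * lo) + 1 / (2 * g\<^sup>2 * lo\<^sup>2)) * l\<^sup>2)
        + \<alpha>\<^sup>2 * ((a / (2 * g\<^sup>2 * lo) + 1 / (2 * g\<^sup>2 * lo\<^sup>2) + 1 / (2 * lo\<^sup>2) + 1 / 2) * l\<^sup>2)"
    proof -
      have r: "(p / \<alpha> + q / \<alpha> + t) * (l\<^sup>2 * \<alpha>\<^sup>2) = \<alpha> * ((p + q) * l\<^sup>2) + \<alpha>\<^sup>2 * (t * l\<^sup>2)" for p q t
        using \<alpha> by (simp add: field_simps power2_eq_square)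
      show ?thesis unfolding cd_def by (rule r)
    qed
    also have "\<dots> = \<alpha> * (1 / 8 - \<phi>\<^sub>5 P) + \<alpha>\<^sup>2 * (\<phi>\<^sub>6 P - l / 2)"
      unfolding a1 a2 unfolding \<phi>\<^sub>5_def \<phi>\<^sub>6_def lo_def b_def g_def l_def
      by (simp add: algebra_simps)
    finally show "cd * (l\<^sup>2 * \<alpha>\<^sup>2) - \<alpha> / 2 + l / 2 * \<alpha>\<^sup>2 \<le> - (\<alpha> * (\<phi>\<^sub>5 P - \<alpha> * \<phi>\<^sub>6 P))"
      using \<alpha> by (simp add: algebra_simps power2_eq_square)
  qed (use nn in auto)
  have sp: "(\<Sum>c<d. (\<Sum>m\<in>{1..<n}. mode_lyap a (lam (m + 1)) (p m c) (r m c)) + z * (r 0 c)\<^sup>2)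
      = S (\<lambda>m c. mode_lyap a (lam (m + 1)) (p m c) (r m c)) + (\<Sum>c<d. z * (r 0 c)\<^sup>2)" for p r
    unfolding S_def by (simp add: sum.distrib)
  have q: "\<alpha> / 2 * G0 = \<alpha> / 4 * G0 + \<alpha> / 4 * G0" by (simp add: field_simps)
  note bounds = kx[unfolded distrib_right mult_minus_left] kw[unfolded mult_minus_left] ke
    kg[unfolded distrib_right left_diff_distrib[of _ _ Gb] mult_minus_left]
  show ?thesis
    unfolding z_def[symmetric] sp
    using modes modes0 F tH tD bounds q
    unfolding X_def[symmetric, unfolded S_def] W_def[symmetric, unfolded S_def] Er_def[symmetric, unfolded S_def]
      Gb_def[symmetric] G0_def[symmetric]
    by linarith
qed

text \<open>A step in one mode is a sum of four terms, hence the factor 4 that reappears in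
  \<open>\<psi>\<^sub>3\<close> and \<open>\<psi>\<^sub>4\<close>. Mode 0 has no Laplacian part, and
  its w is measured with \<open>lam (n + 1)\<close>, which lies in the range of the positive
  eigenvalues.\<close>

lemma network_movement:
  fixes \<xi> w e h \<xi>' :: "nat \<Rightarrow> nat \<Rightarrow> real" and lam :: "nat \<Rightarrow> real"
  assumes n: "n > 0"
    and lam: "\<And>m. m \<in> {1..<n} \<Longrightarrow> \<rho>\<^sub>2 P \<le> lam (m + 1) \<and> lam (m + 1) \<le> \<rho> P"
    and lam0: "\<rho>\<^sub>2 P \<le> lam (n + 1)" "lam (n + 1) \<le> \<rho> P"
    and \<xi>': "\<And>m c. m \<in> {1..<n} \<Longrightarrow> c < d \<Longrightarrow>
      \<xi>' m c = \<xi> m c - \<alpha> * (\<beta> P * lam (m + 1) * (\<xi> m c - e m c) + \<gamma> P * w m c + h m c)"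
    and \<xi>'0: "\<And>c. c < d \<Longrightarrow> \<xi>' 0 c = \<xi> 0 c - \<alpha> * (\<gamma> P * w 0 c + h 0 c)"
    and hb: "(\<Sum>c<d. \<Sum>m<n. (h m c)\<^sup>2) \<le> (lip P)\<^sup>2 * (\<Sum>c<d. \<Sum>m\<in>{1..<n}. (\<xi> m c)\<^sup>2)"
  shows "(\<Sum>c<d. \<Sum>m<n. (\<xi>' m c - \<xi> m c)\<^sup>2) \<le> 4 * \<alpha>\<^sup>2 *
    ((\<beta> P)\<^sup>2 * (\<rho> P)\<^sup>2 * (\<Sum>c<d. \<Sum>m\<in>{1..<n}. (e m c)\<^sup>2)
     + max ((\<beta> P)\<^sup>2 * (\<rho> P)\<^sup>2 + (lip P)\<^sup>2) ((\<gamma> P)\<^sup>2 * \<rho> P)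
       * ((\<Sum>c<d. \<Sum>m\<in>{1..<n}. (\<xi> m c)\<^sup>2)
         + (\<Sum>c<d. (\<Sum>m\<in>{1..<n}. (w m c)\<^sup>2 / lam (m + 1)) + (w 0 c)\<^sup>2 / lam (n + 1))))"
proof -
  define B where "B = (\<beta> P)\<^sup>2 * (\<rho> P)\<^sup>2"
  define M where "M = max (B + (lip P)\<^sup>2) ((\<gamma> P)\<^sup>2 * \<rho> P)"
  have sq4: "(p + q + r + t)\<^sup>2 \<le> 4 * (p\<^sup>2 + q\<^sup>2 + r\<^sup>2 + t\<^sup>2)" for p q r t :: real
    using zero_le_power2[of "p - q"] zero_le_power2[of "p - r"] zero_le_power2[of "p - t"]
      zero_le_power2[of "q - r"] zero_le_power2[of "q - t"] zero_le_power2[of "r - t"]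
    by (simp add: power2_eq_square algebra_simps)
  have gw: "(\<gamma> P * u)\<^sup>2 \<le> M * (u\<^sup>2 / \<mu>)" if "\<rho>\<^sub>2 P \<le> \<mu>" "\<mu> \<le> \<rho> P" for u \<mu>
  proof -
    have \<mu>: "\<mu> > 0" using that rho2_pos by simp
    have "(\<gamma> P * u)\<^sup>2 = (\<gamma> P)\<^sup>2 * \<mu> * (u\<^sup>2 / \<mu>)" using \<mu> by (simp add: power_mult_distrib)
    also have "\<dots> \<le> M * (u\<^sup>2 / \<mu>)"
      using that \<mu> unfolding M_def by (intro mult_right_mono max.coboundedI2 mult_left_mono) auto
    finally show ?thesis .
  qed
  have bl: "(\<beta> P * \<mu> * u)\<^sup>2 \<le> B * u\<^sup>2" if "\<rho>\<^sub>2 P \<le> \<mu>" "\<mu> \<le> \<rho> P" for u \<mu>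
  proof -
    have "\<mu>\<^sup>2 \<le> (\<rho> P)\<^sup>2" using that rho2_pos by (intro power_mono) auto
    then show ?thesis unfolding B_def by (simp add: power_mult_distrib mult_right_mono mult_left_mono)
  qed
  have m1: "(\<xi>' m c - \<xi> m c)\<^sup>2 \<le> 4 * \<alpha>\<^sup>2 * (B * (e m c)\<^sup>2 + B * (\<xi> m c)\<^sup>2
      + M * ((w m c)\<^sup>2 / lam (m + 1)) + (h m c)\<^sup>2)" if m: "m \<in> {1..<n}" and c: "c < d" for m c
  proof -
    define \<mu> where "\<mu> = lam (m + 1)"
    have \<mu>: "\<rho>\<^sub>2 P \<le> \<mu>" "\<mu> \<le> \<rho> P" using lam[OF m] unfolding \<mu>_def by auto
    have "(\<xi>' m c - \<xi> m c)\<^sup>2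
        = \<alpha>\<^sup>2 * (\<beta> P * \<mu> * (- e m c) + \<beta> P * \<mu> * \<xi> m c + \<gamma> P * w m c + h m c)\<^sup>2"
      unfolding \<xi>'[OF m c] \<mu>_def[symmetric] by (simp add: power_mult_distrib[symmetric]) (simp add: algebra_simps)
    also have "\<dots> \<le> \<alpha>\<^sup>2 * (4 * ((\<beta> P * \<mu> * (- e m c))\<^sup>2 + (\<beta> P * \<mu> * \<xi> m c)\<^sup>2 + (\<gamma> P * w m c)\<^sup>2 + (h m c)\<^sup>2))"
      by (intro mult_left_mono sq4) auto
    also have "\<dots> \<le> \<alpha>\<^sup>2 * (4 * (B * (- e m c)\<^sup>2 + B * (\<xi> m c)\<^sup>2 + M * ((w m c)\<^sup>2 / \<mu>) + (h m c)\<^sup>2))"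
      using bl[OF \<mu>] gw[OF \<mu>] by (intro mult_left_mono add_mono) auto
    finally show ?thesis unfolding \<mu>_def by (simp add: algebra_simps)
  qed
  have m0: "(\<xi>' 0 c - \<xi> 0 c)\<^sup>2 \<le> 4 * \<alpha>\<^sup>2 * (M * ((w 0 c)\<^sup>2 / lam (n + 1)) + (h 0 c)\<^sup>2)" if c: "c < d" for c
  proof -
    have "(\<xi>' 0 c - \<xi> 0 c)\<^sup>2 = \<alpha>\<^sup>2 * (0 + 0 + \<gamma> P * w 0 c + h 0 c)\<^sup>2"
      unfolding \<xi>'0[OF c] by (simp add: power_mult_distrib[symmetric])
    also have "\<dots> \<le> \<alpha>\<^sup>2 * (4 * (0\<^sup>2 + 0\<^sup>2 + (\<gamma> P * w 0 c)\<^sup>2 + (h 0 c)\<^sup>2))"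
      by (intro mult_left_mono sq4) auto
    also have "\<dots> \<le> \<alpha>\<^sup>2 * (4 * (M * ((w 0 c)\<^sup>2 / lam (n + 1)) + (h 0 c)\<^sup>2))"
      using gw[OF lam0] by (intro mult_left_mono) auto
    finally show ?thesis by (simp add: algebra_simps)
  qed
  define X where "X = (\<Sum>c<d. \<Sum>m\<in>{1..<n}. (\<xi> m c)\<^sup>2)"
  define Er where "Er = (\<Sum>c<d. \<Sum>m\<in>{1..<n}. (e m c)\<^sup>2)"
  define W where "W = (\<Sum>c<d. (\<Sum>m\<in>{1..<n}. (w m c)\<^sup>2 / lam (m + 1)) + (w 0 c)\<^sup>2 / lam (n + 1))"
  define H where "H = (\<Sum>c<d. \<Sum>m<n. (h m c)\<^sup>2)"
  have X0: "X \<ge> 0" unfolding X_def by (intro sum_nonneg) auto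
  have "(\<Sum>c<d. \<Sum>m<n. (\<xi>' m c - \<xi> m c)\<^sup>2)
      \<le> (\<Sum>c<d. 4 * \<alpha>\<^sup>2 * (M * ((w 0 c)\<^sup>2 / lam (n + 1)) + (h 0 c)\<^sup>2) +
          (\<Sum>m\<in>{1..<n}. 4 * \<alpha>\<^sup>2 * (B * (e m c)\<^sup>2 + B * (\<xi> m c)\<^sup>2 + M * ((w m c)\<^sup>2 / lam (m + 1)) + (h m c)\<^sup>2)))"
    unfolding sum_lessThan_head[OF n] using m0 m1 by (intro sum_mono add_mono) auto
  also have "\<dots> = 4 * \<alpha>\<^sup>2 * (B * Er + B * X + M * W + H)"
    unfolding X_def Er_def W_def H_def sum_lessThan_head[OF n]
    by (simp add: sum.distrib sum_distrib_left algebra_simps)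
  also have "\<dots> \<le> 4 * \<alpha>\<^sup>2 * (B * Er + M * (X + W))"
  proof (intro mult_left_mono)
    \<comment> \<open>The gradient differences h are charged to the consensus error; this is the
      origin of lip^2 in the maximum.\<close>
    have "B * X + H \<le> (B + (lip P)\<^sup>2) * X" using hb unfolding X_def H_def by (simp add: algebra_simps)
    also have "\<dots> \<le> M * X" unfolding M_def using X0 by (intro mult_right_mono) auto
    finally show "B * Er + B * X + M * W + H \<le> B * Er + M * (X + W)" by (simp add: algebra_simps)
  qed auto
  finally show ?thesis unfolding X_def Er_def W_def M_def B_def .
qed

text \<open>The quotient in \<open>mode_lyap\<close> is \<open>1 + \<tau>\<^sub>1 P\<close>, so the
  bound for a single mode applies; mode 0 has no cross term, and its coefficient exceeds 1 / 2 and
  thus \<open>\<epsilon>\<^sub>1\<close>.\<close>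

lemma network_lyap_lower_bound:
  fixes \<xi> w :: "nat \<Rightarrow> nat \<Rightarrow> real" and lam :: "nat \<Rightarrow> real"
  assumes lam: "\<And>m. m \<in> {1..<n} \<Longrightarrow> \<rho>\<^sub>2 P \<le> lam (m + 1)" and lam0: "\<rho>\<^sub>2 P \<le> lam (n + 1)"
  shows "\<epsilon>\<^sub>1 P * ((\<Sum>c<d. \<Sum>m\<in>{1..<n}. (\<xi> m c)\<^sup>2)
      + (\<Sum>c<d. (\<Sum>m\<in>{1..<n}. (w m c)\<^sup>2 / lam (m + 1)) + (w 0 c)\<^sup>2 / lam (n + 1)))
    \<le> (\<Sum>c<d. (\<Sum>m\<in>{1..<n}. mode_lyap ((\<beta> P + \<gamma> P) / \<gamma> P) (lam (m + 1)) (\<xi> m c) (w m c))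
        + ((\<beta> P + \<gamma> P) / \<gamma> P) / (2 * lam (n + 1)) * (w 0 c)\<^sup>2)"
proof -
  have a: "(\<beta> P + \<gamma> P) / \<gamma> P = 1 + \<tau>\<^sub>1 P" unfolding beta_eq using gamma_pos by (simp add: field_simps)
  have m1: "\<epsilon>\<^sub>1 P * ((\<xi> m c)\<^sup>2 + (w m c)\<^sup>2 / lam (m + 1)) \<le> mode_lyap (1 + \<tau>\<^sub>1 P) (lam (m + 1)) (\<xi> m c) (w m c)"
    if "m \<in> {1..<n}" for m c
    unfolding \<epsilon>\<^sub>1_def using mode_lyap_lower_bound[OF rho2_pos lam[OF that] tau_pos] .
  have m0: "\<epsilon>\<^sub>1 P * ((w 0 c)\<^sup>2 / lam (n + 1)) \<le> (1 + \<tau>\<^sub>1 P) / (2 * lam (n + 1)) * (w 0 c)\<^sup>2" for c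
  proof -
    have l: "lam (n + 1) > 0" using lam0 rho2_pos by simp
    have "\<epsilon>\<^sub>1 P * ((w 0 c)\<^sup>2 / lam (n + 1)) \<le> (1 + \<tau>\<^sub>1 P) / 2 * ((w 0 c)\<^sup>2 / lam (n + 1))"
      using eps1 tau_pos l by (intro mult_right_mono) auto
    then show ?thesis by simp
  qed
  have "(\<Sum>c<d. (\<Sum>m\<in>{1..<n}. \<epsilon>\<^sub>1 P * ((\<xi> m c)\<^sup>2 + (w m c)\<^sup>2 / lam (m + 1))) + \<epsilon>\<^sub>1 P * ((w 0 c)\<^sup>2 / lam (n + 1)))
    \<le> (\<Sum>c<d. (\<Sum>m\<in>{1..<n}. mode_lyap (1 + \<tau>\<^sub>1 P) (lam (m + 1)) (\<xi> m c) (w m c))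
        + (1 + \<tau>\<^sub>1 P) / (2 * lam (n + 1)) * (w 0 c)\<^sup>2)"
    using m0 m1 by (intro sum_mono add_mono) auto
  then show ?thesis unfolding a by (simp add: sum.distrib sum_distrib_left algebra_simps)
qed

end

section \<open>The algorithm in modal coordinates\<close>

lemma modal_norm:
  assumes "U \<in> carrier_mat n n" "U * transpose_mat U = 1\<^sub>m n"
  shows "(\<Sum>c<d. \<Sum>m<n. (modal n U z m c)\<^sup>2) = (\<Sum>i<n. \<Sum>c<d. (z i c)\<^sup>2)"
proof -
  have "(\<Sum>m<n. (modal n U z m c)\<^sup>2) = (\<Sum>i<n. (z i c)\<^sup>2)" for c
    using modal_parseval[OF assms, of z c z] by (simp add: power2_eq_square)
  then have "(\<Sum>c<d. \<Sum>m<n. (modal n U z m c)\<^sup>2) = (\<Sum>c<d. \<Sum>i<n. (z i c)\<^sup>2)" by simp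
  then show ?thesis by (subst (asm) sum.swap)
qed

text \<open>A run with any step size up to \<open>\<kappa>\<^sub>7\<close> and any positive
  scalings: the one-step estimates involve neither the horizon nor the recursion of s.\<close>

locale compression_run = compression_params P for P :: params +
  fixes n d :: nat and U L :: "real mat" and lam :: "nat \<Rightarrow> real" and f :: "nat \<Rightarrow> real vec \<Rightarrow> real"
    and p :: ereal and \<C> :: "real vec \<Rightarrow> real vec" and s :: "nat \<Rightarrow> real"
    and x v q xh y :: "nat \<Rightarrow> nat \<Rightarrow> real vec" and \<alpha> :: real
  assumes n: "n \<ge> 2" and d: "d > 0" and ed: "laplacian_eigendecomp n L U lam"
    and rho_lam: "\<rho> P = lam n" and rho2_lam: "\<rho>\<^sub>2 P = lam 2"
    and sm: "\<And>i. i < n \<Longrightarrow> smooth d (lip P) (f i)"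
    and bdd: "bdd_below (avg_fun n f ` carrier_vec d)"
    and p: "1 \<le> p" and dh: "dh P = d_hat d p"
    and compressor: "locally_bounded_compressor d p (scale P) (rad P) (\<delta> P) \<C>"
    and run: "unified_compression n d L \<C> f \<alpha> (\<beta> P) (\<gamma> P) (\<omega> P) s x v q xh y"
    and \<alpha>_pos: "\<alpha> > 0" and \<alpha>_le: "\<alpha> \<le> \<kappa>\<^sub>7 P"
    and s_pos: "\<And>k. s k > 0"
begin

lemma run_eqs:
  assumes "i < n"
  shows "x i 0 \<in> carrier_vec d" "v i 0 = 0\<^sub>v d"
    "q i k = \<C> ((1 / s k) \<cdot>\<^sub>v (x i k - prev d (xh i) k))"
    "xh i k = prev d (xh i) k + (\<omega> P * s k) \<cdot>\<^sub>v q i k"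
    "y i k = prev d (y i) k
        + (\<omega> P * s k) \<cdot>\<^sub>v finsum_vec TYPE(real) d (\<lambda>j. L $$ (i, j) \<cdot>\<^sub>v q j k) {..<n}"
    "x i (Suc k) = x i k - \<alpha> \<cdot>\<^sub>v (\<beta> P \<cdot>\<^sub>v y i k + \<gamma> P \<cdot>\<^sub>v v i k + grad d (f i) (x i k))"
    "v i (Suc k) = v i k + (\<alpha> * \<gamma> P) \<cdot>\<^sub>v y i k"
  using run assms unfolding unified_compression_def by auto

lemma prev_Suc [simp]: "prev d z (Suc k) = z k" and prev_0 [simp]: "prev d z 0 = 0\<^sub>v d"
  by (simp_all add: prev_def)

text \<open>The state at time k consists of x and v at k but xh and y at k - 1, hence
  \<open>prev\<close>. All four are carried through the induction, since the compressor is only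
  known to stay in the space on arguments in it.\<close>

lemma carriers_prev:
  "\<forall>i<n. x i k \<in> carrier_vec d \<and> v i k \<in> carrier_vec d \<and> prev d (xh i) k \<in> carrier_vec d
    \<and> prev d (y i) k \<in> carrier_vec d"
proof (induction k)
  case 0
  then show ?case using run_eqs(1,2) by simp
next
  case (Suc k)
  have c: "x i k \<in> carrier_vec d" "v i k \<in> carrier_vec d" "prev d (xh i) k \<in> carrier_vec d"
    "prev d (y i) k \<in> carrier_vec d" if "i < n" for i using Suc.IH that by blast+
  have q: "q i k \<in> carrier_vec d" if i: "i < n" for i
  proof -
    have "(1 / s k) \<cdot>\<^sub>v (x i k - prev d (xh i) k) \<in> carrier_vec d"
      by (intro smult_carrier_vec[THEN iffD2] minus_carrier_vec c i)
    then show ?thesis unfolding run_eqs(3)[OF i, of k]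
      using compressor unfolding locally_bounded_compressor_def by blast
  qed
  have xh: "xh i k \<in> carrier_vec d" if i: "i < n" for i
    unfolding run_eqs(4)[OF i, of k] by (intro smult_carrier_vec[THEN iffD2] add_carrier_vec c q i)
  have y: "y i k \<in> carrier_vec d" if i: "i < n" for i
  proof -
    have "finsum_vec TYPE(real) d (\<lambda>j. L $$ (i, j) \<cdot>\<^sub>v q j k) {..<n} \<in> carrier_vec d"
      using q by (intro finsum_vec_closed) simp
    then show ?thesis unfolding run_eqs(5)[OF i, of k]
      by (intro smult_carrier_vec[THEN iffD2] add_carrier_vec c i)
  qed
  show ?case
  proof (intro allI impI conjI)
    fix i assume i: "i < n"
    have "grad d (f i) (x i k) \<in> carrier_vec d" by (intro grad_carrier[OF sm] c i)
    then show "x i (Suc k) \<in> carrier_vec d" unfolding run_eqs(6)[OF i, of k]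
      by (intro smult_carrier_vec[THEN iffD2] add_carrier_vec minus_carrier_vec c y i)
    show "v i (Suc k) \<in> carrier_vec d" unfolding run_eqs(7)[OF i, of k]
      by (intro smult_carrier_vec[THEN iffD2] add_carrier_vec c y i)
    show "prev d (xh i) (Suc k) \<in> carrier_vec d" "prev d (y i) (Suc k) \<in> carrier_vec d"
      using xh[OF i] y[OF i] by simp_all
  qed
qed

lemma carriers [simp]:
  assumes "i < n"
  shows "x i k \<in> carrier_vec d" "v i k \<in> carrier_vec d" "xh i k \<in> carrier_vec d" "y i k \<in> carrier_vec d"
    "prev d (xh i) k \<in> carrier_vec d" "q i k \<in> carrier_vec d"
proof -
  show c: "x i k \<in> carrier_vec d" "v i k \<in> carrier_vec d" "prev d (xh i) k \<in> carrier_vec d"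
    using carriers_prev assms by blast+
  show "xh i k \<in> carrier_vec d" "y i k \<in> carrier_vec d" using carriers_prev[of "Suc k"] assms by simp_all
  have "(1 / s k) \<cdot>\<^sub>v (x i k - prev d (xh i) k) \<in> carrier_vec d"
    by (intro smult_carrier_vec[THEN iffD2] minus_carrier_vec c)
  then show "q i k \<in> carrier_vec d" unfolding run_eqs(3)[OF assms, of k]
    using compressor unfolding locally_bounded_compressor_def by blast
qed

lemmas dims [simp] = carriers[THEN carrier_vecD]

text \<open>Both y and xh accumulate the same compressed messages from zero, once with and once
  without the Laplacian. This eliminates y from the dynamics.\<close>

lemma y_coord:
  assumes i: "i < n" and c: "c < d"
  shows "y i k $ c = (\<Sum>j<n. L $$ (i, j) * xh j k $ c)"
proof -
  define qs where "qs k = finsum_vec TYPE(real) d (\<lambda>j. L $$ (i, j) \<cdot>\<^sub>v q j k) {..<n}" for k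
  have dq: "dim_vec (qs k) = d" for k
    unfolding qs_def by (rule carrier_vecD, rule finsum_vec_closed) simp
  have ix: "qs k $ c = (\<Sum>j<n. L $$ (i, j) * q j k $ c)" for k
  proof -
    have "qs k $ c = (\<Sum>j<n. (L $$ (i, j) \<cdot>\<^sub>v q j k) $ c)"
      unfolding qs_def using c by (intro index_finsum_vec) simp_all
    then show ?thesis using c by simp
  qed
  have step: "y i k $ c = prev d (y i) k $ c + \<omega> P * s k * (\<Sum>j<n. L $$ (i, j) * q j k $ c)" for k
    using arg_cong[OF run_eqs(5)[OF i, of k], of "\<lambda>v. v $ c", folded qs_def] c dq[of k] ix[of k] by simp
  have step': "xh j k $ c = prev d (xh j) k $ c + \<omega> P * s k * q j k $ c" if "j < n" for j k
    using arg_cong[OF run_eqs(4)[OF that, of k], of "\<lambda>v. v $ c"] c that by simp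
  show ?thesis
  proof (induction k)
    case 0
    have "(\<Sum>j<n. L $$ (i, j) * xh j 0 $ c) = \<omega> P * s 0 * (\<Sum>j<n. L $$ (i, j) * q j 0 $ c)"
      using c by (simp add: step' sum_distrib_left algebra_simps)
    then show ?case using step[of 0] c by simp
  next
    case (Suc k)
    have "(\<Sum>j<n. L $$ (i, j) * xh j (Suc k) $ c)
        = (\<Sum>j<n. L $$ (i, j) * xh j k $ c) + \<omega> P * s (Suc k) * (\<Sum>j<n. L $$ (i, j) * q j (Suc k) $ c)"
      by (simp add: step'[of _ "Suc k"] sum_distrib_left sum.distrib algebra_simps)
    then show ?case using step[of "Suc k"] Suc by simp
  qed
qed

section \<open>Modal variables of the run\<close>

definition "xb k = mean_vec n d (\<lambda>i. x i k)"
definition "gr k i = grad d (f i) (x i k)"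
definition "gr0 k i = grad d (f i) (xb k)"
text \<open>The eigenvalues of the Laplacian itself: mode 0 has eigenvalue 0 here, unlike in F,
  where \<open>lam (n + 1)\<close> replaces it.\<close>

definition "mu m = (if m = 0 then 0 else lam (m + 1))"
definition "xi k = modal n U (\<lambda>i c. x i k $ c)"
definition "er k = modal n U (\<lambda>i c. x i k $ c - xh i k $ c)"
text \<open>With this shift \<gamma> * v plus the local gradient becomes \<gamma> * wm + hm, so
  besides wm only gradient differences enter the update of x.\<close>

definition "wm k = modal n U (\<lambda>i c. v i k $ c + 1 / \<gamma> P * gr0 k i $ c)"
definition "hm k = modal n U (\<lambda>i c. gr k i $ c - gr0 k i $ c)"
definition "Dm k = modal n U (\<lambda>i c. gr0 (Suc k) i $ c - gr0 k i $ c)"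
definition "gb k c = modal n U (\<lambda>i c. gr k i $ c) 0 c"
definition "gb0 k c = modal n U (\<lambda>i c. gr0 k i $ c) 0 c"
definition "gap k = real n * (avg_fun n f (xb k) - f_star n d f)"
definition "Lyap k = lyapunov n d U lam f (\<beta> P) (\<gamma> P) (\<lambda>i. x i k) (\<lambda>i. v i k)"

lemma n_pos [simp]: "n > 0" "0 < real n" using n by auto

lemma U: "U \<in> carrier_mat n n" "U * transpose_mat U = 1\<^sub>m n" "transpose_mat U * U = 1\<^sub>m n"
  "col U 0 = vec n (\<lambda>_. 1 / sqrt (real n))"
  and L: "L = U * mat_diag n mu * transpose_mat U"
  using ed unfolding laplacian_eigendecomp_def mu_def[abs_def] by auto

lemma lam_bounds: "m \<in> {1..<n} \<Longrightarrow> \<rho>\<^sub>2 P \<le> lam (m + 1) \<and> lam (m + 1) \<le> \<rho> P"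
  "\<rho>\<^sub>2 P \<le> lam (n + 1)" "lam (n + 1) \<le> \<rho> P"
  using ed n unfolding laplacian_eigendecomp_def rho_lam rho2_lam by auto

lemma xb_carrier [simp]: "xb k \<in> carrier_vec d"
  unfolding xb_def by simp

lemma xb_dim [simp]: "dim_vec (xb k) = d"
  using xb_carrier by (rule carrier_vecD)

lemma gr_carrier [simp]: "i < n \<Longrightarrow> gr k i \<in> carrier_vec d" "i < n \<Longrightarrow> gr0 k i \<in> carrier_vec d"
  unfolding gr_def gr0_def using grad_carrier[OF sm] by auto

lemmas gr_dim [simp] = gr_carrier[THEN carrier_vecD]

lemma modal_L: "m < n \<Longrightarrow> modal n U (\<lambda>i c. \<Sum>j<n. L $$ (i, j) * z j c) m c = mu m * modal n U z m c"
  by (rule modal_diagonalized[OF U(1,3) _ L])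

lemma modal_xh: "modal n U (\<lambda>i c. xh i k $ c) m c = xi k m c - er k m c"
  unfolding xi_def er_def by (simp add: modal_linear)

text \<open>The Laplacian annihilates mode 0, and v starts at zero and receives only multiples of L
  applied to xh. Hence wm at mode 0 is purely a gradient term.\<close>

lemma v_mode_0: "c < d \<Longrightarrow> modal n U (\<lambda>i c. v i k $ c) 0 c = 0"
proof (induction k)
  case 0
  have "modal n U (\<lambda>i c. v i 0 $ c) 0 c = modal n U (\<lambda>i c. 0 * (0::real)) 0 c"
    using 0 run_eqs(2) by (intro modal_cong) auto
  then show ?case by (simp add: modal_def)
next
  case (Suc k)
  have "modal n U (\<lambda>i c. v i (Suc k) $ c) 0 c
      = modal n U (\<lambda>i c. v i k $ c + \<alpha> * \<gamma> P * (\<Sum>j<n. L $$ (i, j) * xh j k $ c)) 0 c"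
  proof (rule modal_cong)
    fix i assume i: "i < n"
    show "v i (Suc k) $ c = v i k $ c + \<alpha> * \<gamma> P * (\<Sum>j<n. L $$ (i, j) * xh j k $ c)"
      unfolding run_eqs(7)[OF i, of k] y_coord[OF i Suc.prems, symmetric] using i Suc.prems by simp
  qed
  also have "\<dots> = 0" using Suc modal_L[of 0] unfolding modal_linear by (simp add: mu_def)
  finally show ?case .
qed

lemma wm_0: "c < d \<Longrightarrow> wm k 0 c = gb0 k c / \<gamma> P"
  unfolding wm_def gb0_def by (simp only: modal_linear v_mode_0) simp

lemma hm_0: "hm k 0 c = gb k c - gb0 k c"
  unfolding hm_def gb_def gb0_def by (simp only: modal_linear)

lemma xi_step:
  assumes m: "m < n" and c: "c < d"
  shows "xi (Suc k) m c = xi k m c - \<alpha> * (\<beta> P * mu m * (xi k m c - er k m c) + \<gamma> P * wm k m c + hm k m c)"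
proof -
  have "xi (Suc k) m c = modal n U (\<lambda>i c. x i k $ c - \<alpha> * (\<beta> P * (\<Sum>j<n. L $$ (i, j) * xh j k $ c)
      + (\<gamma> P * (v i k $ c + 1 / \<gamma> P * gr0 k i $ c) + (gr k i $ c - gr0 k i $ c)))) m c"
    unfolding xi_def
  proof (rule modal_cong)
    fix i assume i: "i < n"
    have "x i (Suc k) $ c = x i k $ c - \<alpha> * (\<beta> P * y i k $ c + \<gamma> P * v i k $ c + gr k i $ c)"
      unfolding run_eqs(6)[OF i, of k] gr_def[symmetric] using i c by simp
    then show "x i (Suc k) $ c = x i k $ c - \<alpha> * (\<beta> P * (\<Sum>j<n. L $$ (i, j) * xh j k $ c)
      + (\<gamma> P * (v i k $ c + 1 / \<gamma> P * gr0 k i $ c) + (gr k i $ c - gr0 k i $ c)))"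
      unfolding y_coord[OF i c] using gamma_pos by (simp add: algebra_simps)
  qed
  also have "\<dots> = xi k m c - \<alpha> * (\<beta> P * (mu m * (xi k m c - er k m c)) + (\<gamma> P * wm k m c + hm k m c))"
    unfolding modal_xh[symmetric] modal_L[OF m, symmetric] unfolding xi_def wm_def hm_def
    by (simp only: modal_linear)
  finally show ?thesis by (simp add: algebra_simps)
qed

lemma wm_step:
  assumes m: "m < n" and c: "c < d"
  shows "wm (Suc k) m c = wm k m c + \<alpha> * \<gamma> P * mu m * (xi k m c - er k m c) + Dm k m c / \<gamma> P"
proof -
  have "wm (Suc k) m c = modal n U (\<lambda>i c. (v i k $ c + 1 / \<gamma> P * gr0 k i $ c)
      + (\<alpha> * \<gamma> P * (\<Sum>j<n. L $$ (i, j) * xh j k $ c) + 1 / \<gamma> P * (gr0 (Suc k) i $ c - gr0 k i $ c))) m c"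
    unfolding wm_def
  proof (rule modal_cong)
    fix i assume i: "i < n"
    have "v i (Suc k) $ c = v i k $ c + \<alpha> * \<gamma> P * y i k $ c"
      unfolding run_eqs(7)[OF i, of k] using i c by simp
    then show "v i (Suc k) $ c + 1 / \<gamma> P * gr0 (Suc k) i $ c = (v i k $ c + 1 / \<gamma> P * gr0 k i $ c)
      + (\<alpha> * \<gamma> P * (\<Sum>j<n. L $$ (i, j) * xh j k $ c) + 1 / \<gamma> P * (gr0 (Suc k) i $ c - gr0 k i $ c))"
      unfolding y_coord[OF i c] by (simp add: diff_divide_distrib)
  qed
  also have "\<dots> = wm k m c + (\<alpha> * \<gamma> P * (mu m * (xi k m c - er k m c)) + 1 / \<gamma> P * Dm k m c)"
    unfolding modal_xh[symmetric] modal_L[OF m, symmetric] unfolding wm_def Dm_def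
    by (simp only: modal_linear)
  finally show ?thesis by (simp add: algebra_simps)
qed

lemma xi_0: "c < d \<Longrightarrow> xi k 0 c = sqrt (real n) * xb k $ c"
proof -
  assume c: "c < d"
  have "xi k 0 c = (\<Sum>i<n. x i k $ c) / sqrt (real n)"
    unfolding xi_def by (rule modal_0[OF U(1,4) n_pos(1)])
  also have "(\<Sum>i<n. x i k $ c) = real n * xb k $ c"
    unfolding xb_def using c by (simp add: index_mean_vec)
  also have "real n * xb k $ c / sqrt (real n) = sqrt (real n) * xb k $ c"
    by (simp add: field_simps flip: real_sqrt_mult_self[of "real n"])
  finally show ?thesis .
qed

lemma grad_avg: "grad d (avg_fun n f) (xb k) = mean_vec n d (gr0 k)"
  unfolding gr0_def[abs_def] by (rule grad_avg_fun[OF n_pos(1) _ xb_carrier, where l = "lip P"]) (rule sm)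

lemma gb0_eq: "c < d \<Longrightarrow> gb0 k c = sqrt (real n) * grad d (avg_fun n f) (xb k) $ c"
proof -
  assume c: "c < d"
  have "gb0 k c = (\<Sum>i<n. gr0 k i $ c) / sqrt (real n)"
    unfolding gb0_def by (rule modal_0[OF U(1,4) n_pos(1)])
  also have "(\<Sum>i<n. gr0 k i $ c) = real n * grad d (avg_fun n f) (xb k) $ c"
    unfolding grad_avg using c by (simp add: index_mean_vec)
  also have "real n * grad d (avg_fun n f) (xb k) $ c / sqrt (real n)
      = sqrt (real n) * grad d (avg_fun n f) (xb k) $ c"
    by (simp add: field_simps flip: real_sqrt_mult_self[of "real n"])
  finally show ?thesis .
qed

lemma grad_avg_carrier [simp]: "grad d (avg_fun n f) (xb k) \<in> carrier_vec d"
  unfolding grad_avg by simp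

lemma grad_avg_dim [simp]: "dim_vec (grad d (avg_fun n f) (xb k)) = d"
  using grad_avg_carrier by (rule carrier_vecD)

lemma sum_gb0: "(\<Sum>c<d. (gb0 k c)\<^sup>2) = real n * (norm2 (grad d (avg_fun n f) (xb k)))\<^sup>2"
  unfolding norm2_sq by (simp add: gb0_eq power_mult_distrib sum_distrib_left)

text \<open>Neither the Laplacian term nor v contributes to mode 0, so the average moves along the
  mean of the local gradients, free of compression error.\<close>

lemma xb_step: "c < d \<Longrightarrow> (xb (Suc k) - xb k) $ c = - (\<alpha> / sqrt (real n)) * gb k c"
proof -
  assume c: "c < d"
  have "sqrt (real n) * xb (Suc k) $ c - sqrt (real n) * xb k $ c = - \<alpha> * gb k c"
    unfolding xi_0[OF c, symmetric] xi_step[OF n_pos(1) c] hm_0 wm_0[OF c] using gamma_pos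
    by (simp add: mu_def)
  then have "sqrt (real n) * (xb (Suc k) - xb k) $ c = - \<alpha> * gb k c"
    using c xb_carrier[of k] xb_carrier[of "Suc k"] by (simp add: right_diff_distrib)
  then show ?thesis by (simp add: field_simps)
qed

lemma norm2_xb_step: "(norm2 (xb (Suc k) - xb k))\<^sup>2 = \<alpha>\<^sup>2 / real n * (\<Sum>c<d. (gb k c)\<^sup>2)"
proof -
  have "(norm2 (xb (Suc k) - xb k))\<^sup>2 = (\<Sum>c<d. ((xb (Suc k) - xb k) $ c)\<^sup>2)"
    using xb_carrier[of k] unfolding norm2_sq by simp
  also have "\<dots> = (\<Sum>c<d. \<alpha>\<^sup>2 / real n * (gb k c)\<^sup>2)"
  proof (rule sum.cong[OF refl])
    fix c assume "c \<in> {..<d}"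
    then have c: "c < d" by simp
    show "((xb (Suc k) - xb k) $ c)\<^sup>2 = \<alpha>\<^sup>2 / real n * (gb k c)\<^sup>2"
      unfolding xb_step[OF c] by (simp add: power_mult_distrib power_divide)
  qed
  finally show ?thesis by (simp add: sum_distrib_left)
qed

text \<open>Mode 0 is sqrt n times the average, so Parseval splits the squared norm of the iterates
  into the part of the average and the deviation from it.\<close>

lemma consensus: "(\<Sum>i<n. (norm2 (x i k - xb k))\<^sup>2) = (\<Sum>c<d. \<Sum>m\<in>{1..<n}. (xi k m c)\<^sup>2)"
proof -
  have "(\<Sum>i<n. (norm2 (x i k - xb k))\<^sup>2) = (\<Sum>i<n. \<Sum>c<d. (x i k $ c - xb k $ c)\<^sup>2)"
  proof (rule sum.cong[OF refl])
    fix i assume "i \<in> {..<n}"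
    show "(norm2 (x i k - xb k))\<^sup>2 = (\<Sum>c<d. (x i k $ c - xb k $ c)\<^sup>2)"
      using xb_carrier[of k] unfolding norm2_sq by simp
  qed
  also have "\<dots> = (\<Sum>c<d. \<Sum>i<n. (x i k $ c - xb k $ c)\<^sup>2)" by (rule sum.swap)
  also have "\<dots> = (\<Sum>c<d. \<Sum>m\<in>{1..<n}. (xi k m c)\<^sup>2)"
  proof (rule sum.cong[OF refl])
    fix c assume "c \<in> {..<d}"
    then have c: "c < d" by simp
    define b where "b = xb k $ c"
    have sx: "(\<Sum>i<n. x i k $ c) = real n * b"
      unfolding b_def xb_def using c by (simp add: index_mean_vec)
    have "(\<Sum>i<n. (x i k $ c - b)\<^sup>2) = (\<Sum>i<n. x i k $ c * x i k $ c) - 2 * b * (\<Sum>i<n. x i k $ c) + real n * b\<^sup>2"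
      by (simp add: power2_eq_square algebra_simps sum.distrib sum_subtractf sum_distrib_left)
    also have "\<dots> = (\<Sum>i<n. x i k $ c * x i k $ c) - real n * b\<^sup>2"
      unfolding sx by (simp add: power2_eq_square)
    also have "(\<Sum>i<n. x i k $ c * x i k $ c) = (\<Sum>m<n. xi k m c * xi k m c)"
      unfolding xi_def by (rule modal_parseval[OF U(1,2), symmetric])
    also have "\<dots> = (xi k 0 c)\<^sup>2 + (\<Sum>m\<in>{1..<n}. (xi k m c)\<^sup>2)"
      unfolding sum_lessThan_head[OF n_pos(1)] by (simp add: power2_eq_square)
    also have "(xi k 0 c)\<^sup>2 = real n * b\<^sup>2" unfolding xi_0[OF c] b_def by (simp add: power_mult_distrib)
    finally show "(\<Sum>i<n. (x i k $ c - xb k $ c)\<^sup>2) = (\<Sum>m\<in>{1..<n}. (xi k m c)\<^sup>2)"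
      unfolding b_def by simp
  qed
  finally show ?thesis .
qed

lemma modal_diff_norm:
  assumes "\<And>i. i < n \<Longrightarrow> z i \<in> carrier_vec d" "\<And>i. i < n \<Longrightarrow> w i \<in> carrier_vec d"
  shows "(\<Sum>c<d. \<Sum>m<n. (modal n U (\<lambda>i c. z i $ c - w i $ c) m c)\<^sup>2) = (\<Sum>i<n. (norm2 (z i - w i))\<^sup>2)"
proof -
  have "(norm2 (z i - w i))\<^sup>2 = (\<Sum>c<d. (z i $ c - w i $ c)\<^sup>2)" if "i < n" for i
  proof -
    have "dim_vec (z i) = d" "dim_vec (w i) = d" using assms[OF that] by auto
    then show ?thesis unfolding norm2_sq by simp
  qed
  then show ?thesis unfolding modal_norm[OF U(1,2)] by simp
qed

lemma hm_bound:
  "(\<Sum>c<d. \<Sum>m<n. (hm k m c)\<^sup>2) \<le> (lip P)\<^sup>2 * (\<Sum>c<d. \<Sum>m\<in>{1..<n}. (xi k m c)\<^sup>2)"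
proof -
  have "(\<Sum>c<d. \<Sum>m<n. (hm k m c)\<^sup>2) = (\<Sum>i<n. (norm2 (gr k i - gr0 k i))\<^sup>2)"
    unfolding hm_def by (rule modal_diff_norm) auto
  also have "\<dots> \<le> (\<Sum>i<n. (lip P * norm2 (x i k - xb k))\<^sup>2)"
    using sm unfolding gr_def gr0_def smooth_def by (intro sum_mono power_mono) auto
  also have "\<dots> = (lip P)\<^sup>2 * (\<Sum>i<n. (norm2 (x i k - xb k))\<^sup>2)"
    by (simp add: power_mult_distrib sum_distrib_left)
  finally show ?thesis unfolding consensus .
qed

text \<open>All n gradients are taken at the same point, the average, whose squared displacement
  carries a factor 1 / n; summing over the agents cancels it.\<close>

lemma Dm_bound:
  "(\<Sum>c<d. \<Sum>m<n. (Dm k m c)\<^sup>2) \<le> (lip P)\<^sup>2 * \<alpha>\<^sup>2 * (\<Sum>c<d. (gb k c)\<^sup>2)"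
proof -
  have "(\<Sum>c<d. \<Sum>m<n. (Dm k m c)\<^sup>2) = (\<Sum>i<n. (norm2 (gr0 (Suc k) i - gr0 k i))\<^sup>2)"
    unfolding Dm_def by (rule modal_diff_norm) auto
  also have "\<dots> \<le> (\<Sum>i<n. (lip P * norm2 (xb (Suc k) - xb k))\<^sup>2)"
    using sm unfolding gr0_def smooth_def by (intro sum_mono power_mono) auto
  also have "\<dots> = (lip P)\<^sup>2 * \<alpha>\<^sup>2 * (\<Sum>c<d. (gb k c)\<^sup>2)"
    by (simp add: power_mult_distrib norm2_xb_step)
  finally show ?thesis .
qed

text \<open>The descent lemma for the average objective, multiplied by n; the factors sqrt n in
  gradient and displacement absorb the n.\<close>

lemma gap_step:
  "gap (Suc k) \<le> gap k - \<alpha> * (\<Sum>c<d. gb0 k c * gb k c) + lip P / 2 * \<alpha>\<^sup>2 * (\<Sum>c<d. (gb k c)\<^sup>2)"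
proof -
  define h where "h = xb (Suc k) - xb k"
  have h: "h \<in> carrier_vec d" unfolding h_def by simp
  have xs: "xb k + h = xb (Suc k)" unfolding h_def using xb_carrier[of k] xb_carrier[of "Suc k"] by auto
  have "avg_fun n f (xb (Suc k))
      \<le> avg_fun n f (xb k) + grad d (avg_fun n f) (xb k) \<bullet> h + lip P / 2 * (norm2 h)\<^sup>2"
    using avg_fun_upper_bound[where f = f, OF n_pos(1) sm xb_carrier h, of k] unfolding xs grad_avg gr0_def[abs_def] by simp
  then have "real n * avg_fun n f (xb (Suc k))
      \<le> real n * (avg_fun n f (xb k) + grad d (avg_fun n f) (xb k) \<bullet> h + lip P / 2 * (norm2 h)\<^sup>2)"
    by (intro mult_left_mono) auto
  also have "\<dots> = real n * avg_fun n f (xb k) + real n * (grad d (avg_fun n f) (xb k) \<bullet> h)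
      + lip P / 2 * (real n * (norm2 h)\<^sup>2)" by (simp add: algebra_simps)
  also have "real n * (norm2 h)\<^sup>2 = \<alpha>\<^sup>2 * (\<Sum>c<d. (gb k c)\<^sup>2)" unfolding h_def norm2_xb_step by simp
  also have "real n * (grad d (avg_fun n f) (xb k) \<bullet> h) = - \<alpha> * (\<Sum>c<d. gb0 k c * gb k c)"
  proof -
    have "real n * (grad d (avg_fun n f) (xb k) \<bullet> h) = (\<Sum>c<d. real n * (grad d (avg_fun n f) (xb k) $ c * h $ c))"
      unfolding scalar_prod_def using h by (simp add: atLeast0LessThan sum_distrib_left)
    also have "\<dots> = (\<Sum>c<d. - \<alpha> * (gb0 k c * gb k c))"
    proof (intro sum.cong refl)
      fix c assume "c \<in> {..<d}"
      then have c: "c < d" by simp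
      have "sqrt (real n) * sqrt (real n) = real n" by simp
      then show "real n * (grad d (avg_fun n f) (xb k) $ c * h $ c) = - \<alpha> * (gb0 k c * gb k c)"
        unfolding h_def xb_step[OF c] gb0_eq[OF c] by (simp add: field_simps)
    qed
    finally show ?thesis by (simp add: sum_distrib_left sum_negf)
  qed
  finally show ?thesis unfolding gap_def by (simp add: algebra_simps)
qed

lemma Lyap_modal:
  "Lyap k = (\<Sum>c<d. (\<Sum>m\<in>{1..<n}. mode_lyap ((\<beta> P + \<gamma> P) / \<gamma> P) (lam (m + 1)) (xi k m c) (wm k m c))
        + ((\<beta> P + \<gamma> P) / \<gamma> P) / (2 * lam (n + 1)) * (wm k 0 c)\<^sup>2) + gap k"
  unfolding Lyap_def lyapunov_modal[OF ed n_pos(1) d] gap_def xi_def wm_def gr0_def xb_def ..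

section \<open>Decrease of the Lyapunov function and length of a step\<close>

definition "cons_err k = (\<Sum>i<n. (norm2 (x i k - xb k))\<^sup>2)"
definition "comp_err k = (\<Sum>i<n. (norm2 (x i k - xh i k))\<^sup>2)"
definition "grad_sq k = (norm2 (grad d (avg_fun n f) (xb k)))\<^sup>2"

lemma er_bound: "(\<Sum>c<d. \<Sum>m\<in>{1..<n}. (er k m c)\<^sup>2) \<le> comp_err k"
proof -
  have "(\<Sum>c<d. \<Sum>m\<in>{1..<n}. (er k m c)\<^sup>2) \<le> (\<Sum>c<d. \<Sum>m<n. (er k m c)\<^sup>2)"
    by (intro sum_mono sum_mono2) auto
  also have "\<dots> = comp_err k" unfolding er_def comp_err_def by (rule modal_diff_norm) auto
  finally show ?thesis .
qed

lemma gap_nonneg: "gap k \<ge> 0"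
proof -
  have "f_star n d f \<le> avg_fun n f (xb k)" unfolding f_star_def using bdd by (intro cINF_lower) auto
  then show ?thesis unfolding gap_def by simp
qed

text \<open>The terms in wm and gb are dropped by their sign, which the bound
  \<open>\<kappa>\<^sub>7\<close> on \<alpha> guarantees. The consensus term keeps its coefficient,
  as the rate is read off from it.\<close>

lemma Lyap_descent:
  "Lyap (Suc k) \<le> Lyap k - \<alpha> * (\<phi>\<^sub>1 P - \<alpha> * \<phi>\<^sub>2 P) * cons_err k - \<alpha> / 4 * (real n * grad_sq k)
    + \<alpha> * \<psi>\<^sub>2 P \<alpha> * comp_err k"
proof -
  define W where "W = (\<Sum>c<d. \<Sum>m\<in>{1..<n}. (wm k m c)\<^sup>2 / lam (m + 1))"
  define G where "G = (\<Sum>c<d. (gb k c)\<^sup>2)"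
  define Er where "Er = (\<Sum>c<d. \<Sum>m\<in>{1..<n}. (er k m c)\<^sup>2)"
  have "Lyap (Suc k) \<le> Lyap k - \<alpha> * (\<phi>\<^sub>1 P - \<alpha> * \<phi>\<^sub>2 P) * cons_err k
      - \<alpha> * (\<phi>\<^sub>3 P - \<alpha> * \<phi>\<^sub>4 P) * W - \<alpha> * (\<phi>\<^sub>5 P - \<alpha> * \<phi>\<^sub>6 P) * G
      - \<alpha> / 4 * (real n * grad_sq k) + \<alpha> * \<psi>\<^sub>2 P \<alpha> * Er"
    unfolding Lyap_modal W_def G_def Er_def cons_err_def consensus grad_sq_def sum_gb0[symmetric]
  proof (rule network_descent[where D = "Dm k"])
    show "n > 0" "\<alpha> > 0" using \<alpha>_pos by auto
    show "\<And>m. m \<in> {1..<n} \<Longrightarrow> \<rho>\<^sub>2 P \<le> lam (m + 1) \<and> lam (m + 1) \<le> \<rho> P" "\<rho>\<^sub>2 P \<le> lam (n + 1)"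
      using lam_bounds by auto
    fix m c assume m: "m \<in> {1..<n}" and c: "c < d"
    then have m': "m < n" "mu m = lam (m + 1)" by (auto simp: mu_def)
    show "xi (Suc k) m c = xi k m c - \<alpha> * (\<beta> P * lam (m + 1) * (xi k m c - er k m c) + \<gamma> P * wm k m c + hm k m c)"
      using xi_step[OF m'(1) c] unfolding m'(2) .
    show "wm (Suc k) m c = wm k m c + \<alpha> * \<gamma> P * lam (m + 1) * (xi k m c - er k m c) + Dm k m c / \<gamma> P"
      using wm_step[OF m'(1) c] unfolding m'(2) .
  next
    fix c assume c: "c < d"
    show "wm (Suc k) 0 c = wm k 0 c + Dm k 0 c / \<gamma> P"
      using wm_step[OF n_pos(1) c] by (simp add: mu_def)
  qed (use wm_0 hm_0 hm_bound Dm_bound gap_step in auto)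
  moreover have "0 \<le> \<alpha> * (\<phi>\<^sub>3 P - \<alpha> * \<phi>\<^sub>4 P) * W"
  proof -
    have "lam (m + 1) > 0" if "m \<in> {1..<n}" for m using lam_bounds(1)[OF that] rho2_pos by linarith
    then have "W \<ge> 0" unfolding W_def by (intro sum_nonneg divide_nonneg_nonneg) (auto simp: less_imp_le)
    then show ?thesis using \<alpha>_pos kappa7_coeffs(2)[OF \<alpha>_le] by simp
  qed
  moreover have "0 \<le> \<alpha> * (\<phi>\<^sub>5 P - \<alpha> * \<phi>\<^sub>6 P) * G"
    using \<alpha>_pos kappa7_coeffs(3)[OF \<alpha>_le] unfolding G_def by (simp add: sum_nonneg)
  moreover have "\<alpha> * \<psi>\<^sub>2 P \<alpha> * Er \<le> \<alpha> * \<psi>\<^sub>2 P \<alpha> * comp_err k"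
    unfolding Er_def using er_bound \<alpha>_pos psi2_pos[of \<alpha>] by (intro mult_left_mono) auto
  ultimately show ?thesis by linarith
qed

text \<open>The squared E-norm of the iterates plus the squared F-norm of the shifted dual variable:
  the form without cross term that the Lyapunov function controls.\<close>

definition "energy k = cons_err k
  + (\<Sum>c<d. (\<Sum>m\<in>{1..<n}. (wm k m c)\<^sup>2 / lam (m + 1)) + (wm k 0 c)\<^sup>2 / lam (n + 1))"

lemma energy_le: "\<epsilon>\<^sub>1 P * energy k + gap k \<le> Lyap k"
  unfolding Lyap_modal energy_def cons_err_def consensus
  using network_lyap_lower_bound[where n = n and lam = lam and d = d and \<xi> = "xi k" and w = "wm k"] lam_bounds by auto

lemma cons_err_le_energy: "0 \<le> cons_err k" "cons_err k \<le> energy k"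
proof -
  show "0 \<le> cons_err k" unfolding cons_err_def by (intro sum_nonneg) auto
  have "lam (m + 1) > 0" if "m \<in> {1..<n}" for m using lam_bounds(1)[OF that] rho2_pos by linarith
  moreover have "lam (n + 1) > 0" using lam_bounds(2) rho2_pos by linarith
  ultimately show "cons_err k \<le> energy k" unfolding energy_def
    by (auto intro!: sum_nonneg add_nonneg_nonneg divide_nonneg_nonneg simp: less_imp_le)
qed

lemma movement_le:
  "(\<Sum>i<n. (norm2 (x i (Suc k) - x i k))\<^sup>2) \<le> 4 * \<alpha>\<^sup>2 *
    ((\<beta> P)\<^sup>2 * (\<rho> P)\<^sup>2 * comp_err k
     + max ((\<beta> P)\<^sup>2 * (\<rho> P)\<^sup>2 + (lip P)\<^sup>2) ((\<gamma> P)\<^sup>2 * \<rho> P) * energy k)"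
proof -
  have "(\<Sum>i<n. (norm2 (x i (Suc k) - x i k))\<^sup>2) = (\<Sum>c<d. \<Sum>m<n. (xi (Suc k) m c - xi k m c)\<^sup>2)"
  proof -
    have "xi (Suc k) m c - xi k m c = modal n U (\<lambda>i c. x i (Suc k) $ c - x i k $ c) m c" for m c
      unfolding xi_def by (simp only: modal_linear)
    then show ?thesis by (simp add: modal_diff_norm)
  qed
  also have "\<dots> \<le> 4 * \<alpha>\<^sup>2 * ((\<beta> P)\<^sup>2 * (\<rho> P)\<^sup>2 * (\<Sum>c<d. \<Sum>m\<in>{1..<n}. (er k m c)\<^sup>2)
     + max ((\<beta> P)\<^sup>2 * (\<rho> P)\<^sup>2 + (lip P)\<^sup>2) ((\<gamma> P)\<^sup>2 * \<rho> P) * energy k)"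
    unfolding energy_def cons_err_def consensus
  proof (rule network_movement)
    show "n > 0" by simp
    show "\<And>m. m \<in> {1..<n} \<Longrightarrow> \<rho>\<^sub>2 P \<le> lam (m + 1) \<and> lam (m + 1) \<le> \<rho> P" "\<rho>\<^sub>2 P \<le> lam (n + 1)"
      "lam (n + 1) \<le> \<rho> P"
      using lam_bounds by auto
    fix m c assume m: "m \<in> {1..<n}" and c: "c < d"
    then have m': "m < n" "mu m = lam (m + 1)" by (auto simp: mu_def)
    show "xi (Suc k) m c = xi k m c - \<alpha> * (\<beta> P * lam (m + 1) * (xi k m c - er k m c) + \<gamma> P * wm k m c + hm k m c)"
      using xi_step[OF m'(1) c] unfolding m'(2) .
  next
    fix c assume c: "c < d"
    show "xi (Suc k) 0 c = xi k 0 c - \<alpha> * (\<gamma> P * wm k 0 c + hm k 0 c)"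
      using xi_step[OF n_pos(1) c] by (simp add: mu_def)
  qed (use hm_bound in auto)
  also have "\<dots> \<le> 4 * \<alpha>\<^sup>2 * ((\<beta> P)\<^sup>2 * (\<rho> P)\<^sup>2 * comp_err k
     + max ((\<beta> P)\<^sup>2 * (\<rho> P)\<^sup>2 + (lip P)\<^sup>2) ((\<gamma> P)\<^sup>2 * \<rho> P) * energy k)"
    using er_bound[of k] by (intro mult_left_mono add_right_mono) auto
  finally show ?thesis .
qed

end

section \<open>Compression errors and rates\<close>

context compression_run
begin

text \<open>After division by \<open>s k\<close> this says that every input of the compressor lies
  in the ball where it is accurate.\<close>

definition "tracked k \<longleftrightarrow> (\<forall>i<n. pnorm p (x i k - prev d (xh i) k) \<le> rad P * s k)"

text \<open>With t = \<omega> * scale, the new error combines the scaled input z, of norm at most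
  rad, with weight 1 - t, and the compressor error, of norm at most rad * (1 - \<delta>), with
  weight t. The bound t <= 1 keeps the first weight nonnegative.\<close>

lemma compression_contracts:
  assumes i: "i < n" and tr: "pnorm p (x i k - prev d (xh i) k) \<le> rad P * s k"
  shows "pnorm p (x i k - xh i k) \<le> (1 - \<omega> P * scale P * \<delta> P) * (rad P * s k)"
proof -
  define t where "t = \<omega> P * scale P"
  define z where "z = (1 / s k) \<cdot>\<^sub>v (x i k - prev d (xh i) k)"
  define e where "e = (1 / scale P) \<cdot>\<^sub>v \<C> z - z"
  have cc: "x i k \<in> carrier_vec d" "prev d (xh i) k \<in> carrier_vec d" using i by auto
  have z: "z \<in> carrier_vec d" unfolding z_def using cc by simp
  have Cz: "\<C> z \<in> carrier_vec d" using compressor z unfolding locally_bounded_compressor_def by blast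
  have e: "e \<in> carrier_vec d" unfolding e_def using z Cz by simp
  have dv: "dim_vec z = d" "dim_vec (\<C> z) = d" "dim_vec e = d"
    using z Cz e by (simp_all only: carrier_vecD)
  have dm: "dim_vec z > 0" "dim_vec e > 0" "dim_vec (x i k - prev d (xh i) k) > 0" using dv i d by simp_all
  have t: "0 < t" "t \<le> 1" unfolding t_def using omega_scale by auto
  have zn: "pnorm p z \<le> rad P"
    unfolding z_def pnorm_smult[OF dm(3) p] using tr s_pos[of k] by (simp add: pos_divide_le_eq)
  then have en: "pnorm p e \<le> rad P * (1 - \<delta> P)"
    using compressor z unfolding locally_bounded_compressor_def e_def by blast
  have "x i k - xh i k = s k \<cdot>\<^sub>v ((1 - t) \<cdot>\<^sub>v z + (- t) \<cdot>\<^sub>v e)"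
  proof (rule eq_vecI)
    fix c assume "c < dim_vec (s k \<cdot>\<^sub>v ((1 - t) \<cdot>\<^sub>v z + (- t) \<cdot>\<^sub>v e))"
    then have c: "c < d" using dv by simp
    have qz: "q i k = \<C> z" unfolding run_eqs(3)[OF i] z_def ..
    have zc: "s k * z $ c = x i k $ c - prev d (xh i) k $ c"
      unfolding z_def using i c s_pos[of k] by simp
    have "(x i k - xh i k) $ c = x i k $ c - (prev d (xh i) k $ c + \<omega> P * s k * \<C> z $ c)"
      unfolding run_eqs(4)[OF i, of k] qz using i c dv by simp
    also have "\<dots> = s k * z $ c - \<omega> P * s k * \<C> z $ c" unfolding zc by simp
    also have "\<dots> = s k * ((1 - t) * z $ c - t * (1 / scale P * \<C> z $ c - z $ c))"
      unfolding t_def using scale_pos by (simp add: field_simps)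
    finally show "(x i k - xh i k) $ c = (s k \<cdot>\<^sub>v ((1 - t) \<cdot>\<^sub>v z + (- t) \<cdot>\<^sub>v e)) $ c"
      using i c dv unfolding e_def by simp
  qed (use dv i in simp)
  then have "pnorm p (x i k - xh i k) = s k * pnorm p ((1 - t) \<cdot>\<^sub>v z + (- t) \<cdot>\<^sub>v e)"
    using dv d s_pos[of k] by (simp add: pnorm_smult[OF _ p])
  also have "pnorm p ((1 - t) \<cdot>\<^sub>v z + (- t) \<cdot>\<^sub>v e) \<le> (1 - t) * pnorm p z + t * pnorm p e"
  proof -
    have "pnorm p ((1 - t) \<cdot>\<^sub>v z + (- t) \<cdot>\<^sub>v e) \<le> pnorm p ((1 - t) \<cdot>\<^sub>v z) + pnorm p ((- t) \<cdot>\<^sub>v e)"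
      using z e d p by (intro pnorm_triangle[of _ d]) auto
    then show ?thesis using t by (simp add: pnorm_smult[OF dm(1) p] pnorm_smult[OF dm(2) p])
  qed
  also have "(1 - t) * pnorm p z + t * pnorm p e \<le> (1 - t) * rad P + t * (rad P * (1 - \<delta> P))"
    using zn en t by (intro add_mono mult_left_mono) auto
  finally show ?thesis using s_pos[of k] unfolding t_def by (simp add: algebra_simps mult_left_mono)
qed

lemma comp_err_le:
  assumes "tracked k"
  shows "comp_err k \<le> real n * (d_tilde d p)\<^sup>2 * (1 - 2 * \<epsilon>\<^sub>5 P) * (rad P)\<^sup>2 * (s k)\<^sup>2"
proof -
  have "(norm2 (x i k - xh i k))\<^sup>2 \<le> (d_tilde d p)\<^sup>2 * (1 - 2 * \<epsilon>\<^sub>5 P) * (rad P)\<^sup>2 * (s k)\<^sup>2" if i: "i < n" for i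
  proof -
    define t where "t = 1 - \<omega> P * scale P * \<delta> P"
    have cc: "x i k - xh i k \<in> carrier_vec d" using i by simp
    have pn: "pnorm p (x i k - xh i k) \<ge> 0" using i d by (intro pnorm_nonneg) simp
    have dt: "d_tilde d p \<ge> 0" using d_tilde_ge_1[OF d, of p] by simp
    have "norm2 (x i k - xh i k) \<le> d_tilde d p * pnorm p (x i k - xh i k)"
      by (rule norm2_le_d_tilde_pnorm[OF cc d p])
    also have "\<dots> \<le> d_tilde d p * (t * (rad P * s k))"
      unfolding t_def using compression_contracts[OF i] assms i dt unfolding tracked_def
      by (intro mult_left_mono) auto
    finally have "(norm2 (x i k - xh i k))\<^sup>2 \<le> (d_tilde d p * (t * (rad P * s k)))\<^sup>2"
      by (intro power_mono) auto
    also have "\<dots> = (d_tilde d p)\<^sup>2 * t\<^sup>2 * ((rad P)\<^sup>2 * (s k)\<^sup>2)" by (simp add: power_mult_distrib)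
    also have "\<dots> \<le> (d_tilde d p)\<^sup>2 * (1 - 2 * \<epsilon>\<^sub>5 P) * ((rad P)\<^sup>2 * (s k)\<^sup>2)"
      unfolding t_def using eps5(3) by (intro mult_right_mono mult_left_mono) auto
    finally show ?thesis by (simp add: mult.assoc)
  qed
  then have "comp_err k \<le> (\<Sum>i<n. (d_tilde d p)\<^sup>2 * (1 - 2 * \<epsilon>\<^sub>5 P) * (rad P)\<^sup>2 * (s k)\<^sup>2)"
    unfolding comp_err_def by (intro sum_mono) auto
  then show ?thesis by (simp add: algebra_simps)
qed

text \<open>The next input of the compressor is the present error plus the step of the agent. The
  error contracts; the step is controlled by the compression error and the Lyapunov
  function.\<close>

lemma tracking_error_step:
  assumes i: "i < n" and tr: "tracked k"
  shows "(pnorm p (x i (Suc k) - xh i k))\<^sup>2 \<le> (1 - 2 * \<epsilon>\<^sub>8 P) * ((rad P)\<^sup>2 * (s k)\<^sup>2)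
    + \<alpha>\<^sup>2 * (\<psi>\<^sub>3 P * comp_err k + \<psi>\<^sub>4 P * Lyap k)"
proof -
  define t where "t = 1 - \<omega> P * scale P * \<delta> P"
  define A where "A = pnorm p (x i k - xh i k)"
  define B where "B = pnorm p (x i (Suc k) - x i k)"
  define e where "e = \<epsilon>\<^sub>5 P"
  define M where "M = max ((\<beta> P)\<^sup>2 * (\<rho> P)\<^sup>2 + (lip P)\<^sup>2) ((\<gamma> P)\<^sup>2 * \<rho> P)"
  define Mv where "Mv = (\<Sum>i<n. (norm2 (x i (Suc k) - x i k))\<^sup>2)"
  have e: "e > 0" unfolding e_def using eps5 by simp
  have cc: "x i k - xh i k \<in> carrier_vec d" "x i (Suc k) - x i k \<in> carrier_vec d" using i by auto
  have A0: "A \<ge> 0" and B0: "B \<ge> 0" unfolding A_def B_def using i d by (auto intro!: pnorm_nonneg)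
  have A2: "A\<^sup>2 \<le> (1 - 2 * e) * ((rad P)\<^sup>2 * (s k)\<^sup>2)"
  proof -
    have "A \<le> t * (rad P * s k)" unfolding A_def t_def
      using compression_contracts[OF i] tr i unfolding tracked_def by auto
    then have "A\<^sup>2 \<le> (t * (rad P * s k))\<^sup>2" using A0 by (intro power_mono) auto
    also have "\<dots> = t\<^sup>2 * ((rad P)\<^sup>2 * (s k)\<^sup>2)" by (simp add: power_mult_distrib)
    also have "\<dots> \<le> (1 - 2 * e) * ((rad P)\<^sup>2 * (s k)\<^sup>2)"
      unfolding t_def e_def using eps5(3) by (intro mult_right_mono) auto
    finally show ?thesis .
  qed
  have B2: "B\<^sup>2 \<le> (dh P)\<^sup>2 * Mv"
  proof -
    have "B \<le> dh P * norm2 (x i (Suc k) - x i k)"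
      unfolding B_def dh by (rule pnorm_le_d_hat_norm2[OF cc(2) d p])
    then have "B\<^sup>2 \<le> (dh P * norm2 (x i (Suc k) - x i k))\<^sup>2" using B0 by (intro power_mono) auto
    also have "\<dots> = (dh P)\<^sup>2 * (norm2 (x i (Suc k) - x i k))\<^sup>2" by (simp add: power_mult_distrib)
    \<comment> \<open>A single agent is bounded by all agents together, since the estimate of the
      movement only sees the sum.\<close>
    also have "\<dots> \<le> (dh P)\<^sup>2 * Mv" unfolding Mv_def using i
      by (intro mult_left_mono member_le_sum[where f = "\<lambda>i. (norm2 (x i (Suc k) - x i k))\<^sup>2"]) auto
    finally show ?thesis .
  qed
  have Mv: "Mv \<le> 4 * \<alpha>\<^sup>2 * ((\<beta> P)\<^sup>2 * (\<rho> P)\<^sup>2 * comp_err k + M * (Lyap k / \<epsilon>\<^sub>1 P))"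
  proof -
    have "\<epsilon>\<^sub>1 P * energy k \<le> Lyap k" using energy_le[of k] gap_nonneg[of k] by linarith
    then have "energy k \<le> Lyap k / \<epsilon>\<^sub>1 P" using eps1 by (simp add: pos_le_divide_eq mult.commute)
    moreover have "M \<ge> 0" unfolding M_def by (simp add: le_max_iff_disj)
    ultimately have "4 * \<alpha>\<^sup>2 * ((\<beta> P)\<^sup>2 * (\<rho> P)\<^sup>2 * comp_err k + M * energy k)
        \<le> 4 * \<alpha>\<^sup>2 * ((\<beta> P)\<^sup>2 * (\<rho> P)\<^sup>2 * comp_err k + M * (Lyap k / \<epsilon>\<^sub>1 P))"
      by (intro mult_left_mono add_mono) auto
    then show ?thesis using movement_le[of k] unfolding Mv_def M_def by linarith
  qed
  have "x i (Suc k) - xh i k = (x i k - xh i k) + (x i (Suc k) - x i k)"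
    using i carriers[OF i, of k] carriers[OF i, of "Suc k"] by (intro eq_vecI) auto
  then have "pnorm p (x i (Suc k) - xh i k) \<le> A + B"
    unfolding A_def B_def using pnorm_triangle[OF cc d p] by simp
  moreover have "pnorm p (x i (Suc k) - xh i k) \<ge> 0" using i d by (intro pnorm_nonneg) simp
  ultimately have "(pnorm p (x i (Suc k) - xh i k))\<^sup>2 \<le> (A + B)\<^sup>2" by (intro power_mono) auto
  \<comment> \<open>The weight \<open>\<epsilon>\<^sub>5\<close> leaves the contraction
    \<open>1 - 2 * \<epsilon>\<^sub>8 P\<close> and puts \<open>1 + 1 / \<epsilon>\<^sub>5 P\<close>
    into \<open>\<psi>\<^sub>3\<close> and \<open>\<psi>\<^sub>4\<close>.\<close>
  also have "\<dots> \<le> (1 + e) * A\<^sup>2 + (1 + 1 / e) * B\<^sup>2"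
    using young[of e "1 / e" 2 A B] e by (simp add: power2_eq_square algebra_simps)
  also have "\<dots> \<le> (1 + e) * ((1 - 2 * e) * ((rad P)\<^sup>2 * (s k)\<^sup>2))
      + (1 + 1 / e) * ((dh P)\<^sup>2 * (4 * \<alpha>\<^sup>2 * ((\<beta> P)\<^sup>2 * (\<rho> P)\<^sup>2 * comp_err k + M * (Lyap k / \<epsilon>\<^sub>1 P))))"
    using e A2 order_trans[OF B2 mult_left_mono[OF Mv]] by (intro add_mono mult_left_mono) auto
  also have "(1 + e) * ((1 - 2 * e) * ((rad P)\<^sup>2 * (s k)\<^sup>2)) = (1 - 2 * \<epsilon>\<^sub>8 P) * ((rad P)\<^sup>2 * (s k)\<^sup>2)"
    unfolding e_def eps8(3)[symmetric] by simp
  also have "(1 + 1 / e) * ((dh P)\<^sup>2 * (4 * \<alpha>\<^sup>2 * ((\<beta> P)\<^sup>2 * (\<rho> P)\<^sup>2 * comp_err k + M * (Lyap k / \<epsilon>\<^sub>1 P))))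
      = \<alpha>\<^sup>2 * (\<psi>\<^sub>3 P * comp_err k + \<psi>\<^sub>4 P * Lyap k)"
    unfolding \<psi>\<^sub>3_def \<psi>\<^sub>4_def e_def M_def[symmetric] by (simp add: algebra_simps)
  finally show ?thesis .
qed

end

text \<open>The form of the step size makes the two products exactly 1; every later cancellation of
  n, T and dt goes back to them.\<close>

lemma step_size_sq:
  assumes "n > 0" "T > 0" "dt > 0"
  shows "(step_size n dt T)\<^sup>2 * (sqrt (real n) * dt\<^sup>2 * real T) = 1" "step_size n dt T > 0"
    "step_size n dt T * real T * (real n powr (1 / 4) * dt / sqrt (real T)) = 1"
proof -
  have n4: "(real n powr (1 / 4))\<^sup>2 = sqrt (real n)"
    using assms by (simp add: powr_power powr_half_sqrt)
  have p4: "real n powr (1 / 4) > 0" using assms by simp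
  show "(step_size n dt T)\<^sup>2 * (sqrt (real n) * dt\<^sup>2 * real T) = 1"
    unfolding step_size_def using assms n4 by (simp add: power_divide power_mult_distrib)
  show "step_size n dt T > 0" unfolding step_size_def using assms by simp
  have "sqrt (real T) * sqrt (real T) = real T" by simp
  then show "step_size n dt T * real T * (real n powr (1 / 4) * dt / sqrt (real T)) = 1"
    unfolding step_size_def using assms p4 by (simp add: field_simps)
qed

text \<open>
  The constants below depend on the parameters only: \<open>\<psi>\<^sub>2\<close> is taken at the upper bound \<open>\<kappa>\<^sub>7\<close> of \<open>\<alpha>\<close>, and
  the factors \<open>(1 + \<dots>) / 2\<close> come from \<open>u \<le> (1 + u\<^sup>2) / 2\<close>, where the entries of \<open>\<kappa>\<^sub>3_tilde\<close> bound \<open>u\<^sup>2\<close>.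
\<close>

definition schedule_const :: "params \<Rightarrow> real" where
  "schedule_const P = \<psi>\<^sub>4 P * lyap0 P / (rad P)\<^sup>2 * ((1 + \<epsilon>\<^sub>8 P / \<psi>\<^sub>3 P) / 2) + \<psi>\<^sub>2 P (\<kappa>\<^sub>7 P) * \<psi>\<^sub>4 P * (s\<^sub>0 P)\<^sup>2"

definition compression_const :: "params \<Rightarrow> real" where
  "compression_const P = \<psi>\<^sub>2 P (\<kappa>\<^sub>7 P) * (rad P)\<^sup>2 / \<epsilon>\<^sub>8 P * ((1 + 1 / kh P) / 2 * (s\<^sub>0 P)\<^sup>2 + schedule_const P)"

definition lyapunov_const :: "params \<Rightarrow> real" where
  "lyapunov_const P = lyap0 P + compression_const P"

section \<open>The scaling schedule over a fixed horizon\<close>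

locale compression_schedule = compression_run +
  fixes T :: nat and dt L10 :: real
  assumes T: "T > 0" and \<alpha>: "\<alpha> = step_size n dt T" and dt: "dt = d_tilde d p"
    and L10: "L10 = lyapunov n d U lam f (\<beta> P) (\<gamma> P) (\<lambda>i. x i 0) (\<lambda>i. v i 0)"
    and lyap0: "lyap0 P = L10 / real n"
    and T_large: "real T > \<kappa>\<^sub>3_tilde P n dt L10 \<alpha>"
    and s_0: "s 0 = s\<^sub>0 P"
    and s_init: "s\<^sub>0 P \<ge> Max ((\<lambda>i. pnorm p (x i 0)) ` {..<n}) / rad P"
    and s_rec: "\<And>k. k \<in> {1..T} \<Longrightarrow>
      (s k)\<^sup>2 = (1 - \<epsilon>\<^sub>8 P) * (s (k - 1))\<^sup>2 + \<kappa>\<^sub>4_tilde P n dt L10 \<alpha> T"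
begin

definition "rn = sqrt (real n)"
abbreviation "\<theta> \<equiv> 1 - 2 * \<epsilon>\<^sub>5 P"
abbreviation "\<kappa>4 \<equiv> \<kappa>\<^sub>4_tilde P n dt L10 \<alpha> T"

lemma dt_ge: "dt \<ge> 1" unfolding dt using d_tilde_ge_1[OF d] .

lemma rn: "rn > 0" "rn * rn = real n" "rn \<ge> 1" unfolding rn_def using n by auto

lemma theta: "0 \<le> \<theta>" "\<theta> \<le> 1" using eps5 by auto

lemma step_sq: "\<alpha>\<^sup>2 * (rn * dt\<^sup>2 * real T) = 1"
  unfolding \<alpha> rn_def using step_size_sq(1)[OF n_pos(1) T] dt_ge by simp

lemma L10_Lyap: "L10 = Lyap 0" unfolding L10 Lyap_def ..

lemma L10_nonneg: "L10 \<ge> 0" and lyap0_nonneg: "lyap0 P \<ge> 0"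
proof -
  have "energy 0 \<ge> 0" using cons_err_le_energy[of 0] by linarith
  then have "\<epsilon>\<^sub>1 P * energy 0 \<ge> 0" using eps1(1) by simp
  then show "L10 \<ge> 0" unfolding L10_Lyap using energy_le[of 0] gap_nonneg[of 0] by linarith
  then show "lyap0 P \<ge> 0" unfolding lyap0 by simp
qed

text \<open>These entries pay for the contraction budget, the two summands of
  \<open>\<kappa>\<^sub>4_tilde\<close> and the size of \<alpha> * dt^2. The first entry is what
  yields the bound \<open>\<kappa>\<^sub>7\<close> on \<alpha>.\<close>

lemma T_bounds:
  "\<theta> * \<psi>\<^sub>3 P / \<epsilon>\<^sub>8 P * rn < real T"
  "2 * \<psi>\<^sub>4 P * L10 / (\<epsilon>\<^sub>8 P * (rad P)\<^sup>2 * (s\<^sub>0 P)\<^sup>2 * real n) * (rn / dt\<^sup>2) < real T"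
  "4 * \<theta>\<^sup>2 * (\<psi>\<^sub>2 P \<alpha>)\<^sup>2 * (\<psi>\<^sub>4 P)\<^sup>2 / (\<epsilon>\<^sub>8 P)\<^sup>2 * (rn / dt\<^sup>2) < real T"
  "kh P * dt\<^sup>2 / rn < real T"
  using T_large unfolding \<kappa>\<^sub>3_tilde_def rn_def by (simp_all add: Max_less_iff)

text \<open>By the normalization, \<alpha>^2 * n * dt^2 equals rn / T, which the second entry of
  \<open>\<kappa>\<^sub>3_tilde\<close> bounds. This spends one of the two
  \<open>\<epsilon>\<^sub>8\<close> in the contraction margin.\<close>

lemma compression_error_budget: "\<alpha>\<^sup>2 * \<psi>\<^sub>3 P * (real n * dt\<^sup>2 * \<theta>) \<le> \<epsilon>\<^sub>8 P"
proof -
  have "\<theta> * \<psi>\<^sub>3 P * rn \<le> \<epsilon>\<^sub>8 P * real T" using T_bounds(1) eps8(1) by (simp add: field_simps)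
  then have "\<alpha>\<^sup>2 * (rn * dt\<^sup>2) * (\<theta> * \<psi>\<^sub>3 P * rn) \<le> \<alpha>\<^sup>2 * (rn * dt\<^sup>2) * (\<epsilon>\<^sub>8 P * real T)"
    using rn(1) by (intro mult_left_mono) auto
  also have "\<dots> = \<epsilon>\<^sub>8 P * (\<alpha>\<^sup>2 * (rn * dt\<^sup>2 * real T))" by simp
  also have "\<dots> = \<epsilon>\<^sub>8 P" unfolding step_sq by simp
  also have "\<alpha>\<^sup>2 * (rn * dt\<^sup>2) * (\<theta> * \<psi>\<^sub>3 P * rn) = \<alpha>\<^sup>2 * \<psi>\<^sub>3 P * ((rn * rn) * dt\<^sup>2 * \<theta>)" by (simp only: ac_simps)
  finally show ?thesis unfolding rn(2) .
qed

lemma alpha_rn: "real n * dt\<^sup>2 * \<alpha>^3 * real T = \<alpha> * rn"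
proof -
  have "real n * dt\<^sup>2 * \<alpha>^3 * real T = \<alpha> * rn * (\<alpha>\<^sup>2 * (rn * dt\<^sup>2 * real T))"
    unfolding rn(2)[symmetric] by (simp only: power3_eq_cube power2_eq_square ac_simps)
  then show ?thesis unfolding step_sq by simp
qed

lemma kappa4_nonneg: "\<kappa>4 \<ge> 0"
  unfolding \<kappa>\<^sub>4_tilde_def using psi4_pos psi2_pos[of \<alpha>] L10_nonneg \<alpha>_pos theta
  by (intro add_nonneg_nonneg mult_nonneg_nonneg divide_nonneg_nonneg) auto

text \<open>Each summand uses up half of the bound. Equality would make the initial scaling a fixed
  point of the recursion, so s never exceeds its initial value.\<close>

lemma kappa4_le: "\<kappa>4 \<le> \<epsilon>\<^sub>8 P * (s\<^sub>0 P)\<^sup>2"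
proof -
  have "\<psi>\<^sub>4 P * L10 * \<alpha>\<^sup>2 / (rad P)\<^sup>2 \<le> \<epsilon>\<^sub>8 P * (s\<^sub>0 P)\<^sup>2 / 2"
  proof -
    define D where "D = \<epsilon>\<^sub>8 P * (rad P)\<^sup>2 * (s\<^sub>0 P)\<^sup>2"
    have D: "D > 0" unfolding D_def using eps8 rad_pos s0_pos by simp
    have dt0: "dt > 0" using dt_ge by simp
    have "2 * \<psi>\<^sub>4 P * L10 / (D * real n) * (rn / dt\<^sup>2) = 2 * \<psi>\<^sub>4 P * L10 / (D * rn * dt\<^sup>2)"
      unfolding rn(2)[symmetric] using D rn(1) dt0 by (simp add: divide_simps)
    then have "2 * \<psi>\<^sub>4 P * L10 / (D * rn * dt\<^sup>2) \<le> real T"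
      using T_bounds(2) unfolding D_def[symmetric] by simp
    then have "2 * \<psi>\<^sub>4 P * L10 \<le> real T * (D * rn * dt\<^sup>2)" using D rn(1) dt0 by (simp add: pos_divide_le_eq)
    then have "\<alpha>\<^sup>2 * (2 * \<psi>\<^sub>4 P * L10) \<le> \<alpha>\<^sup>2 * (real T * (D * rn * dt\<^sup>2))" by (intro mult_left_mono) auto
    also have "\<dots> = D * (\<alpha>\<^sup>2 * (rn * dt\<^sup>2 * real T))" by (simp only: ac_simps)
    also have "\<dots> = D" unfolding step_sq by simp
    finally show ?thesis unfolding D_def using rad_pos by (simp add: field_simps)
  qed
  moreover have "\<theta> * \<psi>\<^sub>2 P \<alpha> * \<psi>\<^sub>4 P * real n * dt\<^sup>2 * (s\<^sub>0 P)\<^sup>2 * \<alpha>^3 * real T \<le> \<epsilon>\<^sub>8 P * (s\<^sub>0 P)\<^sup>2 / 2"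
  proof -
    define q where "q = \<theta> * \<psi>\<^sub>2 P \<alpha> * \<psi>\<^sub>4 P"
    have q0: "q \<ge> 0" unfolding q_def using theta psi2_pos[of \<alpha>] psi4_pos \<alpha>_pos by simp
    have dt0: "dt > 0" using dt_ge by simp
    have "4 * q\<^sup>2 / (\<epsilon>\<^sub>8 P)\<^sup>2 * (rn / dt\<^sup>2) \<le> real T"
      using T_bounds(3) unfolding q_def by (simp add: power_mult_distrib)
    then have "4 * q\<^sup>2 * rn \<le> (\<epsilon>\<^sub>8 P)\<^sup>2 * (dt\<^sup>2 * real T)" using eps8(1) dt0 by (simp add: field_simps)
    then have "(\<alpha>\<^sup>2 * rn) * (4 * q\<^sup>2 * rn) \<le> (\<alpha>\<^sup>2 * rn) * ((\<epsilon>\<^sub>8 P)\<^sup>2 * (dt\<^sup>2 * real T))"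
      using rn(1) by (intro mult_left_mono) auto
    also have "\<dots> = (\<epsilon>\<^sub>8 P)\<^sup>2 * (\<alpha>\<^sup>2 * (rn * dt\<^sup>2 * real T))" by (simp only: ac_simps)
    also have "\<dots> = (\<epsilon>\<^sub>8 P)\<^sup>2" unfolding step_sq by simp
    also have "(\<alpha>\<^sup>2 * rn) * (4 * q\<^sup>2 * rn) = (2 * (q * (\<alpha> * rn)))\<^sup>2"
      by (simp add: power2_eq_square)
    finally have "2 * (q * (\<alpha> * rn)) \<le> \<epsilon>\<^sub>8 P"
      by (rule power2_le_imp_le) (use eps8(1) in simp)
    then have "q * (\<alpha> * rn) * (s\<^sub>0 P)\<^sup>2 \<le> \<epsilon>\<^sub>8 P / 2 * (s\<^sub>0 P)\<^sup>2" by (intro mult_right_mono) auto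
    also have "q * (\<alpha> * rn) * (s\<^sub>0 P)\<^sup>2 = \<theta> * \<psi>\<^sub>2 P \<alpha> * \<psi>\<^sub>4 P * real n * dt\<^sup>2 * (s\<^sub>0 P)\<^sup>2 * \<alpha>^3 * real T"
      unfolding alpha_rn[symmetric] q_def by (simp only: ac_simps)
    finally show ?thesis by simp
  qed
  ultimately show ?thesis unfolding \<kappa>\<^sub>4_tilde_def by linarith
qed

lemma s_Suc: "k < T \<Longrightarrow> (s (Suc k))\<^sup>2 = (1 - \<epsilon>\<^sub>8 P) * (s k)\<^sup>2 + \<kappa>4"
  using s_rec[of "Suc k"] by simp

lemma s_le: "k \<le> T \<Longrightarrow> (s k)\<^sup>2 \<le> (s\<^sub>0 P)\<^sup>2"
proof (induction k)
  case (Suc k)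
  then have "(s (Suc k))\<^sup>2 \<le> (1 - \<epsilon>\<^sub>8 P) * (s\<^sub>0 P)\<^sup>2 + \<epsilon>\<^sub>8 P * (s\<^sub>0 P)\<^sup>2"
    using s_Suc[of k] kappa4_le eps8 by (intro order_trans[OF eq_refl[OF s_Suc] add_mono] mult_left_mono) auto
  then show ?case by (simp add: algebra_simps)
qed (simp add: s_0)

text \<open>The recursion expresses \<open>\<epsilon>\<^sub>8 P * (s k)^2\<close> as a difference of
  consecutive squares plus a constant; the sum telescopes and the last square is dropped.\<close>

lemma sum_s: "\<epsilon>\<^sub>8 P * (\<Sum>k<T. (s k)\<^sup>2) \<le> (s\<^sub>0 P)\<^sup>2 + real T * \<kappa>4"
proof -
  have "k \<le> T \<Longrightarrow> \<epsilon>\<^sub>8 P * (\<Sum>j<k. (s j)\<^sup>2) = (s\<^sub>0 P)\<^sup>2 - (s k)\<^sup>2 + real k * \<kappa>4" for k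
  proof (induction k)
    case (Suc k)
    then show ?case using s_Suc[of k] by (simp add: algebra_simps)
  qed (simp add: s_0)
  from this[of T] show ?thesis by simp
qed

text \<open>The coefficient of \<open>(s k)^2\<close> in the descent inequality once the compression
  error is bounded by the scaling.\<close>

definition "Q = \<alpha> * \<psi>\<^sub>2 P \<alpha> * (real n * dt\<^sup>2 * \<theta> * (rad P)\<^sup>2)"

lemma Q_nonneg: "Q \<ge> 0"
  unfolding Q_def using \<alpha>_pos psi2_pos[of \<alpha>] theta by simp

lemma tracked_0: "tracked 0"
  unfolding tracked_def
proof (intro allI impI)
  fix i assume i: "i < n"
  have "pnorm p (x i 0) \<le> Max ((\<lambda>i. pnorm p (x i 0)) ` {..<n})" using i by (intro Max_ge) auto
  also have "\<dots> \<le> rad P * s 0" using s_init rad_pos unfolding s_0 by (simp add: pos_divide_le_eq mult.commute)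
  \<comment> \<open>The estimate xh with index -1 is zero, so the first input is the initial point
    itself.\<close>
  also have "x i 0 = x i 0 - prev d (xh i) 0" using run_eqs(1)[OF i] by auto
  finally show "pnorm p (x i 0 - prev d (xh i) 0) \<le> rad P * s 0" .
qed

lemma descent_tracked:
  assumes "tracked k"
  shows "Lyap (Suc k) + \<alpha> * (\<phi>\<^sub>1 P - \<alpha> * \<phi>\<^sub>2 P) * cons_err k + \<alpha> / 4 * (real n * grad_sq k)
    \<le> Lyap k + Q * (s k)\<^sup>2"
proof -
  have "\<alpha> * \<psi>\<^sub>2 P \<alpha> * comp_err k
      \<le> \<alpha> * \<psi>\<^sub>2 P \<alpha> * (real n * (d_tilde d p)\<^sup>2 * \<theta> * (rad P)\<^sup>2 * (s k)\<^sup>2)"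
    using comp_err_le[OF assms] \<alpha>_pos psi2_pos[of \<alpha>] by (intro mult_left_mono) auto
  also have "\<dots> = Q * (s k)\<^sup>2" unfolding Q_def unfolding dt by (simp only: ac_simps)
  finally show ?thesis using Lyap_descent[of k] by linarith
qed

lemma descent_terms_nonneg:
  "0 \<le> \<alpha> * (\<phi>\<^sub>1 P - \<alpha> * \<phi>\<^sub>2 P) * cons_err k" "0 \<le> \<alpha> / 4 * (real n * grad_sq k)"
  using \<alpha>_pos kappa7_coeffs(1)[OF \<alpha>_le] cons_err_le_energy(1)[of k] unfolding grad_sq_def by auto

text \<open>The claims need each other: the Lyapunov bound at k + 1 uses tracking at k, and tracking
  at k + 1 uses the Lyapunov bound at k.\<close>

lemma invariant:
  "k \<le> T \<Longrightarrow> tracked k \<and> Lyap k \<le> L10 + Q * (\<Sum>j<k. (s j)\<^sup>2)"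
proof (induction k)
  case 0
  then show ?case using tracked_0 by (simp add: L10_Lyap)
next
  case (Suc k)
  then have tr: "tracked k" and Lk: "Lyap k \<le> L10 + Q * (\<Sum>j<k. (s j)\<^sup>2)" and k: "k < T" by auto
  have Ls: "Lyap (Suc k) \<le> L10 + Q * (\<Sum>j<Suc k. (s j)\<^sup>2)"
    using Lk descent_tracked[OF tr] descent_terms_nonneg[of k] by (simp add: distrib_left)
  \<comment> \<open>The bound is made independent of k: each s j is at most the initial scaling and
    k is at most T.\<close>
  have "(\<Sum>j<k. (s j)\<^sup>2) \<le> (\<Sum>j<k. (s\<^sub>0 P)\<^sup>2)" using k by (intro sum_mono s_le) auto
  also have "\<dots> \<le> real T * (s\<^sub>0 P)\<^sup>2" using k by (simp add: mult_right_mono)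
  finally have "Q * (\<Sum>j<k. (s j)\<^sup>2) \<le> Q * (real T * (s\<^sub>0 P)\<^sup>2)" using Q_nonneg by (intro mult_left_mono)
  then have LT: "Lyap k \<le> L10 + Q * (real T * (s\<^sub>0 P)\<^sup>2)" using Lk by linarith
  \<comment> \<open>The schedule is designed for this equality: its increment is the uniform
    Lyapunov bound, scaled as it enters the tracking error.\<close>
  have k4: "\<alpha>\<^sup>2 * \<psi>\<^sub>4 P * (L10 + Q * (real T * (s\<^sub>0 P)\<^sup>2)) = (rad P)\<^sup>2 * \<kappa>4"
    unfolding \<kappa>\<^sub>4_tilde_def Q_def using rad_pos by (simp add: field_simps power2_eq_square power3_eq_cube)
  have "pnorm p (x i (Suc k) - xh i k) \<le> rad P * s (Suc k)" if i: "i < n" for i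
  proof -
    have "(pnorm p (x i (Suc k) - xh i k))\<^sup>2 \<le> (1 - 2 * \<epsilon>\<^sub>8 P) * ((rad P)\<^sup>2 * (s k)\<^sup>2)
        + \<alpha>\<^sup>2 * \<psi>\<^sub>3 P * comp_err k + \<alpha>\<^sup>2 * \<psi>\<^sub>4 P * Lyap k"
      using tracking_error_step[OF i tr] by (simp add: algebra_simps)
    also have "\<alpha>\<^sup>2 * \<psi>\<^sub>3 P * comp_err k \<le> \<epsilon>\<^sub>8 P * ((rad P)\<^sup>2 * (s k)\<^sup>2)"
    proof -
      have "\<alpha>\<^sup>2 * \<psi>\<^sub>3 P * comp_err k \<le> \<alpha>\<^sup>2 * \<psi>\<^sub>3 P * (real n * dt\<^sup>2 * \<theta> * (rad P)\<^sup>2 * (s k)\<^sup>2)"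
        unfolding dt using comp_err_le[OF tr] psi3_pos by (intro mult_left_mono) auto
      also have "\<dots> = \<alpha>\<^sup>2 * \<psi>\<^sub>3 P * (real n * dt\<^sup>2 * \<theta>) * ((rad P)\<^sup>2 * (s k)\<^sup>2)" by (simp only: ac_simps)
      also have "\<dots> \<le> \<epsilon>\<^sub>8 P * ((rad P)\<^sup>2 * (s k)\<^sup>2)"
        using compression_error_budget by (intro mult_right_mono) auto
      finally show ?thesis .
    qed
    also have "\<alpha>\<^sup>2 * \<psi>\<^sub>4 P * Lyap k \<le> (rad P)\<^sup>2 * \<kappa>4"
      unfolding k4[symmetric] using LT psi4_pos by (intro mult_left_mono) auto
    finally have "(pnorm p (x i (Suc k) - xh i k))\<^sup>2
        \<le> (1 - 2 * \<epsilon>\<^sub>8 P) * ((rad P)\<^sup>2 * (s k)\<^sup>2) + \<epsilon>\<^sub>8 P * ((rad P)\<^sup>2 * (s k)\<^sup>2) + (rad P)\<^sup>2 * \<kappa>4"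
      by simp
    \<comment> \<open>The margins add up to \<open>1 - \<epsilon>\<^sub>8 P\<close>, the factor in
      the recursion of s.\<close>
    also have "\<dots> = (rad P * s (Suc k))\<^sup>2"
      unfolding power_mult_distrib s_Suc[OF k] by (simp add: algebra_simps)
    finally show ?thesis by (rule power2_le_imp_le) (use rad_pos s_pos[of "Suc k"] in simp)
  qed
  then show ?case using Ls unfolding tracked_def by simp
qed


text \<open>Together with the normalization, the last entry of \<open>\<kappa>\<^sub>3_tilde\<close>
  bounds the square of \<alpha> * dt^2 by 1 / kh.\<close>

lemma alpha_dt_le: "\<alpha> * dt\<^sup>2 \<le> (1 + 1 / kh P) / 2"
proof -
  have dt0: "dt > 0" using dt_ge by simp
  have "kh P * dt\<^sup>2 \<le> real T * rn" using T_bounds(4) rn(1) by (simp add: pos_divide_less_eq)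
  then have "(\<alpha>\<^sup>2 * dt\<^sup>2) * (kh P * dt\<^sup>2) \<le> (\<alpha>\<^sup>2 * dt\<^sup>2) * (real T * rn)" by (intro mult_left_mono) auto
  also have "\<dots> = \<alpha>\<^sup>2 * (rn * dt\<^sup>2 * real T)" by (simp only: ac_simps)
  finally have "kh P * (\<alpha> * dt\<^sup>2)\<^sup>2 \<le> 1" unfolding step_sq by (simp add: power2_eq_square algebra_simps)
  then have "(\<alpha> * dt\<^sup>2)\<^sup>2 \<le> 1 / kh P" using kh_pos by (simp add: pos_le_divide_eq mult.commute)
  then show ?thesis using zero_le_power2[of "\<alpha> * dt\<^sup>2 - 1"] by (simp add: power2_eq_square algebra_simps)
qed

text \<open>The available bound is on \<theta> * (\<alpha> * rn)^2 with a single factor \<theta>, so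
  \<theta> stays outside the square and is estimated by 1 only afterwards. This avoids dividing by
  \<theta>, which may be zero.\<close>

lemma theta_alpha_rn_le: "\<theta> * (\<alpha> * rn) \<le> (1 + \<epsilon>\<^sub>8 P / \<psi>\<^sub>3 P) / 2"
proof -
  have "\<theta> * \<psi>\<^sub>3 P * rn \<le> \<epsilon>\<^sub>8 P * real T" using T_bounds(1) eps8(1) by (simp add: field_simps)
  then have "\<theta> * rn \<le> \<epsilon>\<^sub>8 P / \<psi>\<^sub>3 P * real T" using psi3_pos by (simp add: field_simps)
  then have "(\<alpha>\<^sup>2 * rn) * (\<theta> * rn) \<le> (\<alpha>\<^sup>2 * rn) * (\<epsilon>\<^sub>8 P / \<psi>\<^sub>3 P * real T)" using rn(1) by (intro mult_left_mono) auto
  also have "\<dots> \<le> (\<alpha>\<^sup>2 * rn) * (\<epsilon>\<^sub>8 P / \<psi>\<^sub>3 P * real T) * dt\<^sup>2"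
  proof -
    have "1 \<le> dt\<^sup>2" using dt_ge by simp
    moreover have "0 \<le> (\<alpha>\<^sup>2 * rn) * (\<epsilon>\<^sub>8 P / \<psi>\<^sub>3 P * real T)" using rn(1) eps8(1) psi3_pos by simp
    ultimately show ?thesis using mult_left_mono by fastforce
  qed
  also have "\<dots> = \<epsilon>\<^sub>8 P / \<psi>\<^sub>3 P * (\<alpha>\<^sup>2 * (rn * dt\<^sup>2 * real T))" by (simp only: ac_simps)
  also have "\<dots> = \<epsilon>\<^sub>8 P / \<psi>\<^sub>3 P" unfolding step_sq by simp
  finally have "\<theta> * (\<alpha> * rn)\<^sup>2 \<le> \<epsilon>\<^sub>8 P / \<psi>\<^sub>3 P" by (simp add: power2_eq_square algebra_simps)
  moreover have "0 \<le> \<theta> * (\<alpha> * rn - 1)\<^sup>2" using theta by simp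
  then have "\<theta> * (\<alpha> * rn) * 2 \<le> \<theta> + \<theta> * (\<alpha> * rn)\<^sup>2" by (simp add: power2_eq_square algebra_simps)
  moreover have "A \<le> (1 + E) / 2" if "B \<le> E" "A * 2 \<le> t + B" "t \<le> 1" for A B E t :: real
    using that by simp
  ultimately show ?thesis using theta(2) by blast
qed

lemma psi2_le: "\<psi>\<^sub>2 P \<alpha> \<le> \<psi>\<^sub>2 P (\<kappa>\<^sub>7 P)" using psi2_mono[OF \<alpha>_le] .

text \<open>In the first summand the powers combine to \<theta> * (\<alpha> * rn), already bounded;
  in the second they combine to the normalized product and disappear.\<close>

lemma kappa4_scaled: "\<alpha> * real T * dt\<^sup>2 * \<theta> * \<kappa>4 \<le> schedule_const P"
proof -
  have L: "L10 = real n * lyap0 P" unfolding lyap0 by simp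
  have "\<alpha> * real T * dt\<^sup>2 * \<theta> * \<kappa>4
      = \<psi>\<^sub>4 P * lyap0 P / (rad P)\<^sup>2 * (\<theta> * (real n * dt\<^sup>2 * \<alpha>^3 * real T))
        + \<theta>\<^sup>2 * \<psi>\<^sub>2 P \<alpha> * \<psi>\<^sub>4 P * (s\<^sub>0 P)\<^sup>2 * (dt\<^sup>2 * (real n * dt\<^sup>2 * \<alpha>^3 * real T) * \<alpha> * real T)"
    unfolding \<kappa>\<^sub>4_tilde_def L
    by (simp add: distrib_left power2_eq_square power3_eq_cube ac_simps)
  also have "dt\<^sup>2 * (real n * dt\<^sup>2 * \<alpha>^3 * real T) * \<alpha> * real T = \<alpha>\<^sup>2 * (rn * dt\<^sup>2 * real T)"
    unfolding alpha_rn by (simp add: power2_eq_square)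
  also have "\<dots> = 1" by (rule step_sq)
  also have "real n * dt\<^sup>2 * \<alpha>^3 * real T = \<alpha> * rn" by (rule alpha_rn)
  also have "\<psi>\<^sub>4 P * lyap0 P / (rad P)\<^sup>2 * (\<theta> * (\<alpha> * rn)) + \<theta>\<^sup>2 * \<psi>\<^sub>2 P \<alpha> * \<psi>\<^sub>4 P * (s\<^sub>0 P)\<^sup>2 * 1 \<le> schedule_const P"
  proof -
    have "\<theta>\<^sup>2 * \<psi>\<^sub>2 P \<alpha> \<le> 1 * \<psi>\<^sub>2 P (\<kappa>\<^sub>7 P)"
      using theta psi2_le psi2_pos[of \<alpha>] \<alpha>_pos by (intro mult_mono) (auto simp: power_le_one)
    then have "\<theta>\<^sup>2 * \<psi>\<^sub>2 P \<alpha> * (\<psi>\<^sub>4 P * (s\<^sub>0 P)\<^sup>2) \<le> 1 * \<psi>\<^sub>2 P (\<kappa>\<^sub>7 P) * (\<psi>\<^sub>4 P * (s\<^sub>0 P)\<^sup>2)"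
      using psi4_pos by (intro mult_right_mono) auto
    moreover have "\<psi>\<^sub>4 P * lyap0 P / (rad P)\<^sup>2 * (\<theta> * (\<alpha> * rn))
        \<le> \<psi>\<^sub>4 P * lyap0 P / (rad P)\<^sup>2 * ((1 + \<epsilon>\<^sub>8 P / \<psi>\<^sub>3 P) / 2)"
      using theta_alpha_rn_le psi4_pos lyap0_nonneg by (intro mult_left_mono) auto
    ultimately show ?thesis unfolding schedule_const_def by (simp add: mult.assoc)
  qed
  finally show ?thesis .
qed

text \<open>The compression error accumulated over the horizon is of order n, like the initial
  Lyapunov value; division by n thus leaves a constant of P alone.\<close>

lemma Q_sum_le: "Q * (\<Sum>k<T. (s k)\<^sup>2) \<le> real n * compression_const P"
proof -
  have "(\<Sum>k<T. (s k)\<^sup>2) \<le> ((s\<^sub>0 P)\<^sup>2 + real T * \<kappa>4) / \<epsilon>\<^sub>8 P"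
    using sum_s eps8(1) by (simp add: pos_le_divide_eq mult.commute)
  then have "Q * (\<Sum>k<T. (s k)\<^sup>2) \<le> Q * (((s\<^sub>0 P)\<^sup>2 + real T * \<kappa>4) / \<epsilon>\<^sub>8 P)"
    using Q_nonneg by (intro mult_left_mono)
  also have "\<dots> = real n * (\<psi>\<^sub>2 P \<alpha> * (rad P)\<^sup>2 / \<epsilon>\<^sub>8 P
      * (\<theta> * (\<alpha> * dt\<^sup>2) * (s\<^sub>0 P)\<^sup>2 + \<alpha> * real T * dt\<^sup>2 * \<theta> * \<kappa>4))"
    unfolding Q_def by (simp add: distrib_left add_divide_distrib ac_simps)
  also have "\<dots> \<le> real n * compression_const P"
    unfolding compression_const_def
  proof (intro mult_left_mono mult_mono divide_right_mono mult_right_mono add_mono kappa4_scaled psi2_le)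
    have "\<theta> * (\<alpha> * dt\<^sup>2) \<le> 1 * (\<alpha> * dt\<^sup>2)" using theta(2) \<alpha>_pos by (intro mult_right_mono) auto
    then show "\<theta> * (\<alpha> * dt\<^sup>2) \<le> (1 + 1 / kh P) / 2" using alpha_dt_le by linarith
    show "0 \<le> \<theta> * (\<alpha> * dt\<^sup>2) * (s\<^sub>0 P)\<^sup>2 + \<alpha> * real T * dt\<^sup>2 * \<theta> * \<kappa>4"
      using theta \<alpha>_pos kappa4_nonneg by (intro add_nonneg_nonneg mult_nonneg_nonneg) auto
    show "0 \<le> \<psi>\<^sub>2 P (\<kappa>\<^sub>7 P) * (rad P)\<^sup>2 / \<epsilon>\<^sub>8 P"
      using psi2_pos[of "\<kappa>\<^sub>7 P"] kappa7_pos eps8(1) by simp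
  qed (use eps8(1) kh_pos kappa7_pos psi2_pos[of "\<kappa>\<^sub>7 P"] in auto)
  finally show ?thesis .
qed


lemma Lyap_le: "k \<le> T \<Longrightarrow> Lyap k \<le> real n * lyapunov_const P"
proof -
  assume k: "k \<le> T"
  have "(\<Sum>j<k. (s j)\<^sup>2) \<le> (\<Sum>j<T. (s j)\<^sup>2)" using k by (intro sum_mono2) auto
  then have "Q * (\<Sum>j<k. (s j)\<^sup>2) \<le> Q * (\<Sum>j<T. (s j)\<^sup>2)" using Q_nonneg by (intro mult_left_mono)
  then have "Lyap k \<le> L10 + real n * compression_const P" using invariant[OF k] Q_sum_le by linarith
  then show ?thesis unfolding lyapunov_const_def lyap0 by (simp add: distrib_left)
qed

lemma Lyap_nonneg: "0 \<le> Lyap k"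
proof -
  have "energy k \<ge> 0" using cons_err_le_energy[of k] by linarith
  then have "\<epsilon>\<^sub>1 P * energy k \<ge> 0" using eps1(1) by simp
  then show ?thesis using energy_le[of k] gap_nonneg[of k] by linarith
qed

lemma lyapunov_const_nonneg: "lyapunov_const P \<ge> 0"
  using Lyap_le[of 0] Lyap_nonneg[of 0] n_pos(2) by (metis le0 mult_less_0_iff not_less order_trans)

section \<open>The averaged stationarity measure and its rate\<close>

definition "rate = real n powr (1 / 4) * dt / sqrt (real T)"
definition "avg = (1 / real T) * (\<Sum>k<T. grad_sq k + (1 / real n) * cons_err k)"

text \<open>The last part rests on rn * dt^2 >= 1; it turns a lower bound on the step size into one
  on the rate.\<close>

lemma rate: "\<alpha> * real T * rate = 1" "rate > 0" "rate \<ge> \<alpha>"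
proof -
  have dt0: "dt > 0" using dt_ge by simp
  show r: "\<alpha> * real T * rate = 1" unfolding rate_def \<alpha> by (rule step_size_sq(3)[OF n_pos(1) T dt0])
  show "rate > 0" unfolding rate_def using dt0 T n by simp
  have "\<alpha> * real T * \<alpha> \<le> \<alpha>\<^sup>2 * (rn * dt\<^sup>2 * real T)"
  proof -
    have "1 * 1 \<le> rn * dt\<^sup>2" using rn(3) dt_ge by (intro mult_mono) auto
    then have "\<alpha>\<^sup>2 * real T * (1 * 1) \<le> \<alpha>\<^sup>2 * real T * (rn * dt\<^sup>2)" by (intro mult_left_mono) auto
    then show ?thesis by (simp add: power2_eq_square ac_simps)
  qed
  then have "\<alpha> * real T * \<alpha> \<le> \<alpha> * real T * rate" unfolding step_sq r .
  then show "rate \<ge> \<alpha>" using \<alpha>_pos T by simp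
qed

lemma avg_nonneg: "avg \<ge> 0"
  unfolding avg_def grad_sq_def using cons_err_le_energy(1)
  by (intro mult_nonneg_nonneg sum_nonneg add_nonneg_nonneg) auto

text \<open>Twice the step size is still admissible, so \<open>\<alpha> * \<phi>\<^sub>2 P\<close>
  is at most half of \<open>\<phi>\<^sub>1 P\<close> and the consensus coefficient stays bounded
  below. The summed descent is then divided by \<alpha> * T, the reciprocal of the rate.\<close>

lemma avg_le_small_step:
  assumes small: "\<alpha> \<le> \<kappa>\<^sub>7 P / 2"
  shows "avg \<le> lyapunov_const P / min (\<phi>\<^sub>1 P / 2) (1 / 4) * rate"
proof -
  define c where "c = min (\<phi>\<^sub>1 P / 2) (1 / 4)"
  have c: "c > 0" "c \<le> \<phi>\<^sub>1 P / 2" "c \<le> 1 / 4" unfolding c_def using phi1_pos by auto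
  have "2 * \<alpha> * \<phi>\<^sub>2 P \<le> \<phi>\<^sub>1 P" using kappa7_coeffs(1)[of "2 * \<alpha>"] small by simp
  then have half: "\<phi>\<^sub>1 P - \<alpha> * \<phi>\<^sub>2 P \<ge> c" using c by simp
  have summand: "c * \<alpha> * real n * (grad_sq k + (1 / real n) * cons_err k)
      \<le> \<alpha> * (\<phi>\<^sub>1 P - \<alpha> * \<phi>\<^sub>2 P) * cons_err k + \<alpha> / 4 * (real n * grad_sq k)" for k
  proof -
    have "c * (\<alpha> * cons_err k) \<le> (\<phi>\<^sub>1 P - \<alpha> * \<phi>\<^sub>2 P) * (\<alpha> * cons_err k)"
      using half \<alpha>_pos cons_err_le_energy(1)[of k] by (intro mult_right_mono) auto
    moreover have "c * (\<alpha> * (real n * grad_sq k)) \<le> 1 / 4 * (\<alpha> * (real n * grad_sq k))"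
      using c \<alpha>_pos unfolding grad_sq_def by (intro mult_right_mono) auto
    moreover have "c * \<alpha> * real n * (grad_sq k + (1 / real n) * cons_err k)
        = c * (\<alpha> * (real n * grad_sq k)) + c * (\<alpha> * cons_err k)"
      using n_pos(2) by (simp add: distrib_left ac_simps del: n_pos(1))
    ultimately show ?thesis by (simp add: ac_simps)
  qed
  have "k \<le> T \<Longrightarrow> c * \<alpha> * real n * (\<Sum>j<k. grad_sq j + (1 / real n) * cons_err j) + Lyap k
      \<le> L10 + Q * (\<Sum>j<k. (s j)\<^sup>2)" for k
  proof (induction k)
    case (Suc k)
    have "tracked k" using invariant[of k] Suc.prems by simp
    then show ?case using Suc summand[of k] descent_tracked[of k] by (simp add: distrib_left)
  qed (simp add: L10_Lyap)
  from this[of T] have "c * \<alpha> * real n * (\<Sum>j<T. grad_sq j + (1 / real n) * cons_err j) \<le> L10 + real n * compression_const P"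
    using Q_sum_le Lyap_nonneg[of T] by linarith
  also have "\<dots> = real n * lyapunov_const P" unfolding lyapunov_const_def lyap0 by (simp add: distrib_left)
  finally have "c * \<alpha> * (\<Sum>j<T. grad_sq j + (1 / real n) * cons_err j) \<le> lyapunov_const P"
    using n_pos(2) by (simp add: mult.commute mult.left_commute)
  moreover have "(\<Sum>j<T. grad_sq j + (1 / real n) * cons_err j) = real T * avg" unfolding avg_def using T by simp
  ultimately have "c * (\<alpha> * real T * avg) \<le> lyapunov_const P" by (simp add: ac_simps)
  then have "rate * (c * (\<alpha> * real T * avg)) \<le> rate * lyapunov_const P" using rate(2) by (intro mult_left_mono) auto
  also have "rate * (c * (\<alpha> * real T * avg)) = c * avg * (\<alpha> * real T * rate)" by (simp only: ac_simps)
  finally have "c * avg \<le> rate * lyapunov_const P" unfolding rate(1) by simp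
  then show ?thesis using c(1) unfolding c_def[symmetric] by (simp add: pos_le_divide_eq mult.commute)
qed

text \<open>The rate now exceeds half of \<open>\<kappa>\<^sub>7\<close>, so it suffices to bound
  every summand by a constant: the gradient through the optimality gap, the consensus error through
  the energy.\<close>

lemma avg_le_large_step:
  assumes large: "\<alpha> > \<kappa>\<^sub>7 P / 2"
  shows "avg \<le> (2 * lip P + 1 / \<epsilon>\<^sub>1 P) * lyapunov_const P * (2 / \<kappa>\<^sub>7 P) * rate"
proof -
  have "grad_sq k + (1 / real n) * cons_err k \<le> (2 * lip P + 1 / \<epsilon>\<^sub>1 P) * lyapunov_const P" if "k < T" for k
  proof -
    have L: "Lyap k \<le> real n * lyapunov_const P" using Lyap_le that by simp
    have e0: "energy k \<ge> 0" using cons_err_le_energy[of k] by linarith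
    then have "\<epsilon>\<^sub>1 P * energy k \<ge> 0" using eps1(1) by simp
    then have gap: "gap k \<le> real n * lyapunov_const P" using energy_le[of k] L by linarith
    have "grad_sq k \<le> 2 * lip P * (avg_fun n f (xb k) - f_star n d f)"
      unfolding grad_sq_def using norm2_grad_avg_fun_le[where f = f, OF n_pos(1) sm lip_pos bdd xb_carrier] .
    also have "\<dots> \<le> 2 * lip P * lyapunov_const P"
      using gap n_pos(2) lip_pos unfolding gap_def by (intro mult_left_mono) auto
    finally have g: "grad_sq k \<le> 2 * lip P * lyapunov_const P" .
    have "\<epsilon>\<^sub>1 P * cons_err k \<le> \<epsilon>\<^sub>1 P * energy k" using cons_err_le_energy(2) eps1(1) by (intro mult_left_mono) auto
    then have "\<epsilon>\<^sub>1 P * cons_err k \<le> real n * lyapunov_const P" using energy_le[of k] gap_nonneg[of k] L by linarith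
    then have "(1 / real n) * cons_err k \<le> 1 / \<epsilon>\<^sub>1 P * lyapunov_const P" using eps1(1) n_pos(2) by (simp add: field_simps)
    then show ?thesis using g by (simp add: distrib_right)
  qed
  then have "(\<Sum>k<T. grad_sq k + (1 / real n) * cons_err k) \<le> (\<Sum>k<T. (2 * lip P + 1 / \<epsilon>\<^sub>1 P) * lyapunov_const P)"
    by (intro sum_mono) auto
  then have a: "avg \<le> (2 * lip P + 1 / \<epsilon>\<^sub>1 P) * lyapunov_const P * 1" unfolding avg_def using T by (simp add: field_simps)
  have "1 \<le> 2 / \<kappa>\<^sub>7 P * rate" using large rate(3) kappa7_pos by (simp add: field_simps)
  then have "(2 * lip P + 1 / \<epsilon>\<^sub>1 P) * lyapunov_const P * 1 \<le> (2 * lip P + 1 / \<epsilon>\<^sub>1 P) * lyapunov_const P * (2 / \<kappa>\<^sub>7 P * rate)"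
    using lip_pos eps1(1) lyapunov_const_nonneg by (intro mult_left_mono) auto
  with a show ?thesis by (simp only: mult.assoc)
qed

lemma gap_T: "avg_fun n f (xb T) - f_star n d f \<le> lyapunov_const P" "0 \<le> avg_fun n f (xb T) - f_star n d f"
proof -
  have e0: "energy T \<ge> 0" using cons_err_le_energy[of T] by linarith
  then have "\<epsilon>\<^sub>1 P * energy T \<ge> 0" using eps1(1) by simp
  then have "gap T \<le> real n * lyapunov_const P" using energy_le[of T] Lyap_le[of T] by linarith
  then show "avg_fun n f (xb T) - f_star n d f \<le> lyapunov_const P" unfolding gap_def by simp
  show "0 \<le> avg_fun n f (xb T) - f_star n d f"
    using gap_nonneg[of T] n_pos(1) unfolding gap_def by (auto simp: zero_le_mult_iff)
qed

end

section \<open>The bound uniform in network, dimension and horizon\<close>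

lemma d_hat_pos: "d > 0 \<Longrightarrow> d_hat d p > 0"
  by (simp add: d_hat_def)

text \<open>By the first entry, the square of \<open>\<kappa>\<^sub>7\<close> times sqrt n * dt^2 *
  T exceeds 1, while the square of the step size times the same factor equals 1. Positivity of
  \<open>\<kappa>\<^sub>7\<close> permits taking roots.\<close>

lemma step_size_le_kappa7:
  assumes "n > 0" "T > 0" "dt > 0" "\<kappa>\<^sub>7 P > 0"
    and "real T > \<kappa>\<^sub>3_tilde P n dt L10 (step_size n dt T)"
  shows "step_size n dt T \<le> \<kappa>\<^sub>7 P"
proof -
  define \<alpha> where "\<alpha> = step_size n dt T"
  define S where "S = sqrt (real n) * dt\<^sup>2"
  have S: "S > 0" unfolding S_def using assms by simp
  have "1 / (sqrt (real n) * dt\<^sup>2 * (\<kappa>\<^sub>7 P)\<^sup>2) < real T"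
    using assms(5) unfolding \<kappa>\<^sub>3_tilde_def by (simp add: Max_less_iff)
  then have "1 / (S * (\<kappa>\<^sub>7 P)\<^sup>2) < real T" unfolding S_def .
  then have "1 < (\<kappa>\<^sub>7 P)\<^sup>2 * (S * real T)" using S assms(4) by (simp add: field_simps)
  moreover have "\<alpha>\<^sup>2 * (S * real T) = 1" unfolding \<alpha>_def S_def using step_size_sq(1)[OF assms(1-3)] .
  ultimately have "\<alpha>\<^sup>2 * (S * real T) \<le> (\<kappa>\<^sub>7 P)\<^sup>2 * (S * real T)" by simp
  then have "\<alpha>\<^sup>2 \<le> (\<kappa>\<^sub>7 P)\<^sup>2" using S assms(2) by simp
  then show ?thesis unfolding \<alpha>_def by (rule power2_le_imp_le) (use assms(4) in simp)
qed

theorem theorem1: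
  fixes P :: params
  assumes "lip P > 0"
    and "\<tau>\<^sub>1 P \<ge> \<kappa>\<^sub>1 P" and "\<beta> P = \<tau>\<^sub>1 P * \<gamma> P" and "\<gamma> P > \<kappa>\<^sub>2 P"
    and "scale P > 0" and "rad P > 0" and "0 < \<delta> P" and "\<delta> P \<le> 1"
    and "0 < \<omega> P" and "\<omega> P \<le> 1 / scale P"
    and "kh P > 0"
    and "\<kappa>\<^sub>7 P > 0"
  shows "\<exists>M. \<forall>(n::nat) (d::nat) A U lam f f_low p \<C> (T::nat) s x v q xh y dt L L10 \<alpha> fbar xbar.
    n \<ge> 2 \<and> d \<ge> 1 \<and> connected_network n A \<and>
    L = laplacian n A \<and> laplacian_eigendecomp n L U lam \<and>
    \<rho> P = spectral_radius (map_mat complex_of_real L) \<and> \<rho>\<^sub>2 P = smallest_pos_eigenvalue L \<and>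
    (\<forall>i<n. smooth d (lip P) (f i)) \<and>
    fbar = avg_fun n f \<and> bdd_below (fbar ` carrier_vec d) \<and> (f_low::real) \<le> f_star n d f \<and>
    1 \<le> p \<and> dh P = d_hat d p \<and> dt = d_tilde d p \<and>
    locally_bounded_compressor d p (scale P) (rad P) (\<delta> P) \<C> \<and>
    T > 0 \<and> \<alpha> = step_size n dt T \<and>
    unified_compression n d L \<C> f \<alpha> (\<beta> P) (\<gamma> P) (\<omega> P) s x v q xh y \<and>
    L10 = lyapunov n d U lam f (\<beta> P) (\<gamma> P) (\<lambda>i. x i 0) (\<lambda>i. v i 0) \<and> lyap0 P = L10 / real n \<and>
    real T > \<kappa>\<^sub>3_tilde P n dt L10 \<alpha> \<and>
    (\<forall>k. s k > 0) \<and> s 0 = s\<^sub>0 P \<and> s\<^sub>0 P \<ge> Max ((\<lambda>i. pnorm p (x i 0)) ` {..<n}) / rad P \<and>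
    (\<forall>k\<in>{1..T}. (s k)^2 = (1 - \<epsilon>\<^sub>8 P) * (s (k - 1))^2 + \<kappa>\<^sub>4_tilde P n dt L10 \<alpha> T) \<and>
    xbar = (\<lambda>k. mean_vec n d (\<lambda>i. x i k))
    \<longrightarrow>
    \<bar>(1 / real T) * (\<Sum>k<T. (norm2 (grad d fbar (xbar k)))^2
        + (1 / real n) * (\<Sum>i<n. (norm2 (x i k - xbar k))^2))\<bar>
      \<le> M * (real n powr (1 / 4) * dt / sqrt (real T)) \<and>
    \<bar>fbar (xbar T) - f_star n d f\<bar> \<le> M"
proof -
  \<comment> \<open>The constants are formed from P before any network, dimension or horizon is
    fixed. M1 serves small steps and M2 large ones; \<open>lyapunov_const\<close> in the witness
    serves the final optimality gap.\<close>
  define M1 where "M1 = lyapunov_const P / min (\<phi>\<^sub>1 P / 2) (1 / 4)"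
  define M2 where "M2 = (2 * lip P + 1 / \<epsilon>\<^sub>1 P) * lyapunov_const P * (2 / \<kappa>\<^sub>7 P)"
  show ?thesis
  proof (rule exI[where x = "max (lyapunov_const P) (max M1 M2)"], intro allI impI, goal_cases)
    case (1 n d A U lam f f_low p \<C> T s x v q xh y dt L L10 \<alpha> fbar xbar)
    then have n: "n \<ge> 2" and d: "d > 0" and ed: "laplacian_eigendecomp n L U lam"
      and rho: "\<rho> P = spectral_radius (map_mat complex_of_real L)" and rho2: "\<rho>\<^sub>2 P = smallest_pos_eigenvalue L"
      and sm: "\<And>i. i < n \<Longrightarrow> smooth d (lip P) (f i)"
      and fbar: "fbar = avg_fun n f" and bdd: "bdd_below (fbar ` carrier_vec d)"
      and p: "1 \<le> p" and dh: "dh P = d_hat d p" and dt: "dt = d_tilde d p"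
      and comp: "locally_bounded_compressor d p (scale P) (rad P) (\<delta> P) \<C>"
      and T: "T > 0" and \<alpha>: "\<alpha> = step_size n dt T"
      and run: "unified_compression n d L \<C> f \<alpha> (\<beta> P) (\<gamma> P) (\<omega> P) s x v q xh y"
      and L10: "L10 = lyapunov n d U lam f (\<beta> P) (\<gamma> P) (\<lambda>i. x i 0) (\<lambda>i. v i 0)"
      and lyap0: "lyap0 P = L10 / real n"
      and large: "real T > \<kappa>\<^sub>3_tilde P n dt L10 \<alpha>"
      and s: "\<And>k. s k > 0" "s 0 = s\<^sub>0 P" "s\<^sub>0 P \<ge> Max ((\<lambda>i. pnorm p (x i 0)) ` {..<n}) / rad P"
        "\<And>k. k \<in> {1..T} \<Longrightarrow> (s k)\<^sup>2 = (1 - \<epsilon>\<^sub>8 P) * (s (k - 1))\<^sup>2 + \<kappa>\<^sub>4_tilde P n dt L10 \<alpha> T"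
      and xbar: "xbar = (\<lambda>k. mean_vec n d (\<lambda>i. x i k))"
      by (elim conjE; simp)+
    have n0: "n > 0" using n by simp
    have dt0: "dt > 0" unfolding dt using d_tilde_ge_1[OF d, of p] by simp
    have lam: "\<rho> P = lam n" "\<rho>\<^sub>2 P = lam 2"
      unfolding rho rho2 using laplacian_spectrum[OF ed n] by simp_all
    have lam_pos: "0 < lam 2" "lam 2 \<le> lam n"
      using ed n unfolding laplacian_eigendecomp_def by auto
    have \<alpha>_le: "\<alpha> \<le> \<kappa>\<^sub>7 P"
      unfolding \<alpha> by (rule step_size_le_kappa7[OF n0 T dt0 assms(12)]) (use large \<alpha> in simp)
    have \<alpha>_pos: "\<alpha> > 0" unfolding \<alpha> by (rule step_size_sq(2)[OF n0 T dt0])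
    \<comment> \<open>The network supplies the conditions on \<rho>, the dimension that on dh, and
      the scalings that on the initial value of s.\<close>
    interpret compression_params P
      by unfold_locales (use assms lam lam_pos d_hat_pos[OF d] dh s(1)[of 0] s(2) in auto)
    interpret compression_schedule P n d U L lam f p \<C> s x v q xh y \<alpha> T dt L10
      by unfold_locales
        (use n d ed lam sm bdd[unfolded fbar] p dh comp run \<alpha>_pos \<alpha>_le s T \<alpha> dt L10 lyap0 large in auto)
    have xb: "xbar = xb" unfolding xbar xb_def[abs_def] ..
    have avg: "(1 / real T) * (\<Sum>k<T. (norm2 (grad d fbar (xbar k)))\<^sup>2
        + (1 / real n) * (\<Sum>i<n. (norm2 (x i k - xbar k))\<^sup>2)) = avg"
      unfolding avg_def grad_sq_def cons_err_def fbar xb ..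
    have "avg \<le> max M1 M2 * rate"
    proof (cases "\<alpha> \<le> \<kappa>\<^sub>7 P / 2")
      case True
      then have "avg \<le> M1 * rate" unfolding M1_def by (rule avg_le_small_step)
      also have "\<dots> \<le> max M1 M2 * rate" using rate(2) by (intro mult_right_mono) auto
      finally show ?thesis .
    next
      case False
      then have "avg \<le> M2 * rate" unfolding M2_def using avg_le_large_step by simp
      also have "\<dots> \<le> max M1 M2 * rate" using rate(2) by (intro mult_right_mono) auto
      finally show ?thesis .
    qed
    also have "\<dots> \<le> max (lyapunov_const P) (max M1 M2) * rate" using rate(2) by (intro mult_right_mono) auto
    finally have "\<bar>avg\<bar> \<le> max (lyapunov_const P) (max M1 M2) * rate" using avg_nonneg by simp
    moreover have "\<bar>fbar (xbar T) - f_star n d f\<bar> \<le> max (lyapunov_const P) (max M1 M2)"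
      unfolding fbar xb using gap_T by simp
    ultimately show ?case unfolding avg rate_def by blast
  qed
qed

end
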